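(* Let $\mathcal S$ be a special pre-abelian category consisting of group objects and let $\mathcal S_1$ be its full subcategory of objects killed by $p$. Let $(C^{(n)},i^{(n)})_{n\geqslant0}$ be a $p$-divisible group in $\mathcal S$ and suppose there are objects $D_1,D_2\in\mathcal S_1$ and a short exact sequence $0\to D_1\to C^{(1)}\to D_2\to0$ in $\mathcal S_1$, and that $\mathrm{Ext}_{\mathcal S_1}(D_1,D_2)=0$. Then there is a short exact sequence of $p$-divisible groups $0\to(C_1^{(n)},i_1^{(n)})_{n\geqslant0}\to(C^{(n)},i^{(n)})_{n\geqslant0}\to(C_2^{(n)},i_2^{(n)})_{n\geqslant0}\to0$ in $\mathcal S$ with $C_1^{(1)}=D_1$ and $C_2^{(1)}=D_2$.
   Context: $p$ is a fixed prime. A pre-abelian category is an additive category in which every morphism has a kernel and a cokernel. A morphism $u$ is strict if the canonical morphism $\mathrm{Coker}(\mathrm{Ker}\,u)\to\mathrm{Ker}(\mathrm{Coker}\,u)$ is an isomorphism. A sequence $0\to A_1\xrightarrow{i}A\xrightarrow{j}A_2\to0$ is short exact if $(A_1,i)=\mathrm{Ker}\,j$ and $(A_2,j)=\mathrm{Coker}\,i$. A pre-abelian category is special if (A1) the pushout of a strict monomorphism along any morphism is a strict monomorphism, and (A2) the pullback of a strict epimorphism along any morphism is a strict epimorphism. "Consisting of group objects" means objects carry commutative group structures respected by morphisms. An object $A$ is killed by $p$ if $p\cdot\mathrm{id}_A=0$. $\mathrm{Ext}_{\mathcal S_1}(A_2,A_1)$ is the set of equivalence classes of short exact sequences $0\to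 A_1\to A\to A_2\to0$ in $\mathcal S_1$; $\mathrm{Ext}_{\mathcal S_1}(D_1,D_2)=0$ means every short exact sequence $0\to D_2\to E\to D_1\to0$ in $\mathcal S_1$ splits. A $p$-divisible group in $\mathcal S$ is an inductive system $(C^{(n)},i^{(n)})_{n\geqslant0}$ with $C^{(0)}=0$ and strict monomorphisms $i^{(n)}:C^{(n)}\to C^{(n+1)}$ such that, with $i_{mn}=i^{(n-1)}\circ\dots\circ i^{(m)}$, for all $0\leqslant m\leqslant n$: (a) there are $j_{n,n-m}:C^{(n)}\to C^{(n-m)}$ making $0\to C^{(m)}\xrightarrow{i_{mn}}C^{(n)}\xrightarrow{j_{n,n-m}}C^{(n-m)}\to0$ short exact; (b) $i_{n-m,n}\circ j_{n,n-m}=p^m\,\mathrm{id}_{C^{(n)}}$. A sequence $0\to(C_1^{(n)})\xrightarrow{(\gamma_n)}(C^{(n)})\xrightarrow{(\delta_n)}(C_2^{(n)})\to0$ of $p$-divisible groups is short exact if for all $n\geqslant1$ the sequences $0\to C_1^{(n)}\xrightarrow{\gamma_n}C^{(n)}\xrightarrow{\delta_n}C_2^{(n)}\to0$ are short exact in $\mathcal S$ and $\gamma_{n+1}\circ i_1^{(n)}=i^{(n)}\circ\gamma_n$, $\delta_{n+1}\circ i^{(n)}=i_2^{(n)}\circ\delta_n$. *)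

theory Defs
  imports "HOL-Algebra.Group" "HOL-Computational_Algebra.Primes"
begin

section \<open>Categories\<close>

record ('o, 'a) category =
  Obj :: "'o set"
  Arr :: "'a set"
  Dom :: "'a \<Rightarrow> 'o"
  Cod :: "'a \<Rightarrow> 'o"
  Ide :: "'o \<Rightarrow> 'a"
  Comp :: "'a \<Rightarrow> 'a \<Rightarrow> 'a"  (infixl "\<cdot>\<index>" 70)

definition homset :: "('o, 'a, 'm) category_scheme \<Rightarrow> 'o \<Rightarrow> 'o \<Rightarrow> 'a set" where
  "homset S A B = {f \<in> Arr S. Dom S f = A \<and> Cod S f = B}"

text \<open>Composition is in the usual order, and is only constrained on composable arrows.\<close>

locale category =
  fixes S :: "('o, 'a, 'm) category_scheme" (structure)
  assumes dom_obj: "f \<in> Arr S \<Longrightarrow> Dom S f \<in> Obj S"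
    and cod_obj: "f \<in> Arr S \<Longrightarrow> Cod S f \<in> Obj S"
    and ide_hom: "A \<in> Obj S \<Longrightarrow> Ide S A \<in> homset S A A"
    and comp_hom: "\<lbrakk>f \<in> homset S A B; g \<in> homset S B C\<rbrakk> \<Longrightarrow> g \<cdot> f \<in> homset S A C"
    and comp_assoc:
      "\<lbrakk>f \<in> homset S A B; g \<in> homset S B C; h \<in> homset S C D\<rbrakk> \<Longrightarrow> (h \<cdot> g) \<cdot> f = h \<cdot> (g \<cdot> f)"
    and comp_ide_right: "f \<in> homset S A B \<Longrightarrow> f \<cdot> Ide S A = f"
    and comp_ide_left: "f \<in> homset S A B \<Longrightarrow> Ide S B \<cdot> f = f"

definition full_subcategory ::
    "('o, 'a, 'm) category_scheme \<Rightarrow> 'o set \<Rightarrow> ('o, 'a, 'm) category_scheme" where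
  "full_subcategory S X =
     S\<lparr>Obj := Obj S \<inter> X, Arr := {f \<in> Arr S. Dom S f \<in> X \<and> Cod S f \<in> X}\<rparr>"

definition is_mono :: "('o, 'a, 'm) category_scheme \<Rightarrow> 'a \<Rightarrow> bool" where
  "is_mono S f \<longleftrightarrow> f \<in> Arr S \<and>
     (\<forall>X\<in>Obj S. \<forall>x\<in>homset S X (Dom S f). \<forall>y\<in>homset S X (Dom S f).
        f \<cdot>\<^bsub>S\<^esub> x = f \<cdot>\<^bsub>S\<^esub> y \<longrightarrow> x = y)"

definition is_epi :: "('o, 'a, 'm) category_scheme \<Rightarrow> 'a \<Rightarrow> bool" where
  "is_epi S f \<longleftrightarrow> f \<in> Arr S \<and>
     (\<forall>X\<in>Obj S. \<forall>x\<in>homset S (Cod S f) X. \<forall>y\<in>homset S (Cod S f) X.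
        x \<cdot>\<^bsub>S\<^esub> f = y \<cdot>\<^bsub>S\<^esub> f \<longrightarrow> x = y)"

definition is_iso :: "('o, 'a, 'm) category_scheme \<Rightarrow> 'a \<Rightarrow> bool" where
  "is_iso S f \<longleftrightarrow> f \<in> Arr S \<and>
     (\<exists>g\<in>homset S (Cod S f) (Dom S f).
        g \<cdot>\<^bsub>S\<^esub> f = Ide S (Dom S f) \<and> f \<cdot>\<^bsub>S\<^esub> g = Ide S (Cod S f))"

definition is_initial :: "('o, 'a, 'm) category_scheme \<Rightarrow> 'o \<Rightarrow> bool" where
  "is_initial S Z \<longleftrightarrow> Z \<in> Obj S \<and> (\<forall>X\<in>Obj S. \<exists>!f. f \<in> homset S Z X)"

definition is_terminal :: "('o, 'a, 'm) category_scheme \<Rightarrow> 'o \<Rightarrow> bool" where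
  "is_terminal S Z \<longleftrightarrow> Z \<in> Obj S \<and> (\<forall>X\<in>Obj S. \<exists>!f. f \<in> homset S X Z)"

definition is_zero_object :: "('o, 'a, 'm) category_scheme \<Rightarrow> 'o \<Rightarrow> bool" where
  "is_zero_object S Z \<longleftrightarrow> is_initial S Z \<and> is_terminal S Z"

definition is_product ::
    "('o, 'a, 'm) category_scheme \<Rightarrow> 'o \<Rightarrow> 'o \<Rightarrow> 'o \<Rightarrow> 'a \<Rightarrow> 'a \<Rightarrow> bool" where
  "is_product S A B P \<pi>\<^sub>1 \<pi>\<^sub>2 \<longleftrightarrow> P \<in> Obj S \<and> \<pi>\<^sub>1 \<in> homset S P A \<and> \<pi>\<^sub>2 \<in> homset S P B \<and>
     (\<forall>X\<in>Obj S. \<forall>x\<in>homset S X A. \<forall>y\<in>homset S X B.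
        \<exists>!h. h \<in> homset S X P \<and> \<pi>\<^sub>1 \<cdot>\<^bsub>S\<^esub> h = x \<and> \<pi>\<^sub>2 \<cdot>\<^bsub>S\<^esub> h = y)"

text \<open>\<open>is_pushout S f g f' g'\<close>: the arrow \<open>f'\<close> is the pushout of \<open>f\<close> along \<open>g\<close>.
  Dually, in \<open>is_pullback S f g f' g'\<close>, the arrow \<open>f'\<close> is the pullback of \<open>f\<close> along \<open>g\<close>.\<close>

definition is_pushout ::
    "('o, 'a, 'm) category_scheme \<Rightarrow> 'a \<Rightarrow> 'a \<Rightarrow> 'a \<Rightarrow> 'a \<Rightarrow> bool" where
  "is_pushout S f g f' g' \<longleftrightarrow>
     f \<in> Arr S \<and> g \<in> Arr S \<and> f' \<in> Arr S \<and> g' \<in> Arr S \<and>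
     Dom S f = Dom S g \<and> Dom S g' = Cod S f \<and> Dom S f' = Cod S g \<and> Cod S f' = Cod S g' \<and>
     g' \<cdot>\<^bsub>S\<^esub> f = f' \<cdot>\<^bsub>S\<^esub> g \<and>
     (\<forall>X\<in>Obj S. \<forall>x\<in>homset S (Cod S f) X. \<forall>y\<in>homset S (Cod S g) X.
        x \<cdot>\<^bsub>S\<^esub> f = y \<cdot>\<^bsub>S\<^esub> g \<longrightarrow>
        (\<exists>!h. h \<in> homset S (Cod S f') X \<and> h \<cdot>\<^bsub>S\<^esub> g' = x \<and> h \<cdot>\<^bsub>S\<^esub> f' = y))"

definition is_pullback ::
    "('o, 'a, 'm) category_scheme \<Rightarrow> 'a \<Rightarrow> 'a \<Rightarrow> 'a \<Rightarrow> 'a \<Rightarrow> bool" where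
  "is_pullback S f g f' g' \<longleftrightarrow>
     f \<in> Arr S \<and> g \<in> Arr S \<and> f' \<in> Arr S \<and> g' \<in> Arr S \<and>
     Cod S f = Cod S g \<and> Cod S g' = Dom S f \<and> Cod S f' = Dom S g \<and> Dom S f' = Dom S g' \<and>
     f \<cdot>\<^bsub>S\<^esub> g' = g \<cdot>\<^bsub>S\<^esub> f' \<and>
     (\<forall>X\<in>Obj S. \<forall>x\<in>homset S X (Dom S f). \<forall>y\<in>homset S X (Dom S g).
        f \<cdot>\<^bsub>S\<^esub> x = g \<cdot>\<^bsub>S\<^esub> y \<longrightarrow>
        (\<exists>!h. h \<in> homset S X (Dom S f') \<and> g' \<cdot>\<^bsub>S\<^esub> h = x \<and> f' \<cdot>\<^bsub>S\<^esub> h = y))"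


section \<open>Additive and pre-abelian categories\<close>

record ('o, 'a) additive_category = "('o, 'a) category" +
  AddArr :: "'a \<Rightarrow> 'a \<Rightarrow> 'a"
  ZeroArr :: "'o \<Rightarrow> 'o \<Rightarrow> 'a"

definition hom_group :: "('o, 'a, 'm) additive_category_scheme \<Rightarrow> 'o \<Rightarrow> 'o \<Rightarrow> 'a monoid" where
  "hom_group S A B =
     \<lparr>carrier = homset S A B, monoid.mult = AddArr S, one = ZeroArr S A B\<rparr>"

definition nat_mult :: "('o, 'a, 'm) additive_category_scheme \<Rightarrow> nat \<Rightarrow> 'a \<Rightarrow> 'a" where
  "nat_mult S n f = f [^]\<^bsub>hom_group S (Dom S f) (Cod S f)\<^esub> n"

locale additive_category = category S
  for S :: "('o, 'a, 'm) additive_category_scheme" (structure) +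
  assumes hom_comm_group: "\<lbrakk>A \<in> Obj S; B \<in> Obj S\<rbrakk> \<Longrightarrow> comm_group (hom_group S A B)"
    and comp_add_right: "\<lbrakk>f \<in> homset S A B; f' \<in> homset S A B; g \<in> homset S B C\<rbrakk>
      \<Longrightarrow> g \<cdot> AddArr S f f' = AddArr S (g \<cdot> f) (g \<cdot> f')"
    and comp_add_left: "\<lbrakk>f \<in> homset S A B; g \<in> homset S B C; g' \<in> homset S B C\<rbrakk>
      \<Longrightarrow> AddArr S g g' \<cdot> f = AddArr S (g \<cdot> f) (g' \<cdot> f)"
    and zero_object: "\<exists>Z. is_zero_object S Z"
    and binary_products: "\<lbrakk>A \<in> Obj S; B \<in> Obj S\<rbrakk> \<Longrightarrow> \<exists>P \<pi>\<^sub>1 \<pi>\<^sub>2. is_product S A B P \<pi>\<^sub>1 \<pi>\<^sub>2"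

definition is_kernel :: "('o, 'a, 'm) additive_category_scheme \<Rightarrow> 'a \<Rightarrow> 'a \<Rightarrow> bool" where
  "is_kernel S k f \<longleftrightarrow> f \<in> Arr S \<and> k \<in> Arr S \<and> Cod S k = Dom S f \<and>
     f \<cdot>\<^bsub>S\<^esub> k = ZeroArr S (Dom S k) (Cod S f) \<and>
     (\<forall>X\<in>Obj S. \<forall>x\<in>homset S X (Dom S f). f \<cdot>\<^bsub>S\<^esub> x = ZeroArr S X (Cod S f) \<longrightarrow>
        (\<exists>!h. h \<in> homset S X (Dom S k) \<and> k \<cdot>\<^bsub>S\<^esub> h = x))"

definition is_cokernel :: "('o, 'a, 'm) additive_category_scheme \<Rightarrow> 'a \<Rightarrow> 'a \<Rightarrow> bool" where
  "is_cokernel S c f \<longleftrightarrow> f \<in> Arr S \<and> c \<in> Arr S \<and> Dom S c = Cod S f \<and>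
     c \<cdot>\<^bsub>S\<^esub> f = ZeroArr S (Dom S f) (Cod S c) \<and>
     (\<forall>X\<in>Obj S. \<forall>x\<in>homset S (Cod S f) X. x \<cdot>\<^bsub>S\<^esub> f = ZeroArr S (Dom S f) X \<longrightarrow>
        (\<exists>!h. h \<in> homset S (Cod S c) X \<and> h \<cdot>\<^bsub>S\<^esub> c = x))"

locale preabelian_category = additive_category +
  assumes has_kernel: "f \<in> Arr S \<Longrightarrow> \<exists>k. is_kernel S k f"
    and has_cokernel: "f \<in> Arr S \<Longrightarrow> \<exists>c. is_cokernel S c f"

text \<open>Here \<open>c\<close> is the coimage \<open>Coker (Ker u)\<close> and \<open>e\<close> the image \<open>Ker (Coker u)\<close>; the
  canonical morphism between them is the unique \<open>w\<close> with \<open>e \<cdot> w \<cdot> c = u\<close>. The choice of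
  kernels and cokernels is immaterial.\<close>

definition is_strict :: "('o, 'a, 'm) additive_category_scheme \<Rightarrow> 'a \<Rightarrow> bool" where
  "is_strict S u \<longleftrightarrow>
     (\<exists>k c d e w. is_kernel S k u \<and> is_cokernel S c k \<and> is_cokernel S d u \<and> is_kernel S e d \<and>
        w \<in> homset S (Cod S c) (Dom S e) \<and> e \<cdot>\<^bsub>S\<^esub> w \<cdot>\<^bsub>S\<^esub> c = u \<and> is_iso S w)"

definition is_strict_mono :: "('o, 'a, 'm) additive_category_scheme \<Rightarrow> 'a \<Rightarrow> bool" where
  "is_strict_mono S f \<longleftrightarrow> is_mono S f \<and> is_strict S f"

definition is_strict_epi :: "('o, 'a, 'm) additive_category_scheme \<Rightarrow> 'a \<Rightarrow> bool" where
  "is_strict_epi S f \<longleftrightarrow> is_epi S f \<and> is_strict S f"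

locale special_preabelian_category = preabelian_category +
  assumes pushout_strict_mono: "\<lbrakk>is_strict_mono S f; is_pushout S f g f' g'\<rbrakk> \<Longrightarrow> is_strict_mono S f'"
    and pullback_strict_epi: "\<lbrakk>is_strict_epi S f; is_pullback S f g f' g'\<rbrakk> \<Longrightarrow> is_strict_epi S f'"

definition short_exact ::
    "('o, 'a, 'm) additive_category_scheme \<Rightarrow> 'o \<Rightarrow> 'a \<Rightarrow> 'o \<Rightarrow> 'a \<Rightarrow> 'o \<Rightarrow> bool" where
  "short_exact S A\<^sub>1 i A j A\<^sub>2 \<longleftrightarrow>
     i \<in> homset S A\<^sub>1 A \<and> j \<in> homset S A A\<^sub>2 \<and> is_kernel S i j \<and> is_cokernel S j i"

definition splits :: "('o, 'a, 'm) additive_category_scheme \<Rightarrow> 'a \<Rightarrow> bool" where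
  "splits S j \<longleftrightarrow> (\<exists>s\<in>homset S (Cod S j) (Dom S j). j \<cdot>\<^bsub>S\<^esub> s = Ide S (Cod S j))"

text \<open>\<open>Ext S A\<^sub>2 A\<^sub>1 = 0\<close>, where the elements of \<open>Ext S A\<^sub>2 A\<^sub>1\<close> are classes of short exact
  sequences with subobject \<open>A\<^sub>1\<close> and quotient \<open>A\<^sub>2\<close>.\<close>

definition Ext_vanishes :: "('o, 'a, 'm) additive_category_scheme \<Rightarrow> 'o \<Rightarrow> 'o \<Rightarrow> bool" where
  "Ext_vanishes S A\<^sub>2 A\<^sub>1 \<longleftrightarrow> (\<forall>E i j. short_exact S A\<^sub>1 i E j A\<^sub>2 \<longrightarrow> splits S j)"


section \<open>Group objects\<close>

text \<open>The data of a group object on \<open>A\<close>: a chosen product of \<open>A\<close> with itself, the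
  multiplication on it, and the unit, an arrow to \<open>A\<close> from a terminal object.\<close>

record ('o, 'a) group_object =
  Square :: 'o
  Proj1 :: 'a
  Proj2 :: 'a
  Mul :: 'a
  Unit :: 'a

definition pairing ::
    "('o, 'a, 'm) category_scheme \<Rightarrow> ('o, 'a) group_object \<Rightarrow> 'a \<Rightarrow> 'a \<Rightarrow> 'a" where
  "pairing S M x y =
     (THE h. h \<in> homset S (Dom S x) (Square M) \<and> Proj1 M \<cdot>\<^bsub>S\<^esub> h = x \<and> Proj2 M \<cdot>\<^bsub>S\<^esub> h = y)"

text \<open>The induced structure on the \<open>X\<close>-valued points of \<open>A\<close>. By Yoneda, the group object
  axioms amount to these being commutative groups for all \<open>X\<close>.\<close>

definition points ::
    "('o, 'a, 'm) category_scheme \<Rightarrow> 'o \<Rightarrow> ('o, 'a) group_object \<Rightarrow> 'o \<Rightarrow> 'a monoid" where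
  "points S A M X =
     \<lparr>carrier = homset S X A,
      monoid.mult = (\<lambda>x y. Mul M \<cdot>\<^bsub>S\<^esub> pairing S M x y),
      one = Unit M \<cdot>\<^bsub>S\<^esub> (THE t. t \<in> homset S X (Dom S (Unit M)))\<rparr>"

definition comm_group_object ::
    "('o, 'a, 'm) category_scheme \<Rightarrow> 'o \<Rightarrow> ('o, 'a) group_object \<Rightarrow> bool" where
  "comm_group_object S A M \<longleftrightarrow>
     is_product S A A (Square M) (Proj1 M) (Proj2 M) \<and> Mul M \<in> homset S (Square M) A \<and>
     is_terminal S (Dom S (Unit M)) \<and> Unit M \<in> homset S (Dom S (Unit M)) A \<and>
     (\<forall>X\<in>Obj S. comm_group (points S A M X))"

definition group_object_hom ::
    "('o, 'a, 'm) category_scheme \<Rightarrow> ('o, 'a) group_object \<Rightarrow> ('o, 'a) group_object \<Rightarrow> 'a \<Rightarrow> bool" where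
  "group_object_hom S M N f \<longleftrightarrow>
     f \<cdot>\<^bsub>S\<^esub> Mul M = Mul N \<cdot>\<^bsub>S\<^esub> pairing S N (f \<cdot>\<^bsub>S\<^esub> Proj1 M) (f \<cdot>\<^bsub>S\<^esub> Proj2 M)"

definition consists_of_group_objects :: "('o, 'a, 'm) category_scheme \<Rightarrow> bool" where
  "consists_of_group_objects S \<longleftrightarrow>
     (\<exists>M. (\<forall>A\<in>Obj S. comm_group_object S A (M A)) \<and>
          (\<forall>f\<in>Arr S. group_object_hom S (M (Dom S f)) (M (Cod S f)) f))"


section \<open>\<open>p\<close>-divisible groups\<close>

definition killed_by :: "('o, 'a, 'm) additive_category_scheme \<Rightarrow> nat \<Rightarrow> 'o \<Rightarrow> bool" where
  "killed_by S p A \<longleftrightarrow> nat_mult S p (Ide S A) = ZeroArr S A A"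

definition killed_subcategory ::
    "('o, 'a, 'm) additive_category_scheme \<Rightarrow> nat \<Rightarrow> ('o, 'a, 'm) additive_category_scheme" where
  "killed_subcategory S p = full_subcategory S {A \<in> Obj S. killed_by S p A}"

text \<open>\<open>iter_trans S C i m k\<close> is the composite
  \<open>i (m + k - 1) \<cdot> \<dots> \<cdot> i m\<close> from \<open>C m\<close> to \<open>C (m + k)\<close>.\<close>

primrec iter_trans ::
    "('o, 'a, 'm) category_scheme \<Rightarrow> (nat \<Rightarrow> 'o) \<Rightarrow> (nat \<Rightarrow> 'a) \<Rightarrow> nat \<Rightarrow> nat \<Rightarrow> 'a" where
  "iter_trans S C i m 0 = Ide S (C m)"
| "iter_trans S C i m (Suc k) = i (m + k) \<cdot>\<^bsub>S\<^esub> iter_trans S C i m k"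

definition trans_map ::
    "('o, 'a, 'm) category_scheme \<Rightarrow> (nat \<Rightarrow> 'o) \<Rightarrow> (nat \<Rightarrow> 'a) \<Rightarrow> nat \<Rightarrow> nat \<Rightarrow> 'a" where
  "trans_map S C i m n = iter_trans S C i m (n - m)"

definition p_divisible_group ::
    "('o, 'a, 'm) additive_category_scheme \<Rightarrow> nat \<Rightarrow> (nat \<Rightarrow> 'o) \<Rightarrow> (nat \<Rightarrow> 'a) \<Rightarrow> bool" where
  "p_divisible_group S p C i \<longleftrightarrow>
     (\<forall>n. C n \<in> Obj S) \<and> is_zero_object S (C 0) \<and>
     (\<forall>n. i n \<in> homset S (C n) (C (Suc n)) \<and> is_strict_mono S (i n)) \<and>
     (\<forall>m n. m \<le> n \<longrightarrow>
        (\<exists>j. short_exact S (C m) (trans_map S C i m n) (C n) j (C (n - m)) \<and>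
             trans_map S C i (n - m) n \<cdot>\<^bsub>S\<^esub> j = nat_mult S (p ^ m) (Ide S (C n))))"

definition short_exact_p_divisible ::
    "('o, 'a, 'm) additive_category_scheme \<Rightarrow> nat \<Rightarrow> (nat \<Rightarrow> 'o) \<Rightarrow> (nat \<Rightarrow> 'a) \<Rightarrow> (nat \<Rightarrow> 'a) \<Rightarrow>
     (nat \<Rightarrow> 'o) \<Rightarrow> (nat \<Rightarrow> 'a) \<Rightarrow> (nat \<Rightarrow> 'a) \<Rightarrow> (nat \<Rightarrow> 'o) \<Rightarrow> (nat \<Rightarrow> 'a) \<Rightarrow> bool" where
  "short_exact_p_divisible S p C\<^sub>1 i\<^sub>1 \<gamma> C i \<delta> C\<^sub>2 i\<^sub>2 \<longleftrightarrow>
     p_divisible_group S p C\<^sub>1 i\<^sub>1 \<and> p_divisible_group S p C i \<and> p_divisible_group S p C\<^sub>2 i\<^sub>2 \<and>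
     (\<forall>n. \<gamma> n \<in> homset S (C\<^sub>1 n) (C n) \<and> \<delta> n \<in> homset S (C n) (C\<^sub>2 n) \<and>
          \<gamma> (Suc n) \<cdot>\<^bsub>S\<^esub> i\<^sub>1 n = i n \<cdot>\<^bsub>S\<^esub> \<gamma> n \<and> \<delta> (Suc n) \<cdot>\<^bsub>S\<^esub> i n = i\<^sub>2 n \<cdot>\<^bsub>S\<^esub> \<delta> n) \<and>
     (\<forall>n\<ge>1. short_exact S (C\<^sub>1 n) (\<gamma> n) (C n) (\<delta> n) (C\<^sub>2 n))"

end

(* Call the cokernels covers. In a special pre-abelian category covers are stable under pullback
   and composition, so one may chase generalized elements X -> A as in an abelian category, at the
   price of replacing X by a cover X' -> X whenever a preimage is chosen; kernels compose by (A1).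

   Write C_n for C^(n). The subobjects H_n of C_n are built one level at a time from H_1 = D1. Let E
   be the preimage of H_n under C_(n+1) -> C_n. Then E / H_n is an extension of D1 by D2, and it is
   killed by p because p E is contained in H_n. Hence it splits, and a retraction E / H_n -> D2
   composed with E -> E / H_n has kernel H_(n+1). The subobjects satisfy H_(n+1) meet C_n = H_n and
   p H_(n+1) = H_n, which makes both (H_n) and (C_n / H_n) p-divisible. *)

theory Submission
  imports Defs
begin

section \<open>Arrows in additive categories\<close>

text \<open>An epimorphism need not be a cokernel here, nor a monomorphism a kernel, so covers and
  kernels take the place of surjections and subobjects, and both properties are carried along
  explicitly. The extension of D1 by D2 arises as follows. The kernel of p : C_(n+1) -> C_n is C_1,
  so E contains C_1 and E / C_1 = H_n. Since C_1 meets H_n in D1, the quotient C_1 / D1 = D2 embeds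
  into E / H_n. What is left is H_n / p H_n, and p^(n-1) identifies it with D1 provided that every
  element of H_n killed by p^(n-1) is divisible by p inside H_n. This proviso is therefore part of
  the invariant of the recursion and is re-established for H_(n+1). A complement of D2 in E / H_n
  pulls back to H_(n+1) with H_(n+1) + C_1 = E, whence p H_(n+1) = H_n, and with no more of C_1 in
  it than D1, from which H_(n+1) meet C_n = H_n follows.\<close>

context category
begin

lemma in_homset [simp]: "f \<in> homset S A B \<longleftrightarrow> f \<in> Arr S \<and> Dom S f = A \<and> Cod S f = B"
  by (auto simp: homset_def)

lemma comp_arr [simp]:
  assumes "f \<in> Arr S" "g \<in> Arr S" "Dom S g = Cod S f"
  shows "g \<cdot> f \<in> Arr S" "Dom S (g \<cdot> f) = Dom S f" "Cod S (g \<cdot> f) = Cod S g"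
  using comp_hom[of f "Dom S f" "Cod S f" g "Cod S g"] assms by auto

lemma comp_assoc_arr [simp]:
  assumes "f \<in> Arr S" "g \<in> Arr S" "h \<in> Arr S" "Dom S g = Cod S f" "Dom S h = Cod S g"
  shows "(h \<cdot> g) \<cdot> f = h \<cdot> (g \<cdot> f)"
  using comp_assoc[of f "Dom S f" "Cod S f" g "Cod S g" h "Cod S h"] assms by auto

text \<open>Composites are normalised to the right, so an equation for \<open>g \<cdot> f\<close> no
  longer matches inside \<open>g \<cdot> (f \<cdot> x)\<close>. This puts it into the matching form;
  nearly every diagram chase below rewrites through it.\<close>

lemma comp_reduce:
  assumes "g \<cdot> f = k" "f \<in> Arr S" "g \<in> Arr S" "Dom S g = Cod S f" "x \<in> Arr S" "Cod S x = Dom S f"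
  shows "g \<cdot> (f \<cdot> x) = k \<cdot> x"
  using assms comp_assoc_arr[of x f g] by auto

lemma ide_arr [simp]:
  assumes "A \<in> Obj S"
  shows "Ide S A \<in> Arr S" "Dom S (Ide S A) = A" "Cod S (Ide S A) = A"
  using ide_hom[OF assms] by auto

lemma comp_ide [simp]:
  "\<lbrakk>f \<in> Arr S; Dom S f = A\<rbrakk> \<Longrightarrow> f \<cdot> Ide S A = f"
  "\<lbrakk>f \<in> Arr S; Cod S f = B\<rbrakk> \<Longrightarrow> Ide S B \<cdot> f = f"
  using comp_ide_right[of f A "Cod S f"] comp_ide_left[of f "Dom S f" B] by auto

lemma arr_obj [simp]:
  assumes "f \<in> Arr S"
  shows "Dom S f \<in> Obj S" "Cod S f \<in> Obj S"
  using assms by (simp_all add: dom_obj cod_obj)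

lemma hom_obj:
  assumes "f \<in> homset S A B"
  shows "A \<in> Obj S" "B \<in> Obj S"
  using assms by auto

lemma mono_cancel:
  assumes "is_mono S k" "k \<cdot> x = k \<cdot> y" "x \<in> Arr S" "y \<in> Arr S"
    "Cod S x = Dom S k" "Cod S y = Dom S k" "Dom S x = Dom S y"
  shows "x = y"
  using assms unfolding is_mono_def by (metis arr_obj(1) in_homset)

lemma epi_cancel:
  assumes "is_epi S k" "x \<cdot> k = y \<cdot> k" "x \<in> Arr S" "y \<in> Arr S"
    "Dom S x = Cod S k" "Dom S y = Cod S k" "Cod S x = Cod S y"
  shows "x = y"
  using assms unfolding is_epi_def by (metis arr_obj(2) in_homset)

lemma mono_arr: "is_mono S k \<Longrightarrow> k \<in> Arr S"
  and epi_arr: "is_epi S k \<Longrightarrow> k \<in> Arr S"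
  by (auto simp: is_mono_def is_epi_def)

lemma mono_ide: "A \<in> Obj S \<Longrightarrow> is_mono S (Ide S A)"
  and epi_ide: "A \<in> Obj S \<Longrightarrow> is_epi S (Ide S A)"
  by (auto simp: is_mono_def is_epi_def)

lemma mono_comp:
  assumes "is_mono S f" "is_mono S g" "Dom S g = Cod S f"
  shows "is_mono S (g \<cdot> f)"
proof -
  have fg: "f \<in> Arr S" "g \<in> Arr S"
    using assms mono_arr by auto
  have "x = y" if "X \<in> Obj S" "x \<in> homset S X (Dom S f)" "y \<in> homset S X (Dom S f)"
    "(g \<cdot> f) \<cdot> x = (g \<cdot> f) \<cdot> y" for X x y
  proof -
    have "f \<cdot> x = f \<cdot> y"
      using mono_cancel[OF assms(2), of "f \<cdot> x" "f \<cdot> y"] that fg assms by simp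
    then show ?thesis
      using mono_cancel[OF assms(1), of x y] that by simp
  qed
  then show ?thesis
    using fg assms by (auto simp: is_mono_def)
qed

lemma epi_comp:
  assumes "is_epi S f" "is_epi S g" "Dom S g = Cod S f"
  shows "is_epi S (g \<cdot> f)"
proof -
  have fg: "f \<in> Arr S" "g \<in> Arr S"
    using assms epi_arr by auto
  have "x = y" if "X \<in> Obj S" "x \<in> homset S (Cod S g) X" "y \<in> homset S (Cod S g) X"
    "x \<cdot> (g \<cdot> f) = y \<cdot> (g \<cdot> f)" for X x y
  proof -
    have "x \<cdot> g = y \<cdot> g"
      using epi_cancel[OF assms(1), of "x \<cdot> g" "y \<cdot> g"] that fg assms by simp
    then show ?thesis
      using epi_cancel[OF assms(2), of x y] that by simp
  qed
  then show ?thesis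
    using fg assms by (auto simp: is_epi_def)
qed

lemma mono_of_comp_mono:
  assumes "is_mono S (g \<cdot> f)" "f \<in> Arr S" "g \<in> Arr S" "Dom S g = Cod S f"
  shows "is_mono S f"
proof -
  have "x = y" if "X \<in> Obj S" "x \<in> homset S X (Dom S f)" "y \<in> homset S X (Dom S f)"
    "f \<cdot> x = f \<cdot> y" for X x y
    using mono_cancel[OF assms(1), of x y] that assms by simp
  then show ?thesis
    using assms by (auto simp: is_mono_def)
qed

lemma epi_of_comp_epi:
  assumes "is_epi S (g \<cdot> f)" "f \<in> Arr S" "g \<in> Arr S" "Dom S g = Cod S f"
  shows "is_epi S g"
proof -
  have "x = y" if "X \<in> Obj S" "x \<in> homset S (Cod S g) X" "y \<in> homset S (Cod S g) X"
    "x \<cdot> g = y \<cdot> g" for X x y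
    using epi_cancel[OF assms(1), of x y] that assms 
    by (metis comp_arr(3) comp_assoc_arr in_homset)
  then show ?thesis
    using assms by (auto simp: is_epi_def)
qed

end

section \<open>Hom groups, kernels and cokernels, integer multiples, covers, limits\<close>

context additive_category
begin

text \<open>The signature has only addition and zero, so the inverse is taken in the hom group,
  whose endpoints are read off \<open>f\<close>.\<close>

definition diff :: "'a \<Rightarrow> 'a \<Rightarrow> 'a" where
  "diff f g = AddArr S f (inv\<^bsub>hom_group S (Dom S f) (Cod S f)\<^esub> g)"

lemma hom_group_sel [simp]:
  "carrier (hom_group S A B) = homset S A B"
  "monoid.mult (hom_group S A B) = AddArr S"
  "one (hom_group S A B) = ZeroArr S A B"
  by (simp_all add: hom_group_def)

lemma zero_arr [simp]:
  assumes "A \<in> Obj S" "B \<in> Obj S"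
  shows "ZeroArr S A B \<in> Arr S" "Dom S (ZeroArr S A B) = A" "Cod S (ZeroArr S A B) = B"
proof -
  interpret comm_group "hom_group S A B" using hom_comm_group[OF assms] .
  show "ZeroArr S A B \<in> Arr S" "Dom S (ZeroArr S A B) = A" "Cod S (ZeroArr S A B) = B"
    using one_closed by simp_all
qed

lemma add_arr [simp]:
  assumes "f \<in> Arr S" "g \<in> Arr S" "Dom S g = Dom S f" "Cod S g = Cod S f"
  shows "AddArr S f g \<in> Arr S" "Dom S (AddArr S f g) = Dom S f" "Cod S (AddArr S f g) = Cod S f"
proof -
  interpret comm_group "hom_group S (Dom S f) (Cod S f)" using hom_comm_group assms by simp
  show "AddArr S f g \<in> Arr S" "Dom S (AddArr S f g) = Dom S f" "Cod S (AddArr S f g) = Cod S f"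
    using m_closed[of f g] assms by simp_all
qed

lemma diff_arr [simp]:
  assumes "f \<in> Arr S" "g \<in> Arr S" "Dom S g = Dom S f" "Cod S g = Cod S f"
  shows "diff f g \<in> Arr S" "Dom S (diff f g) = Dom S f" "Cod S (diff f g) = Cod S f"
proof -
  interpret comm_group "hom_group S (Dom S f) (Cod S f)" using hom_comm_group assms by simp
  show "diff f g \<in> Arr S" "Dom S (diff f g) = Dom S f" "Cod S (diff f g) = Cod S f"
    using inv_closed[of g] assms by (simp_all add: diff_def)
qed

lemma comp_add_arr [simp]:
  assumes "f \<in> Arr S" "g \<in> Arr S" "Dom S g = Dom S f" "Cod S g = Cod S f"
  shows "\<lbrakk>h \<in> Arr S; Dom S h = Cod S f\<rbrakk> \<Longrightarrow> h \<cdot> AddArr S f g = AddArr S (h \<cdot> f) (h \<cdot> g)"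
    and "\<lbrakk>h \<in> Arr S; Cod S h = Dom S f\<rbrakk> \<Longrightarrow> AddArr S f g \<cdot> h = AddArr S (f \<cdot> h) (g \<cdot> h)"
  using comp_add_right[of f "Dom S f" "Cod S f" g h "Cod S h"]
    comp_add_left[of h "Dom S h" "Dom S f" f "Cod S f" g] assms by simp_all

text \<open>Characterising \<open>diff\<close> by an equation between sums lets facts about
  differences, such as distributivity, be read off from those about \<open>AddArr\<close>.\<close>

lemma add_eq_iff_diff:
  assumes "f \<in> Arr S" "g \<in> Arr S" "Dom S g = Dom S f" "Cod S g = Cod S f"
    "h \<in> Arr S" "Dom S h = Dom S f" "Cod S h = Cod S f"
  shows "AddArr S h g = f \<longleftrightarrow> h = diff f g"
proof -
  interpret comm_group "hom_group S (Dom S f) (Cod S f)" using hom_comm_group assms by simp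
  show ?thesis
    using inv_solve_right[of h f g] assms by (auto simp: diff_def)
qed

lemma diff_add [simp]:
  assumes "f \<in> Arr S" "g \<in> Arr S" "Dom S g = Dom S f" "Cod S g = Cod S f"
  shows "AddArr S (diff f g) g = f"
  using assms add_eq_iff_diff[of f g "diff f g"] by simp

lemma comp_diff [simp]:
  assumes "f \<in> Arr S" "g \<in> Arr S" "Dom S g = Dom S f" "Cod S g = Cod S f"
  shows "\<lbrakk>h \<in> Arr S; Dom S h = Cod S f\<rbrakk> \<Longrightarrow> h \<cdot> diff f g = diff (h \<cdot> f) (h \<cdot> g)"
    and "\<lbrakk>h \<in> Arr S; Cod S h = Dom S f\<rbrakk> \<Longrightarrow> diff f g \<cdot> h = diff (f \<cdot> h) (g \<cdot> h)"
proof -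
  assume h: "h \<in> Arr S" "Dom S h = Cod S f"
  show "h \<cdot> diff f g = diff (h \<cdot> f) (h \<cdot> g)"
    using assms h by (subst add_eq_iff_diff[symmetric]) (simp_all flip: comp_add_arr)
next
  assume h: "h \<in> Arr S" "Cod S h = Dom S f"
  show "diff f g \<cdot> h = diff (f \<cdot> h) (g \<cdot> h)"
    using assms h by (subst add_eq_iff_diff[symmetric]) (simp_all flip: comp_add_arr)
qed

lemma diff_self [simp]:
  assumes "f \<in> Arr S"
  shows "diff f f = ZeroArr S (Dom S f) (Cod S f)"
proof -
  interpret comm_group "hom_group S (Dom S f) (Cod S f)" using hom_comm_group assms by simp
  show ?thesis
    using r_inv[of f] assms by (simp add: diff_def)
qed

lemma add_zero [simp]:
  assumes "f \<in> Arr S" "Dom S f = A" "Cod S f = B"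
  shows "AddArr S f (ZeroArr S A B) = f" "AddArr S (ZeroArr S A B) f = f"
proof -
  interpret comm_group "hom_group S (Dom S f) (Cod S f)" using hom_comm_group assms(1) by simp
  show "AddArr S f (ZeroArr S A B) = f" "AddArr S (ZeroArr S A B) f = f"
    using r_one[of f] l_one[of f] assms by auto
qed

lemma diff_zero [simp]:
  assumes "f \<in> Arr S" "Dom S f = A" "Cod S f = B"
  shows "diff f (ZeroArr S A B) = f"
  using assms add_eq_iff_diff[of f "ZeroArr S A B" f] by auto

lemma diff_eq_zeroD:
  assumes "diff f g = ZeroArr S A B"
    "f \<in> Arr S" "g \<in> Arr S" "Dom S g = A" "Cod S g = B" "Dom S f = A" "Cod S f = B"
  shows "f = g"
  using assms diff_add[of f g] by auto

text \<open>Zero is 0 - 0, and a difference of equal composites vanishes.\<close>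

lemma comp_zero [simp]:
  shows "\<lbrakk>f \<in> Arr S; Dom S f = A; X \<in> Obj S\<rbrakk> \<Longrightarrow> f \<cdot> ZeroArr S X A = ZeroArr S X (Cod S f)"
    and "\<lbrakk>f \<in> Arr S; Cod S f = B; Y \<in> Obj S\<rbrakk> \<Longrightarrow> ZeroArr S B Y \<cdot> f = ZeroArr S (Dom S f) Y"
proof -
  assume f: "f \<in> Arr S" "Dom S f = A" "X \<in> Obj S"
  have A: "A \<in> Obj S" using f by auto
  have "f \<cdot> diff (ZeroArr S X A) (ZeroArr S X A)
      = diff (f \<cdot> ZeroArr S X A) (f \<cdot> ZeroArr S X A)"
    by (rule comp_diff(1)) (use f A in simp_all)
  then show "f \<cdot> ZeroArr S X A = ZeroArr S X (Cod S f)"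
    using f A by simp
next
  assume f: "f \<in> Arr S" "Cod S f = B" "Y \<in> Obj S"
  have B: "B \<in> Obj S" using f by auto
  have "diff (ZeroArr S B Y) (ZeroArr S B Y) \<cdot> f
      = diff (ZeroArr S B Y \<cdot> f) (ZeroArr S B Y \<cdot> f)"
    by (rule comp_diff(2)) (use f B in simp_all)
  then show "ZeroArr S B Y \<cdot> f = ZeroArr S (Dom S f) Y"
    using f B by simp
qed

text \<open>Two arrows with the same composite are compared through their difference, so it suffices
  to test arrows killed by \<open>k\<close>.\<close>

lemma monoI:
  assumes "k \<in> Arr S"
    and "\<And>x. \<lbrakk>x \<in> Arr S; Cod S x = Dom S k; k \<cdot> x = ZeroArr S (Dom S x) (Cod S k)\<rbrakk>
      \<Longrightarrow> x = ZeroArr S (Dom S x) (Dom S k)"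
  shows "is_mono S k"
proof -
  have "x = y" if "x \<in> homset S X (Dom S k)" "y \<in> homset S X (Dom S k)" "k \<cdot> x = k \<cdot> y" for X x y
    using assms(2)[of "diff x y"] that assms(1)
    by (intro diff_eq_zeroD[of x y X "Dom S k"]) simp_all
  then show ?thesis
    using assms(1) by (auto simp: is_mono_def)
qed

lemma epiI:
  assumes "k \<in> Arr S"
    and "\<And>x. \<lbrakk>x \<in> Arr S; Dom S x = Cod S k; x \<cdot> k = ZeroArr S (Dom S k) (Cod S x)\<rbrakk>
      \<Longrightarrow> x = ZeroArr S (Cod S k) (Cod S x)"
  shows "is_epi S k"
proof -
  have "x = y" if "x \<in> homset S (Cod S k) X" "y \<in> homset S (Cod S k) X" "x \<cdot> k = y \<cdot> k" for X x y
    using assms(2)[of "diff x y"] that assms(1)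
    by (intro diff_eq_zeroD[of x y "Cod S k" X]) simp_all
  then show ?thesis
    using assms(1) by (auto simp: is_epi_def)
qed

lemma mono_zero:
  assumes "is_mono S k" "k \<cdot> x = ZeroArr S X (Cod S k)" "x \<in> homset S X (Dom S k)"
  shows "x = ZeroArr S X (Dom S k)"
  using assms mono_arr[OF assms(1)] hom_obj[OF assms(3)]
  by (intro mono_cancel[of k x "ZeroArr S X (Dom S k)"]) simp_all

lemma epi_zero:
  assumes "is_epi S k" "x \<cdot> k = ZeroArr S (Dom S k) X" "x \<in> homset S (Cod S k) X"
  shows "x = ZeroArr S (Cod S k) X"
  using assms epi_arr[OF assms(1)] hom_obj[OF assms(3)]
  by (intro epi_cancel[of k x "ZeroArr S (Cod S k) X"]) simp_all

text \<open>Uniqueness of lifts is delegated to \<open>is_mono\<close>; what remains is existence,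
  the shape in which the chases below end.\<close>

lemma kernelI:
  assumes "f \<in> homset S A B" "k \<in> homset S K A" "f \<cdot> k = ZeroArr S K B" "is_mono S k"
    and "\<And>X x. \<lbrakk>x \<in> homset S X A; f \<cdot> x = ZeroArr S X B\<rbrakk> \<Longrightarrow> \<exists>y\<in>homset S X K. k \<cdot> y = x"
  shows "is_kernel S k f"
  unfolding is_kernel_def
proof (intro conjI ballI impI)
  fix X x assume "X \<in> Obj S" and x: "x \<in> homset S X (Dom S f)" "f \<cdot> x = ZeroArr S X (Cod S f)"
  then have "x \<in> homset S X A" "f \<cdot> x = ZeroArr S X B"
    using assms(1) by simp_all
  then obtain y where y: "y \<in> homset S X K" "k \<cdot> y = x"
    using assms(5) by blast
  show "\<exists>!y. y \<in> homset S X (Dom S k) \<and> k \<cdot> y = x"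
  proof (rule ex1I[of _ y])
    show "y \<in> homset S X (Dom S k) \<and> k \<cdot> y = x"
      using y assms(2) by simp
    fix z assume z: "z \<in> homset S X (Dom S k) \<and> k \<cdot> z = x"
    then have "k \<cdot> z = k \<cdot> y"
      using y(2) by simp
    from mono_cancel[OF assms(4) this] show "z = y"
      using y(1) z assms(2) by simp
  qed
qed (use assms(1-4) in simp_all)

lemma kernelD:
  assumes "is_kernel S k f"
  shows "f \<in> Arr S" "k \<in> Arr S" "Cod S k = Dom S f" "f \<cdot> k = ZeroArr S (Dom S k) (Cod S f)"
    "is_mono S k"
proof -
  show k: "f \<in> Arr S" "k \<in> Arr S" "Cod S k = Dom S f" "f \<cdot> k = ZeroArr S (Dom S k) (Cod S f)"
    using assms unfolding is_kernel_def by auto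
  show "is_mono S k"
  proof (rule monoI)
    fix x assume x: "x \<in> Arr S" "Cod S x = Dom S k" "k \<cdot> x = ZeroArr S (Dom S x) (Cod S k)"
    have "f \<cdot> (k \<cdot> x) = ZeroArr S (Dom S x) (Cod S f)"
      using x k by simp
    then have "\<exists>!h. h \<in> homset S (Dom S x) (Dom S k) \<and> k \<cdot> h = k \<cdot> x"
      using assms x k unfolding is_kernel_def by simp
    \<comment> \<open>Both \<open>x\<close> and the zero arrow are lifts of
      \<open>k \<cdot> x\<close>, so uniqueness identifies them.\<close>
    moreover have "k \<cdot> ZeroArr S (Dom S x) (Dom S k) = k \<cdot> x"
      using x k by simp
    ultimately show "x = ZeroArr S (Dom S x) (Dom S k)"
      using x k by (metis arr_obj(1) in_homset zero_arr)
  qed fact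
qed

lemma kernel_lift:
  assumes "is_kernel S k f" "x \<in> homset S X (Dom S f)" "f \<cdot> x = ZeroArr S X (Cod S f)"
  shows "\<exists>y\<in>homset S X (Dom S k). k \<cdot> y = x"
  using assms hom_obj(1)[OF assms(2)] unfolding is_kernel_def by blast

lemma cokernelI:
  assumes "f \<in> homset S A B" "c \<in> homset S B C" "c \<cdot> f = ZeroArr S A C" "is_epi S c"
    and "\<And>X x. \<lbrakk>x \<in> homset S B X; x \<cdot> f = ZeroArr S A X\<rbrakk> \<Longrightarrow> \<exists>y\<in>homset S C X. y \<cdot> c = x"
  shows "is_cokernel S c f"
  unfolding is_cokernel_def
proof (intro conjI ballI impI)
  fix X x assume "X \<in> Obj S" and x: "x \<in> homset S (Cod S f) X" "x \<cdot> f = ZeroArr S (Dom S f) X"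
  then have "x \<in> homset S B X" "x \<cdot> f = ZeroArr S A X"
    using assms(1) by simp_all
  then obtain y where y: "y \<in> homset S C X" "y \<cdot> c = x"
    using assms(5) by blast
  show "\<exists>!y. y \<in> homset S (Cod S c) X \<and> y \<cdot> c = x"
  proof (rule ex1I[of _ y])
    show "y \<in> homset S (Cod S c) X \<and> y \<cdot> c = x"
      using y assms(2) by simp
    fix z assume z: "z \<in> homset S (Cod S c) X \<and> z \<cdot> c = x"
    then have "z \<cdot> c = y \<cdot> c"
      using y(2) by simp
    from epi_cancel[OF assms(4) this] show "z = y"
      using y(1) z assms(2) by simp
  qed
qed (use assms(1-4) in simp_all)

lemma cokernelD:
  assumes "is_cokernel S c f"
  shows "f \<in> Arr S" "c \<in> Arr S" "Dom S c = Cod S f" "c \<cdot> f = ZeroArr S (Dom S f) (Cod S c)"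
    "is_epi S c"
proof -
  show c: "f \<in> Arr S" "c \<in> Arr S" "Dom S c = Cod S f" "c \<cdot> f = ZeroArr S (Dom S f) (Cod S c)"
    using assms unfolding is_cokernel_def by auto
  show "is_epi S c"
  proof (rule epiI)
    fix x assume x: "x \<in> Arr S" "Dom S x = Cod S c" "x \<cdot> c = ZeroArr S (Dom S c) (Cod S x)"
    have "(x \<cdot> c) \<cdot> f = ZeroArr S (Dom S f) (Cod S x)"
      using x c by simp
    then have "\<exists>!h. h \<in> homset S (Cod S c) (Cod S x) \<and> h \<cdot> c = x \<cdot> c"
      using assms x c unfolding is_cokernel_def by simp
    moreover have "ZeroArr S (Cod S c) (Cod S x) \<cdot> c = x \<cdot> c"
      using x c by simp
    ultimately show "x = ZeroArr S (Cod S c) (Cod S x)"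
      using x c by (metis arr_obj(2) in_homset zero_arr)
  qed fact
qed

lemma cokernel_desc:
  assumes "is_cokernel S c f" "x \<in> homset S (Cod S f) X" "x \<cdot> f = ZeroArr S (Dom S f) X"
  shows "\<exists>y\<in>homset S (Cod S c) X. y \<cdot> c = x"
  using assms hom_obj(2)[OF assms(2)] unfolding is_cokernel_def by blast

abbreviation mult_by :: "nat \<Rightarrow> 'o \<Rightarrow> 'a" where
  "mult_by n A \<equiv> nat_mult S n (Ide S A)"

lemma nat_mult_arr [simp]:
  assumes "f \<in> Arr S"
  shows "nat_mult S n f \<in> Arr S" "Dom S (nat_mult S n f) = Dom S f" "Cod S (nat_mult S n f) = Cod S f"
proof -
  interpret comm_group "hom_group S (Dom S f) (Cod S f)" using hom_comm_group assms by simp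
  show "nat_mult S n f \<in> Arr S" "Dom S (nat_mult S n f) = Dom S f" "Cod S (nat_mult S n f) = Cod S f"
    using nat_pow_closed[of f n] assms by (simp_all add: nat_mult_def)
qed

lemma nat_mult_Suc: "nat_mult S (Suc n) f = AddArr S (nat_mult S n f) f"
  and nat_mult_0: "nat_mult S 0 f = ZeroArr S (Dom S f) (Cod S f)"
  by (simp_all add: nat_mult_def nat_pow_def)

text \<open>Two-sided distributivity turns multiples of an identity into multiples of
  \<open>f\<close>. Comparing the two sides gives naturality of multiplication by
  \<open>n\<close>.\<close>

lemma comp_mult_by:
  assumes "f \<in> Arr S"
  shows "f \<cdot> mult_by n (Dom S f) = nat_mult S n f" "mult_by n (Cod S f) \<cdot> f = nat_mult S n f"
  using assms by (induction n) (simp_all add: nat_mult_Suc nat_mult_0)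

lemma mult_by_natural:
  assumes "f \<in> Arr S" "Dom S f = A" "Cod S f = B"
  shows "mult_by n B \<cdot> f = f \<cdot> mult_by n A"
  using comp_mult_by[OF assms(1), of n] assms(2,3) by simp

lemma mult_by_1 [simp]:
  "A \<in> Obj S \<Longrightarrow> mult_by (Suc 0) A = Ide S A"
  by (simp add: nat_mult_Suc nat_mult_0)

lemma mult_by_mult:
  assumes "A \<in> Obj S"
  shows "mult_by (m * n) A = mult_by m A \<cdot> mult_by n A"
proof -
  interpret comm_group "hom_group S A A" using hom_comm_group[OF assms assms] .
  let ?x = "Ide S A [^]\<^bsub>hom_group S A A\<^esub> n"
  have n: "mult_by n A = ?x" and x: "Dom S ?x = A" "Cod S ?x = A"
    using assms nat_pow_closed[of "Ide S A" n] by (simp_all add: nat_mult_def)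
  have "mult_by m A \<cdot> mult_by n A = nat_mult S m (mult_by n A)"
    using comp_mult_by(2)[of "mult_by n A" m] assms by simp
  also have "\<dots> = ?x [^]\<^bsub>hom_group S A A\<^esub> m"
    unfolding n unfolding nat_mult_def x ..
  also have "\<dots> = mult_by (m * n) A"
    using assms nat_pow_pow[of "Ide S A" n m] by (simp add: nat_mult_def mult.commute[of m])
  finally show ?thesis ..
qed

text \<open>In the presence of kernels and (A2), these are exactly the strict epimorphisms.\<close>

definition cover :: "'a \<Rightarrow> bool" where
  "cover f \<longleftrightarrow> (\<exists>g. is_cokernel S f g)"

lemma coverD:
  assumes "cover f"
  shows "f \<in> Arr S" "is_epi S f"
  using assms cokernelD unfolding cover_def by blast+

text \<open>If \<open>f\<close> is the cokernel of \<open>g\<close>, then \<open>g\<close> factors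
  through the kernel of \<open>f\<close>; hence whatever kills the kernel kills \<open>g\<close> and
  descends along \<open>f\<close>.\<close>

lemma cover_cokernel:
  assumes "cover f" "is_kernel S k f"
  shows "is_cokernel S f k"
proof -
  obtain g where g: "is_cokernel S f g"
    using assms(1) cover_def by blast
  note gD = cokernelD[OF g] and kD = kernelD[OF assms(2)]
  obtain u where u: "u \<in> homset S (Dom S g) (Dom S k)" "k \<cdot> u = g"
    by - (rule bexE[OF kernel_lift[OF assms(2), of g "Dom S g"]]; (erule (1) that | use gD in simp))
  show ?thesis
  proof (rule cokernelI[of k "Dom S k" "Dom S f" f "Cod S f"])
    fix X x assume x: "x \<in> homset S (Dom S f) X" "x \<cdot> k = ZeroArr S (Dom S k) X"
    have "(x \<cdot> k) \<cdot> u = ZeroArr S (Dom S g) X"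
      unfolding x(2) using u(1) x(1) kD by auto
    then have "x \<cdot> g = ZeroArr S (Dom S g) X"
      using u x(1) kD by simp
    then show "\<exists>y\<in>homset S (Cod S f) X. y \<cdot> f = x"
      using cokernel_desc[OF g, of x X] x(1) gD by simp
  qed (use gD kD in simp_all)
qed

text \<open>Dual to the previous lemma: \<open>f\<close> factors through the cokernel
  \<open>c\<close> of \<open>k\<close>, so whatever \<open>c\<close> kills is killed by
  \<open>f\<close> and lifts to \<open>k\<close>.\<close>

lemma kernel_of_cokernel:
  assumes "is_kernel S k f" "is_cokernel S c k"
  shows "is_kernel S k c"
proof -
  note cD = cokernelD[OF assms(2)] and kD = kernelD[OF assms(1)]
  obtain u where u: "u \<in> homset S (Cod S c) (Cod S f)" "u \<cdot> c = f"
    by - (rule bexE[OF cokernel_desc[OF assms(2), of f "Cod S f"]]; (erule (1) that | use kD in simp))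
  show ?thesis
  proof (rule kernelI[of c "Dom S c" "Cod S c" k "Dom S k"])
    fix X x assume x: "x \<in> homset S X (Dom S c)" "c \<cdot> x = ZeroArr S X (Cod S c)"
    have "u \<cdot> (c \<cdot> x) = ZeroArr S X (Cod S f)"
      unfolding x(2) using u(1) x(1) cD by auto
    then have "f \<cdot> x = ZeroArr S X (Cod S f)"
      using comp_reduce[OF u(2), of x] u(1) x(1) cD by simp
    then show "\<exists>y\<in>homset S X (Dom S k). k \<cdot> y = x"
      using kernel_lift[OF assms(1), of x X] x(1) kD cD by simp
  qed (use cD kD in simp_all)
qed

text \<open>A subobject that is a kernel in a large object stays one in an intermediate subobject
  \<open>m\<close>: the arrow \<open>f\<close> is restricted to \<open>m\<close>.\<close>

lemma kernel_through_mono: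
  assumes "is_kernel S (m \<cdot> k) f" "is_mono S m" "k \<in> Arr S" "Dom S m = Cod S k"
  shows "is_kernel S k (f \<cdot> m)"
proof -
  have m: "m \<in> Arr S"
    using assms(2) mono_arr by blast
  note fD = kernelD[OF assms(1)]
  have fm: "Dom S f = Cod S m"
    using fD(3) assms m by simp
  show ?thesis
  proof (rule kernelI[of "f \<cdot> m" "Dom S m" "Cod S f" k "Dom S k"])
    show "f \<cdot> m \<cdot> k = ZeroArr S (Dom S k) (Cod S f)"
      using fD assms m by simp
    show "is_mono S k"
      using mono_of_comp_mono[OF fD(5)] assms m by simp
    fix X x assume x: "x \<in> homset S X (Dom S m)" "f \<cdot> m \<cdot> x = ZeroArr S X (Cod S f)"
    then have "f \<cdot> (m \<cdot> x) = ZeroArr S X (Cod S f)"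
      using m fD fm by simp
    then obtain y where y: "y \<in> homset S X (Dom S (m \<cdot> k))" "(m \<cdot> k) \<cdot> y = m \<cdot> x"
      by - (rule bexE[OF kernel_lift[OF assms(1), of "m \<cdot> x" X]];
          (erule (1) that | use m x(1) fm in simp))
    have "m \<cdot> (k \<cdot> y) = m \<cdot> x"
      using y assms m by simp
    from mono_cancel[OF assms(2) this] have "k \<cdot> y = x"
      using y(1) assms(3,4) m x(1) by simp
    then show "\<exists>y\<in>homset S X (Dom S k). k \<cdot> y = x"
      using y(1) assms(3,4) m by auto
  qed (use assms fD fm m in simp_all)
qed

lemma product_lift:
  assumes "is_product S A B P \<pi>\<^sub>1 \<pi>\<^sub>2" "x \<in> homset S X A" "y \<in> homset S X B"
  shows "\<exists>h\<in>homset S X P. \<pi>\<^sub>1 \<cdot> h = x \<and> \<pi>\<^sub>2 \<cdot> h = y"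
  using assms hom_obj[OF assms(2)] unfolding is_product_def by meson

lemma product_eqI:
  assumes "is_product S A B P \<pi>\<^sub>1 \<pi>\<^sub>2" "x \<in> homset S X P" "y \<in> homset S X P"
    "\<pi>\<^sub>1 \<cdot> x = \<pi>\<^sub>1 \<cdot> y" "\<pi>\<^sub>2 \<cdot> x = \<pi>\<^sub>2 \<cdot> y"
  shows "x = y"
proof -
  have hom: "\<pi>\<^sub>1 \<cdot> y \<in> homset S X A" "\<pi>\<^sub>2 \<cdot> y \<in> homset S X B"
    using assms(1,3) unfolding is_product_def by simp_all
  have "\<forall>X\<in>Obj S. \<forall>x\<in>homset S X A. \<forall>y\<in>homset S X B.
      \<exists>!h. h \<in> homset S X P \<and> \<pi>\<^sub>1 \<cdot> h = x \<and> \<pi>\<^sub>2 \<cdot> h = y"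
    using assms(1) unfolding is_product_def by (elim conjE)
  note this[rule_format, OF hom_obj(1)[OF assms(2)] hom]
  then show ?thesis
    using assms by blast
qed

text \<open>Only products are given. The injections are the lifts of identities and zeros, and the
  sum formula is tested on the two projections.\<close>

lemma biproduct:
  assumes "A \<in> Obj S" "B \<in> Obj S"
  obtains P \<pi>\<^sub>1 \<pi>\<^sub>2 \<iota>\<^sub>1 \<iota>\<^sub>2 where
    "is_product S A B P \<pi>\<^sub>1 \<pi>\<^sub>2"
    "\<pi>\<^sub>1 \<in> homset S P A" "\<pi>\<^sub>2 \<in> homset S P B" "\<iota>\<^sub>1 \<in> homset S A P" "\<iota>\<^sub>2 \<in> homset S B P"
    "\<pi>\<^sub>1 \<cdot> \<iota>\<^sub>1 = Ide S A" "\<pi>\<^sub>2 \<cdot> \<iota>\<^sub>1 = ZeroArr S A B"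
    "\<pi>\<^sub>1 \<cdot> \<iota>\<^sub>2 = ZeroArr S B A" "\<pi>\<^sub>2 \<cdot> \<iota>\<^sub>2 = Ide S B"
    "AddArr S (\<iota>\<^sub>1 \<cdot> \<pi>\<^sub>1) (\<iota>\<^sub>2 \<cdot> \<pi>\<^sub>2) = Ide S P"
proof -
  obtain P \<pi>\<^sub>1 \<pi>\<^sub>2 where P: "is_product S A B P \<pi>\<^sub>1 \<pi>\<^sub>2"
    using binary_products assms by blast
  then have \<pi>: "P \<in> Obj S" "\<pi>\<^sub>1 \<in> homset S P A" "\<pi>\<^sub>2 \<in> homset S P B"
    unfolding is_product_def by blast+
  obtain \<iota>\<^sub>1 where 1: "\<iota>\<^sub>1 \<in> homset S A P" "\<pi>\<^sub>1 \<cdot> \<iota>\<^sub>1 = Ide S A" "\<pi>\<^sub>2 \<cdot> \<iota>\<^sub>1 = ZeroArr S A B"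
    by - (rule bexE[OF product_lift[OF P, of "Ide S A" A "ZeroArr S A B"]];
        (erule conjE, erule (2) that | use assms in simp))
  obtain \<iota>\<^sub>2 where 2: "\<iota>\<^sub>2 \<in> homset S B P" "\<pi>\<^sub>1 \<cdot> \<iota>\<^sub>2 = ZeroArr S B A" "\<pi>\<^sub>2 \<cdot> \<iota>\<^sub>2 = Ide S B"
    by - (rule bexE[OF product_lift[OF P, of "ZeroArr S B A" B "Ide S B"]];
        (erule conjE, erule (2) that | use assms in simp))
  have "AddArr S (\<iota>\<^sub>1 \<cdot> \<pi>\<^sub>1) (\<iota>\<^sub>2 \<cdot> \<pi>\<^sub>2) = Ide S P"
  proof (rule product_eqI[OF P, of _ P])
    show "\<pi>\<^sub>1 \<cdot> AddArr S (\<iota>\<^sub>1 \<cdot> \<pi>\<^sub>1) (\<iota>\<^sub>2 \<cdot> \<pi>\<^sub>2) = \<pi>\<^sub>1 \<cdot> Ide S P"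
      using \<pi> 1(1) 2(1) assms comp_reduce[OF 1(2), of \<pi>\<^sub>1] comp_reduce[OF 2(2), of \<pi>\<^sub>2] by simp
    show "\<pi>\<^sub>2 \<cdot> AddArr S (\<iota>\<^sub>1 \<cdot> \<pi>\<^sub>1) (\<iota>\<^sub>2 \<cdot> \<pi>\<^sub>2) = \<pi>\<^sub>2 \<cdot> Ide S P"
      using \<pi> 1(1) 2(1) assms comp_reduce[OF 1(3), of \<pi>\<^sub>1] comp_reduce[OF 2(3), of \<pi>\<^sub>2] by simp
  qed (use \<pi> 1(1) 2(1) in simp_all)
  with P \<pi> 1 2 show thesis
    using that by blast
qed

lemma pullbackD:
  assumes "is_pullback S f g f' g'"
  shows "f \<in> Arr S" "g \<in> Arr S" "f' \<in> Arr S" "g' \<in> Arr S" "Cod S f = Cod S g"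
    "Cod S g' = Dom S f" "Cod S f' = Dom S g" "Dom S g' = Dom S f'" "f \<cdot> g' = g \<cdot> f'"
  using assms unfolding is_pullback_def by simp_all

lemma pullback_lift:
  assumes "is_pullback S f g f' g'" "x \<in> homset S X (Dom S f)" "y \<in> homset S X (Dom S g)"
    "f \<cdot> x = g \<cdot> y"
  shows "\<exists>h\<in>homset S X (Dom S f'). g' \<cdot> h = x \<and> f' \<cdot> h = y"
  using assms hom_obj[OF assms(2)] unfolding is_pullback_def by blast

lemma pushoutD:
  assumes "is_pushout S f g f' g'"
  shows "f \<in> Arr S" "g \<in> Arr S" "f' \<in> Arr S" "g' \<in> Arr S" "Dom S f = Dom S g"
    "Dom S g' = Cod S f" "Dom S f' = Cod S g" "Cod S g' = Cod S f'" "g' \<cdot> f = f' \<cdot> g"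
  using assms unfolding is_pushout_def by simp_all

lemma pushout_desc:
  assumes "is_pushout S f g f' g'" "x \<in> homset S (Cod S f) X" "y \<in> homset S (Cod S g) X"
    "x \<cdot> f = y \<cdot> g"
  shows "\<exists>h\<in>homset S (Cod S f') X. h \<cdot> g' = x \<and> h \<cdot> f' = y"
  using assms hom_obj[OF assms(2)] unfolding is_pushout_def by blast

end

section \<open>Covers and kernels in special pre-abelian categories\<close>

context preabelian_category
begin

text \<open>The pullback is the kernel of the difference of the two composites on the
  product.\<close>

lemma pullback_exists:
  assumes f: "f \<in> homset S A C" and g: "g \<in> homset S B C"
  shows "\<exists>f' g'. is_pullback S f g f' g'"
proof -
  obtain P \<pi>\<^sub>1 \<pi>\<^sub>2 where P: "is_product S A B P \<pi>\<^sub>1 \<pi>\<^sub>2"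
    using binary_products hom_obj(1)[OF f] hom_obj(1)[OF g] by blast
  then have \<pi>: "P \<in> Obj S" "\<pi>\<^sub>1 \<in> homset S P A" "\<pi>\<^sub>2 \<in> homset S P B"
    unfolding is_product_def by blast+
  define d where "d = diff (f \<cdot> \<pi>\<^sub>1) (g \<cdot> \<pi>\<^sub>2)"
  have d: "d \<in> homset S P C"
    using f g \<pi> by (simp add: d_def)
  obtain k where k: "is_kernel S k d"
    using has_kernel d by auto
  note kD = kernelD(1-4)[OF k]
  have k_hom: "k \<in> Arr S" "Cod S k = P"
    using kD(2,3) d by simp_all
  have "d \<cdot> k = diff (f \<cdot> (\<pi>\<^sub>1 \<cdot> k)) (g \<cdot> (\<pi>\<^sub>2 \<cdot> k))"
    using f g \<pi> k_hom by (simp add: d_def)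
  then have "diff (f \<cdot> (\<pi>\<^sub>1 \<cdot> k)) (g \<cdot> (\<pi>\<^sub>2 \<cdot> k)) = ZeroArr S (Dom S k) C"
    using kD(4) d by simp
  then have comm: "f \<cdot> (\<pi>\<^sub>1 \<cdot> k) = g \<cdot> (\<pi>\<^sub>2 \<cdot> k)"
    by (rule diff_eq_zeroD) (use f g \<pi> k_hom in simp_all)
  have univ: "\<exists>!h. h \<in> homset S X (Dom S (\<pi>\<^sub>2 \<cdot> k)) \<and> (\<pi>\<^sub>1 \<cdot> k) \<cdot> h = x \<and> (\<pi>\<^sub>2 \<cdot> k) \<cdot> h = y"
    if x: "x \<in> homset S X A" and y: "y \<in> homset S X B" and eq: "f \<cdot> x = g \<cdot> y" for X x y
  proof -
    obtain t where t: "t \<in> homset S X P" "\<pi>\<^sub>1 \<cdot> t = x" "\<pi>\<^sub>2 \<cdot> t = y"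
      using product_lift[OF P x y] by blast
    have "d \<cdot> t = diff (f \<cdot> x) (g \<cdot> y)"
      using f g \<pi> t by (simp add: d_def)
    also have "\<dots> = ZeroArr S X C"
      unfolding eq using g y by simp
    finally obtain h where h: "h \<in> homset S X (Dom S k)" "k \<cdot> h = t"
      by - (rule bexE[OF kernel_lift[OF k, of t X]]; (erule (1) that | use t(1) d in simp))
    show ?thesis
    proof (rule ex1I[of _ h])
      show "h \<in> homset S X (Dom S (\<pi>\<^sub>2 \<cdot> k)) \<and> (\<pi>\<^sub>1 \<cdot> k) \<cdot> h = x \<and> (\<pi>\<^sub>2 \<cdot> k) \<cdot> h = y"
        using h t k_hom \<pi> by simp
      fix h' assume h': "h' \<in> homset S X (Dom S (\<pi>\<^sub>2 \<cdot> k)) \<and> (\<pi>\<^sub>1 \<cdot> k) \<cdot> h' = x \<and> (\<pi>\<^sub>2 \<cdot> k) \<cdot> h' = y"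
      then have h'_hom: "h' \<in> homset S X (Dom S k)"
        using k_hom \<pi> by simp
      have "\<pi>\<^sub>1 \<cdot> (k \<cdot> h') = \<pi>\<^sub>1 \<cdot> t" "\<pi>\<^sub>2 \<cdot> (k \<cdot> h') = \<pi>\<^sub>2 \<cdot> t"
        using comp_assoc_arr[of h' k \<pi>\<^sub>1] comp_assoc_arr[of h' k \<pi>\<^sub>2] h' h'_hom k_hom \<pi> t(2,3)
        by (simp_all del: comp_assoc_arr)
      then have "k \<cdot> h' = t"
        by (rule product_eqI[OF P, of _ X, rotated 2]) (use h'_hom t(1) k_hom in simp_all)
      then have "k \<cdot> h' = k \<cdot> h"
        using h(2) by simp
      from mono_cancel[OF kernelD(5)[OF k] this] show "h' = h"
        using h(1) h'_hom by simp
    qed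
  qed
  have "is_pullback S f g (\<pi>\<^sub>2 \<cdot> k) (\<pi>\<^sub>1 \<cdot> k)"
    unfolding is_pullback_def
  proof (intro conjI ballI impI)
    fix X x y assume "x \<in> homset S X (Dom S f)" "y \<in> homset S X (Dom S g)" "f \<cdot> x = g \<cdot> y"
    then show "\<exists>!h. h \<in> homset S X (Dom S (\<pi>\<^sub>2 \<cdot> k)) \<and> (\<pi>\<^sub>1 \<cdot> k) \<cdot> h = x \<and> (\<pi>\<^sub>2 \<cdot> k) \<cdot> h = y"
      by (intro univ) (use f g in simp_all)
  qed (use comm f g \<pi> k_hom in simp_all)
  then show ?thesis by blast
qed

text \<open>The pushout is the cokernel of the difference of the two arrows into the biproduct. The
  arrow out of it that belongs to \<open>x\<close> and \<open>y\<close> is induced by the sum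
  \<open>t\<close>, for which the projections are needed as well.\<close>

lemma pushout_exists:
  assumes f: "f \<in> homset S A B" and g: "g \<in> homset S A D"
  shows "\<exists>f' g'. is_pushout S f g f' g'"
proof -
  obtain P \<pi>\<^sub>1 \<pi>\<^sub>2 \<iota>\<^sub>1 \<iota>\<^sub>2 where P:
    "\<pi>\<^sub>1 \<in> homset S P B" "\<pi>\<^sub>2 \<in> homset S P D" "\<iota>\<^sub>1 \<in> homset S B P" "\<iota>\<^sub>2 \<in> homset S D P"
    and \<pi>\<iota>: "\<pi>\<^sub>1 \<cdot> \<iota>\<^sub>1 = Ide S B" "\<pi>\<^sub>2 \<cdot> \<iota>\<^sub>1 = ZeroArr S B D"
    "\<pi>\<^sub>1 \<cdot> \<iota>\<^sub>2 = ZeroArr S D B" "\<pi>\<^sub>2 \<cdot> \<iota>\<^sub>2 = Ide S D"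
    and sum: "AddArr S (\<iota>\<^sub>1 \<cdot> \<pi>\<^sub>1) (\<iota>\<^sub>2 \<cdot> \<pi>\<^sub>2) = Ide S P"
    using biproduct[OF hom_obj(2)[OF f] hom_obj(2)[OF g]] by metis
  have obj: "B \<in> Obj S" "D \<in> Obj S"
    using hom_obj[OF f] hom_obj[OF g] by blast+
  define d where "d = diff (\<iota>\<^sub>1 \<cdot> f) (\<iota>\<^sub>2 \<cdot> g)"
  have d: "d \<in> homset S A P"
    using f g P by (simp add: d_def)
  obtain c where c: "is_cokernel S c d"
    using has_cokernel d by auto
  note cD = cokernelD(1-4)[OF c]
  have c_hom: "c \<in> Arr S" "Dom S c = P"
    using cD(2,3) d by simp_all
  have "c \<cdot> d = diff ((c \<cdot> \<iota>\<^sub>1) \<cdot> f) ((c \<cdot> \<iota>\<^sub>2) \<cdot> g)"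
    using f g P c_hom by (simp add: d_def)
  then have "diff ((c \<cdot> \<iota>\<^sub>1) \<cdot> f) ((c \<cdot> \<iota>\<^sub>2) \<cdot> g) = ZeroArr S A (Cod S c)"
    using cD(4) d by simp
  then have comm: "(c \<cdot> \<iota>\<^sub>1) \<cdot> f = (c \<cdot> \<iota>\<^sub>2) \<cdot> g"
    by (rule diff_eq_zeroD) (use f g P c_hom in simp_all)
  have univ: "\<exists>!h. h \<in> homset S (Cod S (c \<cdot> \<iota>\<^sub>2)) X \<and> h \<cdot> (c \<cdot> \<iota>\<^sub>1) = x \<and> h \<cdot> (c \<cdot> \<iota>\<^sub>2) = y"
    if x: "x \<in> homset S B X" and y: "y \<in> homset S D X" and eq: "x \<cdot> f = y \<cdot> g" for X x y
  proof -
    define t where "t = AddArr S (x \<cdot> \<pi>\<^sub>1) (y \<cdot> \<pi>\<^sub>2)"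
    have X: "X \<in> Obj S"
      using hom_obj[OF x] by simp
    have t: "t \<in> homset S P X"
      using x y P by (simp add: t_def)
    have t1: "t \<cdot> \<iota>\<^sub>1 = x" and t2: "t \<cdot> \<iota>\<^sub>2 = y"
      using x y P obj X by (simp_all add: t_def \<pi>\<iota>)
    have "t \<cdot> d = diff (x \<cdot> f) (y \<cdot> g)"
      using f g P t comp_reduce[OF t1, of f] comp_reduce[OF t2, of g] by (simp add: d_def)
    also have "\<dots> = ZeroArr S A X"
      unfolding eq using g y by simp
    finally obtain h where h: "h \<in> homset S (Cod S c) X" "h \<cdot> c = t"
      by - (rule bexE[OF cokernel_desc[OF c, of t X]]; (erule (1) that | use t d in simp))
    show ?thesis
    proof (rule ex1I[of _ h])
      show "h \<in> homset S (Cod S (c \<cdot> \<iota>\<^sub>2)) X \<and> h \<cdot> (c \<cdot> \<iota>\<^sub>1) = x \<and> h \<cdot> (c \<cdot> \<iota>\<^sub>2) = y"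
        using h(1) t1 t2 c_hom P comp_reduce[OF h(2), of \<iota>\<^sub>1] comp_reduce[OF h(2), of \<iota>\<^sub>2] by simp
      fix h' assume h': "h' \<in> homset S (Cod S (c \<cdot> \<iota>\<^sub>2)) X \<and> h' \<cdot> (c \<cdot> \<iota>\<^sub>1) = x \<and> h' \<cdot> (c \<cdot> \<iota>\<^sub>2) = y"
      then have h'_hom: "h' \<in> homset S (Cod S c) X"
        using c_hom P by simp
      have "h' \<cdot> c = (h' \<cdot> c) \<cdot> AddArr S (\<iota>\<^sub>1 \<cdot> \<pi>\<^sub>1) (\<iota>\<^sub>2 \<cdot> \<pi>\<^sub>2)"
        unfolding sum using c_hom h'_hom by simp
      also have "\<dots> = AddArr S ((h' \<cdot> (c \<cdot> \<iota>\<^sub>1)) \<cdot> \<pi>\<^sub>1) ((h' \<cdot> (c \<cdot> \<iota>\<^sub>2)) \<cdot> \<pi>\<^sub>2)"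
        using c_hom h'_hom P by simp
      also have "\<dots> = t"
        using h' by (simp add: t_def)
      finally have "h' \<cdot> c = h \<cdot> c"
        using h(2) by simp
      from epi_cancel[OF cokernelD(5)[OF c] this] show "h' = h"
        using h(1) h'_hom by simp
    qed
  qed
  have "is_pushout S f g (c \<cdot> \<iota>\<^sub>2) (c \<cdot> \<iota>\<^sub>1)"
    unfolding is_pushout_def
  proof (intro conjI ballI impI)
    fix X x y assume "x \<in> homset S (Cod S f) X" "y \<in> homset S (Cod S g) X" "x \<cdot> f = y \<cdot> g"
    then show "\<exists>!h. h \<in> homset S (Cod S (c \<cdot> \<iota>\<^sub>2)) X \<and> h \<cdot> (c \<cdot> \<iota>\<^sub>1) = x \<and> h \<cdot> (c \<cdot> \<iota>\<^sub>2) = y"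
      by (intro univ) (use f g in simp_all)
  qed (use comm f g P c_hom in simp_all)
  then show ?thesis by blast
qed

lemma kernel_zero_ide:
  assumes "A \<in> Obj S" "B \<in> Obj S"
  shows "is_kernel S (Ide S A) (ZeroArr S A B)"
  by (rule kernelI[of _ A B _ A]) (use assms mono_ide in auto)

lemma cokernel_zero_ide:
  assumes "A \<in> Obj S" "B \<in> Obj S"
  shows "is_cokernel S (Ide S B) (ZeroArr S A B)"
  by (rule cokernelI[of _ A B _ B]) (use assms epi_ide in auto)

lemma mono_kernel_eq_zero:
  assumes "is_mono S f" "is_kernel S k f"
  shows "k = ZeroArr S (Dom S k) (Dom S f)"
  using mono_zero[OF assms(1), of k "Dom S k"] kernelD[OF assms(2)] by simp

lemma epi_cokernel_eq_zero:
  assumes "is_epi S f" "is_cokernel S c f"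
  shows "c = ZeroArr S (Cod S f) (Cod S c)"
  using epi_zero[OF assms(1), of c "Cod S c"] cokernelD[OF assms(2)] by simp

lemma iso_ide: "A \<in> Obj S \<Longrightarrow> is_iso S (Ide S A)"
  unfolding is_iso_def by (intro conjI bexI[of _ "Ide S A"]) simp_all

text \<open>A cover is its own coimage, and since its cokernel is zero its image is the identity; so
  the canonical morphism is an identity.\<close>

lemma cover_imp_strict_epi:
  assumes "cover f"
  shows "is_strict_epi S f"
proof -
  note f = coverD[OF assms]
  obtain k where k: "is_kernel S k f"
    using has_kernel f by blast
  obtain d where d: "is_cokernel S d f"
    using has_cokernel f by blast
  have "is_kernel S (Ide S (Cod S f)) d"
    using kernel_zero_ide[of "Cod S f" "Cod S d"] epi_cokernel_eq_zero[OF f(2) d] cokernelD(2)[OF d] f(1)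
    by (metis arr_obj(2))
  moreover have "is_cokernel S f k"
    using cover_cokernel[OF assms k] .
  moreover have "Ide S (Cod S f) \<cdot> Ide S (Cod S f) \<cdot> f = f"
    using f by simp
  moreover have "is_iso S (Ide S (Cod S f))" "Ide S (Cod S f) \<in> homset S (Cod S f) (Dom S (Ide S (Cod S f)))"
    using f iso_ide by simp_all
  ultimately have "is_strict S f"
    unfolding is_strict_def using k d by blast
  then show ?thesis
    using f unfolding is_strict_epi_def by blast
qed

lemma kernel_imp_strict_mono:
  assumes "is_kernel S f g"
  shows "is_strict_mono S f"
proof -
  note f = kernelD[OF assms]
  obtain k where k: "is_kernel S k f"
    using has_kernel f by blast
  obtain d where d: "is_cokernel S d f"
    using has_cokernel f by blast
  have "is_cokernel S (Ide S (Dom S f)) k"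
    using cokernel_zero_ide[of "Dom S k" "Dom S f"] mono_kernel_eq_zero[OF f(5) k] kernelD(2)[OF k] f(2)
    by (metis arr_obj(1))
  moreover have "is_kernel S f d"
    using kernel_of_cokernel[OF assms d] .
  moreover have "f \<cdot> Ide S (Dom S f) \<cdot> Ide S (Dom S f) = f"
    using f by simp
  moreover have "is_iso S (Ide S (Dom S f))" "Ide S (Dom S f) \<in> homset S (Cod S (Ide S (Dom S f))) (Dom S f)"
    using f iso_ide by simp_all
  ultimately have "is_strict S f"
    unfolding is_strict_def using k d by blast
  then show ?thesis
    using f unfolding is_strict_mono_def by blast
qed

text \<open>The cokernel \<open>d\<close> of an epimorphism is zero, so its kernel \<open>e\<close>
  has an inverse \<open>i\<close>. Thus \<open>f\<close> is the coimage \<open>c\<close> followed by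
  the isomorphism \<open>e \<cdot> w\<close>.\<close>

lemma strict_epi_imp_cover:
  assumes "is_strict_epi S f"
  shows "cover f"
proof -
  have epi: "is_epi S f"
    using assms unfolding is_strict_epi_def by blast
  note f = epi_arr[OF epi]
  obtain k c d e w where k: "is_kernel S k f" and c: "is_cokernel S c k"
    and d: "is_cokernel S d f" and e: "is_kernel S e d"
    and w: "w \<in> homset S (Cod S c) (Dom S e)" "e \<cdot> w \<cdot> c = f" "is_iso S w"
    using assms unfolding is_strict_epi_def is_strict_def by blast
  note kD = kernelD[OF k] and cD = cokernelD[OF c] and dD = cokernelD[OF d] and eD = kernelD[OF e]
  obtain v where v: "v \<in> homset S (Cod S w) (Dom S w)" "v \<cdot> w = Ide S (Dom S w)" "w \<cdot> v = Ide S (Cod S w)"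
    using w(3) unfolding is_iso_def by blast
  have "d \<cdot> Ide S (Cod S f) = d"
    using dD f by simp
  also have "d = ZeroArr S (Cod S f) (Cod S d)"
    using epi_cokernel_eq_zero[OF epi d] .
  finally have "d \<cdot> Ide S (Cod S f) = ZeroArr S (Cod S f) (Cod S d)" .
  then obtain i where i: "i \<in> homset S (Cod S f) (Dom S e)" "e \<cdot> i = Ide S (Cod S f)"
    by - (rule bexE[OF kernel_lift[OF e, of "Ide S (Cod S f)" "Cod S f"]];
        (erule (1) that | use dD f in simp))
  have fc: "Dom S c = Dom S f" "Cod S e = Cod S f" "Dom S d = Cod S f" "Cod S k = Dom S f"
    "e \<in> Arr S" "c \<in> Arr S" "k \<in> Arr S"
    using kD cD dD eD by auto
  have ew: "e \<cdot> (w \<cdot> c) = f"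
    using w fc by simp
  have "e \<cdot> (i \<cdot> e) = e \<cdot> Ide S (Dom S e)"
    using comp_reduce[OF i(2), of e] i(1) fc f by simp
  from mono_cancel[OF eD(5) this] have ie: "i \<cdot> e = Ide S (Dom S e)"
    using i(1) fc by simp
  have "is_cokernel S f k"
  proof (rule cokernelI[of k "Dom S k" "Dom S f" f "Cod S f"])
    fix X x assume x: "x \<in> homset S (Dom S f) X" "x \<cdot> k = ZeroArr S (Dom S k) X"
    then obtain y where y: "y \<in> homset S (Cod S c) X" "y \<cdot> c = x"
      by - (rule bexE[OF cokernel_desc[OF c, of x X]]; (erule (1) that | use fc in simp))
    have "(y \<cdot> v \<cdot> i) \<cdot> f = (y \<cdot> v \<cdot> i) \<cdot> (e \<cdot> (w \<cdot> c))"
      unfolding ew ..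
    also have "\<dots> = x"
      using y v(1) i(1) w(1) fc comp_reduce[OF ie, of "w \<cdot> c"] comp_reduce[OF v(2), of c] by simp
    finally show "\<exists>y\<in>homset S (Cod S f) X. y \<cdot> f = x"
      using y(1) v(1) i(1) w(1) by (intro bexI[of _ "y \<cdot> v \<cdot> i"]) simp_all
  qed (use kD fc f epi in simp_all)
  then show ?thesis
    unfolding cover_def by blast
qed

end

section \<open>Diagram chasing with covers, and composition of kernels\<close>

context special_preabelian_category
begin

lemma cover_lift:
  assumes "cover f" "f \<in> homset S A B" "x \<in> homset S X B"
  obtains X' e z where "cover e" "e \<in> homset S X' X" "z \<in> homset S X' A" "f \<cdot> z = x \<cdot> e"
proof -
  obtain e z where ez: "is_pullback S f x e z"
    using pullback_exists[OF assms(2,3)] by blast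
  then have "cover e"
    using pullback_strict_epi[OF cover_imp_strict_epi[OF assms(1)]] strict_epi_imp_cover by blast
  then show thesis
    using pullbackD[OF ez] assms(2,3) by (intro that[of e "Dom S e" z]) simp_all
qed

lemma cover_ide:
  assumes "A \<in> Obj S"
  shows "cover (Ide S A)"
  using cokernel_zero_ide[OF assms assms] unfolding cover_def by blast

text \<open>The composite is the cokernel of \<open>k'\<close>, the preimage under \<open>f\<close>
  of the kernel of \<open>g\<close>. An arrow killing \<open>k'\<close> descends along
  \<open>f\<close>, because \<open>k'\<close> contains the kernel of \<open>f\<close>. The result
  vanishes on the kernel of \<open>g\<close>, as can be checked after the epimorphism
  \<open>f'\<close> supplied by (A2), so it descends along \<open>g\<close> too.\<close>

lemma cover_comp:
  assumes f: "cover f" "f \<in> homset S A B" and g: "cover g" "g \<in> homset S B C"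
  shows "cover (g \<cdot> f)"
proof -
  obtain k where k: "is_kernel S k g"
    using has_kernel coverD[OF g(1)] by blast
  note kD = kernelD[OF k]
  have k_hom: "k \<in> Arr S" "Cod S k = B"
    using kD g by auto
  obtain f' k' where fk: "is_pullback S f k f' k'"
    using pullback_exists[OF f(2), of k "Dom S k"] k_hom by auto
  have "cover f'"
    using pullback_strict_epi[OF cover_imp_strict_epi[OF f(1)] fk] strict_epi_imp_cover by blast
  note epi = coverD(2)[OF this] and fkD = pullbackD[OF fk]
  obtain l where l: "is_kernel S l f"
    using has_kernel coverD[OF f(1)] by blast
  note lD = kernelD[OF l]
  have "is_cokernel S (g \<cdot> f) k'"
  proof (rule cokernelI[of k' "Dom S k'" A _ C])
    have "(g \<cdot> f) \<cdot> k' = g \<cdot> (k \<cdot> f')"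
      using f g fkD by simp
    also have "\<dots> = ZeroArr S (Dom S k') C"
      using comp_reduce[OF kD(4), of f'] g fkD kD by simp
    finally show "(g \<cdot> f) \<cdot> k' = ZeroArr S (Dom S k') C" .
    show "is_epi S (g \<cdot> f)"
      using epi_comp coverD f g by simp
    fix X x assume x: "x \<in> homset S A X" "x \<cdot> k' = ZeroArr S (Dom S k') X"
    have X: "X \<in> Obj S"
      using hom_obj[OF x(1)] by simp
    have "f \<cdot> l = k \<cdot> ZeroArr S (Dom S l) (Dom S k)"
      using lD k_hom f by simp
    then obtain m where m: "m \<in> homset S (Dom S l) (Dom S f')" "k' \<cdot> m = l"
      by - (rule bexE[OF pullback_lift[OF fk, of l "Dom S l" "ZeroArr S (Dom S l) (Dom S k)"]];
          (erule conjE, erule (2) that | use lD k_hom in simp))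
    have "x \<cdot> (k' \<cdot> m) = ZeroArr S (Dom S l) X"
      using comp_reduce[OF x(2), of m] m(1) x(1) fkD X f by simp
    then have "x \<cdot> l = ZeroArr S (Dom S l) X"
      using m(2) by simp
    then obtain y where y: "y \<in> homset S B X" "y \<cdot> f = x"
      by - (rule bexE[OF cokernel_desc[OF cover_cokernel[OF f(1) l], of x X]];
          (erule (1) that | use x(1) f(2) lD in simp))
    have "(y \<cdot> k) \<cdot> f' = x \<cdot> k'"
      using y f(2) k_hom fkD comp_reduce[OF y(2), of k'] by simp
    then have "y \<cdot> k = ZeroArr S (Dom S k) X"
      using epi_zero[OF epi, of "y \<cdot> k" X] x(2) y(1) k_hom fkD by simp
    then obtain z where z: "z \<in> homset S C X" "z \<cdot> g = y"
      by - (rule bexE[OF cokernel_desc[OF cover_cokernel[OF g(1) k], of y X]];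
          (erule (1) that | use y(1) g(2) kD in simp))
    then show "\<exists>z\<in>homset S C X. z \<cdot> (g \<cdot> f) = x"
      using y f(2) g(2) comp_reduce[OF z(2), of f] by (intro bexI[of _ z]) simp_all
  qed (use f g fkD in simp_all)
  then show ?thesis
    unfolding cover_def by blast
qed

text \<open>Let \<open>x\<close> kill the kernel of \<open>g\<close>. Then
  \<open>x \<cdot> f\<close> descends along \<open>g \<cdot> f\<close> to some \<open>y\<close>, and
  it has to be seen that \<open>x = y \<cdot> g\<close>. On the pullback of
  \<open>g \<cdot> f\<close> along \<open>g\<close>, the arrows \<open>q\<close> and
  \<open>f \<cdot> a\<close> differ by something in the kernel of \<open>g\<close>, so
  \<open>x\<close> does not distinguish them; cancelling the cover \<open>q\<close> gives the
  equation.\<close>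

lemma cover_of_comp_cover:
  assumes gf: "cover (g \<cdot> f)" and f: "f \<in> homset S A B" and g: "g \<in> homset S B C"
  shows "cover g"
proof -
  obtain k where k: "is_kernel S k g"
    using has_kernel g by auto
  note kD = kernelD[OF k]
  obtain l where l: "is_kernel S l (g \<cdot> f)"
    using has_kernel[of "g \<cdot> f"] f g by auto
  note lD = kernelD[OF l]
  have l_hom: "l \<in> Arr S" "Cod S l = A"
    using lD f g by auto
  obtain q a where qa: "is_pullback S (g \<cdot> f) g q a"
    using pullback_exists[of "g \<cdot> f" A C g B] f g by auto
  have "cover q"
    using pullback_strict_epi[OF cover_imp_strict_epi[OF gf] qa] strict_epi_imp_cover by blast
  note epi = coverD(2)[OF this] and qaD = pullbackD[OF qa]
  have qa_hom: "q \<in> Arr S" "a \<in> Arr S" "Cod S q = B" "Cod S a = A" "Dom S a = Dom S q" "g \<cdot> (f \<cdot> a) = g \<cdot> q"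
    using qaD f g by auto
  have "is_cokernel S g k"
  proof (rule cokernelI[of k "Dom S k" B _ C])
    show "is_epi S g"
      using epi_of_comp_epi[OF coverD(2)[OF gf]] f g by simp
    fix X x assume x: "x \<in> homset S B X" "x \<cdot> k = ZeroArr S (Dom S k) X"
    have X: "X \<in> Obj S"
      using hom_obj[OF x(1)] by simp
    have kill: "x \<cdot> t = ZeroArr S (Dom S t) X"
      if t: "t \<in> Arr S" "Cod S t = B" "g \<cdot> t = ZeroArr S (Dom S t) C" for t
    proof -
      obtain s where s: "s \<in> homset S (Dom S t) (Dom S k)" "k \<cdot> s = t"
        by - (rule bexE[OF kernel_lift[OF k, of t "Dom S t"]]; (erule (1) that | use t g in simp))
      have "x \<cdot> (k \<cdot> s) = ZeroArr S (Dom S t) X"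
        using comp_reduce[OF x(2), of s] s(1) x(1) X kD g by simp
      then show ?thesis
        using s(2) by simp
    qed
    have "(x \<cdot> f) \<cdot> l = ZeroArr S (Dom S l) X"
      using kill[of "f \<cdot> l"] l_hom lD x(1) f g by simp
    then obtain y where y: "y \<in> homset S C X" "y \<cdot> (g \<cdot> f) = x \<cdot> f"
      by - (rule bexE[OF cokernel_desc[OF cover_cokernel[OF gf l], of "x \<cdot> f" X]];
          (erule (1) that | use f g x(1) l_hom in simp))
    have "diff (x \<cdot> q) (x \<cdot> (f \<cdot> a)) = ZeroArr S (Dom S q) X"
      using kill[of "diff q (f \<cdot> a)"] qa_hom f g x(1) by simp
    then have "x \<cdot> q = x \<cdot> (f \<cdot> a)"
      by (rule diff_eq_zeroD[where A = "Dom S q" and B = X]) (use qa_hom f x(1) in simp_all)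
    also have "\<dots> = (x \<cdot> f) \<cdot> a"
      using qa_hom f x(1) by simp
    also have "\<dots> = (y \<cdot> g) \<cdot> q"
      unfolding y(2)[symmetric] using qa_hom f g y(1) by simp
    finally have "x \<cdot> q = (y \<cdot> g) \<cdot> q" .
    from epi_cancel[OF epi this] have "x = y \<cdot> g"
      using x(1) y(1) g qa_hom by simp
    then show "\<exists>y\<in>homset S C X. y \<cdot> g = x"
      using y(1) by auto
  qed (use g kD in simp_all)
  then show ?thesis
    unfolding cover_def by blast
qed

text \<open>Factoring through a monomorphism may be tested on a cover: \<open>z\<close> kills the
  kernel of \<open>e\<close> because \<open>m \<cdot> z\<close> does, so it descends along
  \<open>e\<close>. This returns every chase from the refined domain to the original one.\<close>

lemma mono_lift_local:
  assumes "is_mono S m" "m \<in> homset S A B" "cover e" "e \<in> homset S X' X" "x \<in> homset S X B"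
    "z \<in> homset S X' A" "m \<cdot> z = x \<cdot> e"
  shows "\<exists>y\<in>homset S X A. m \<cdot> y = x"
proof -
  obtain l where l: "is_kernel S l e"
    using has_kernel assms(4) by auto
  note lD = kernelD[OF l]
  have "m \<cdot> (z \<cdot> l) = x \<cdot> (e \<cdot> l)"
    using comp_reduce[OF assms(7), of l] assms lD by simp
  also have "\<dots> = ZeroArr S (Dom S l) B"
    using lD assms by simp
  finally have "z \<cdot> l = ZeroArr S (Dom S l) A"
    using mono_zero[OF assms(1), of "z \<cdot> l" "Dom S l"] assms lD by simp
  then obtain y where y: "y \<in> homset S X A" "y \<cdot> e = z"
    by - (rule bexE[OF cokernel_desc[OF cover_cokernel[OF assms(3) l], of z A]];
        (erule (1) that | use assms lD in simp))
  have "(m \<cdot> y) \<cdot> e = x \<cdot> e"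
    using y assms by simp
  from epi_cancel[OF coverD(2)[OF assms(3)] this] have "m \<cdot> y = x"
    using y(1) assms by simp
  then show ?thesis
    using y(1) by blast
qed

text \<open>Pushing \<open>b\<close> out along the cokernel \<open>c\<close> of \<open>a\<close>
  models dividing the big object by the small one; (A1) keeps \<open>b'\<close> mono. If
  \<open>c'\<close> kills \<open>x\<close>, so does \<open>g\<close>, hence \<open>x\<close> lies in
  \<open>b\<close>; then mono \<open>b'\<close> shows that \<open>c\<close> kills the lift, which
  therefore lies in \<open>a\<close>.\<close>

lemma kernel_comp:
  assumes "is_kernel S a f" "is_kernel S b g" "Cod S a = Dom S b"
  shows "\<exists>h. is_kernel S (b \<cdot> a) h"
proof -
  note aD = kernelD[OF assms(1)] and bD = kernelD[OF assms(2)]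
  obtain c where c: "is_cokernel S c a"
    using has_cokernel aD by blast
  note cD = cokernelD[OF c]
  have c_hom: "c \<in> Arr S" "Dom S c = Dom S b"
    using cD assms(3) by auto
  obtain b' c' where bc: "is_pushout S b c b' c'"
    using pushout_exists[of b "Dom S b" "Cod S b" c "Cod S c"] bD c_hom by auto
  note po = pushoutD[OF bc]
  have mono: "is_mono S b'"
    using pushout_strict_mono[OF kernel_imp_strict_mono[OF assms(2)] bc]
    unfolding is_strict_mono_def by blast
  have "g \<cdot> b = ZeroArr S (Cod S c) (Cod S g) \<cdot> c"
    using bD c_hom by simp
  then obtain h where h: "h \<in> homset S (Cod S b') (Cod S g)" "h \<cdot> c' = g"
    by - (rule bexE[OF pushout_desc[OF bc, of g "Cod S g" "ZeroArr S (Cod S c) (Cod S g)"]];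
        (erule conjE, erule (2) that | use bD c_hom in simp))
  have "is_kernel S (b \<cdot> a) c'"
  proof (rule kernelI[of c' "Cod S b" "Cod S c'" _ "Dom S a"])
    have "c' \<cdot> (b \<cdot> a) = b' \<cdot> (c \<cdot> a)"
      using comp_reduce[OF po(9), of a] po(1-8) aD(2) assms(3) by simp
    then show "c' \<cdot> (b \<cdot> a) = ZeroArr S (Dom S a) (Cod S c')"
      using cD(4) po(1-8) aD(2) by simp
    show "is_mono S (b \<cdot> a)"
      using mono_comp[OF aD(5) bD(5)] assms(3) by simp
    fix X x assume x: "x \<in> homset S X (Cod S b)" "c' \<cdot> x = ZeroArr S X (Cod S c')"
    have X: "X \<in> Obj S"
      using hom_obj[OF x(1)] by simp
    have "h \<cdot> (c' \<cdot> x) = ZeroArr S X (Cod S g)"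
      unfolding x(2) using h(1) X po(1-8) by simp
    then have "g \<cdot> x = ZeroArr S X (Cod S g)"
      using comp_reduce[OF h(2), of x] h(1) x(1) po(1-8) by simp
    then obtain y where y: "y \<in> homset S X (Dom S b)" "b \<cdot> y = x"
      by - (rule bexE[OF kernel_lift[OF assms(2), of x X]]; (erule (1) that | use x(1) bD in simp))
    have "b' \<cdot> (c \<cdot> y) = c' \<cdot> (b \<cdot> y)"
      using comp_reduce[OF po(9), of y] po(1-8) y(1) by simp
    then have "b' \<cdot> (c \<cdot> y) = ZeroArr S X (Cod S b')"
      using x(2) y(2) po(1-8) by simp
    then have "c \<cdot> y = ZeroArr S X (Cod S c)"
      using mono_zero[OF mono, of "c \<cdot> y" X] po(1-8) y(1) c_hom by simp
    moreover have "is_kernel S a c"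
      using kernel_of_cokernel[OF assms(1) c] .
    ultimately obtain z where z: "z \<in> homset S X (Dom S a)" "a \<cdot> z = y"
      by - (rule bexE[OF kernel_lift[of a c y X]]; (erule (1) that | use y(1) c_hom in simp))
    then show "\<exists>z\<in>homset S X (Dom S a). b \<cdot> a \<cdot> z = x"
      using aD bD assms(3) y by (intro bexI[of _ z]) simp_all
  qed (use po aD bD assms(3) in simp_all)
  then show ?thesis by blast
qed

end

section \<open>\<open>p\<close>-divisible groups as towers\<close>

context additive_category
begin

lemma mult_by_zero_mult:
  assumes "x \<in> homset S X A" "mult_by m A \<cdot> x = ZeroArr S X A"
  shows "mult_by (n * m) A \<cdot> x = ZeroArr S X A"
proof -
  note obj = hom_obj[OF assms(1)]
  have "mult_by (n * m) A \<cdot> x = mult_by n A \<cdot> (mult_by m A \<cdot> x)"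
    using assms(1) obj by (simp add: mult_by_mult)
  also have "\<dots> = ZeroArr S X A"
    unfolding assms(2) using obj by simp
  finally show ?thesis .
qed

lemma zero_object_hom:
  assumes "is_zero_object S Z"
  shows "f \<in> homset S X Z \<Longrightarrow> f = ZeroArr S X Z" "f \<in> homset S Z X \<Longrightarrow> f = ZeroArr S Z X"
proof -
  have Z: "Z \<in> Obj S"
    using assms unfolding is_zero_object_def is_initial_def by blast
  show "f = ZeroArr S X Z" if f: "f \<in> homset S X Z"
  proof -
    have "ZeroArr S X Z \<in> homset S X Z"
      using hom_obj[OF f] Z by simp
    then show ?thesis
      using assms f hom_obj(1)[OF f] unfolding is_zero_object_def is_terminal_def by blast
  qed
  show "f = ZeroArr S Z X" if f: "f \<in> homset S Z X"
  proof -
    have "ZeroArr S Z X \<in> homset S Z X"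
      using hom_obj[OF f] Z by simp
    then show ?thesis
      using assms f hom_obj(2)[OF f] unfolding is_zero_object_def is_initial_def by blast
  qed
qed

lemma zero_objectI:
  assumes "A \<in> Obj S" "Ide S A = ZeroArr S A A"
  shows "is_zero_object S A"
proof -
  have "f = ZeroArr S X A" if f: "f \<in> homset S X A" for f X
  proof -
    have "f = Ide S A \<cdot> f"
      using f by simp
    also have "\<dots> = ZeroArr S X A"
      unfolding assms(2) using f assms(1) by simp
    finally show ?thesis .
  qed
  moreover have "f = ZeroArr S A X" if f: "f \<in> homset S A X" for f X
  proof -
    have "f = f \<cdot> Ide S A"
      using f by simp
    also have "\<dots> = ZeroArr S A X"
      unfolding assms(2) using f assms(1) by simp
    finally show ?thesis .
  qed
  moreover have "ZeroArr S X A \<in> homset S X A" "ZeroArr S A X \<in> homset S A X" if "X \<in> Obj S" for X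
    using that assms(1) by simp_all
  ultimately show ?thesis
    unfolding is_zero_object_def is_initial_def is_terminal_def using assms(1) by blast
qed

end

text \<open>A \<open>p\<close>-divisible group in terms of consecutive levels only: \<open>j n\<close> is multiplication by \<open>p\<close>,
  corestricted to \<open>C n\<close>. The general \<open>j\<^bsub>n,n-m\<^esub>\<close> are composites of these.\<close>

locale p_tower = special_preabelian_category S for S (structure) +
  fixes p :: nat and C i j
  assumes zero_obj: "is_zero_object S (C 0)"
    and i_hom: "i n \<in> homset S (C n) (C (Suc n))"
    and i_mono: "is_mono S (i n)"
    and j_hom: "j n \<in> homset S (C (Suc n)) (C n)"
    and j_cover: "cover (j n)"
    and ij: "i n \<cdot> j n = mult_by p (C (Suc n))"
    and torsion_Suc: "\<lbrakk>x \<in> homset S X (C (Suc n)); mult_by (p ^ n) (C (Suc n)) \<cdot> x = ZeroArr S X (C (Suc n))\<rbrakk>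
      \<Longrightarrow> \<exists>y\<in>homset S X (C n). i n \<cdot> y = x"
begin

lemma tower_arr [simp]:
  "C n \<in> Obj S" "i n \<in> Arr S" "Dom S (i n) = C n" "Cod S (i n) = C (Suc n)"
  "j n \<in> Arr S" "Dom S (j n) = C (Suc n)" "Cod S (j n) = C n"
  using i_hom[of n] j_hom[of n] hom_obj(1)[OF i_hom[of n]] by simp_all

lemma ji: "j n \<cdot> i n = mult_by p (C n)"
proof -
  have "i n \<cdot> (j n \<cdot> i n) = i n \<cdot> mult_by p (C n)"
    using comp_reduce[OF ij, of n "i n"] mult_by_natural[of "i n" "C n" "C (Suc n)" p] by simp
  from mono_cancel[OF i_mono this] show ?thesis
    by simp
qed

text \<open>On \<open>C (Suc n)\<close>, multiplication by \<open>p\<close> is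
  \<open>i n \<cdot> j n\<close> and passes through \<open>C n\<close>, where the remaining factor
  \<open>p ^ n\<close> vanishes.\<close>

lemma killed: "mult_by (p ^ n) (C n) = ZeroArr S (C n) (C n)"
proof (induction n)
  case 0
  show ?case
    by (rule zero_object_hom(1)[OF zero_obj]) simp
next
  case (Suc n)
  have "mult_by (p ^ Suc n) (C (Suc n)) = mult_by (p ^ n) (C (Suc n)) \<cdot> mult_by p (C (Suc n))"
    using mult_by_mult[of "C (Suc n)" "p ^ n" p] by (simp add: mult.commute)
  also have "\<dots> = (mult_by (p ^ n) (C (Suc n)) \<cdot> i n) \<cdot> j n"
    unfolding ij[symmetric] by simp
  also have "\<dots> = (i n \<cdot> mult_by (p ^ n) (C n)) \<cdot> j n"
    using mult_by_natural[of "i n" "C n" "C (Suc n)" "p ^ n"] by simp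
  also have "\<dots> = ZeroArr S (C (Suc n)) (C (Suc n))"
    unfolding Suc.IH by simp
  finally show ?case .
qed

abbreviation t where "t \<equiv> iter_trans S C i"

lemma t_arr [simp]: "t m k \<in> Arr S" "Dom S (t m k) = C m" "Cod S (t m k) = C (m + k)"
  by (induction k) simp_all

lemma t_mono: "is_mono S (t m k)"
  by (induction k) (simp_all add: mono_ide mono_comp i_mono)

text \<open>Multiplication by \<open>p ^ k\<close> on \<open>C (m + k)\<close>, corestricted to
  \<open>C m\<close>.\<close>

primrec J where
  "J m 0 = Ide S (C m)"
| "J m (Suc k) = J m k \<cdot> j (m + k)"

lemma J_arr [simp]: "J m k \<in> Arr S" "Dom S (J m k) = C (m + k)" "Cod S (J m k) = C m"
  by (induction k) simp_all

lemma J_cover: "cover (J m k)"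
proof (induction k)
  case (Suc k)
  show ?case
    using cover_comp[OF j_cover, of "m + k" _ _ "J m k" "C m"] Suc by simp
qed (simp add: cover_ide)

lemma tJ: "t m k \<cdot> J m k = mult_by (p ^ k) (C (m + k))"
proof (induction k)
  case (Suc k)
  let ?A = "C (Suc (m + k))"
  have "t m (Suc k) \<cdot> J m (Suc k) = i (m + k) \<cdot> ((t m k \<cdot> J m k) \<cdot> j (m + k))"
    by simp
  also have "\<dots> = (i (m + k) \<cdot> mult_by (p ^ k) (C (m + k))) \<cdot> j (m + k)"
    unfolding Suc by simp
  also have "\<dots> = (mult_by (p ^ k) ?A \<cdot> i (m + k)) \<cdot> j (m + k)"
    using mult_by_natural[of "i (m + k)" "C (m + k)" ?A "p ^ k"] by simp
  also have "\<dots> = mult_by (p ^ k) ?A \<cdot> (i (m + k) \<cdot> j (m + k))"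
    by simp
  also have "\<dots> = mult_by (p ^ Suc k) ?A"
    unfolding ij using mult_by_mult[of ?A "p ^ k" p] by (simp add: mult.commute)
  finally show ?case by simp
qed simp

text \<open>Together with \<open>killed\<close>, this makes \<open>C m\<close> the
  \<open>p ^ m\<close>-torsion of every later level. An element killed by \<open>p ^ m\<close> is
  also killed by \<open>p ^ (m + k)\<close>, so it comes down one level at a time.\<close>

lemma torsion:
  assumes "x \<in> homset S X (C (m + k))" "mult_by (p ^ m) (C (m + k)) \<cdot> x = ZeroArr S X (C (m + k))"
  shows "\<exists>y\<in>homset S X (C m). t m k \<cdot> y = x"
  using assms
proof (induction k arbitrary: x)
  case 0
  then show ?case
    by (intro bexI[of _ x]) simp_all
next
  case (Suc k)
  let ?A = "C (Suc (m + k))"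
  have x: "x \<in> homset S X ?A" "mult_by (p ^ m) ?A \<cdot> x = ZeroArr S X ?A"
    using Suc.prems by simp_all
  have "mult_by (p ^ (m + k)) ?A \<cdot> x = ZeroArr S X ?A"
    using mult_by_zero_mult[OF x, of "p ^ k"] by (simp add: power_add mult.commute)
  then obtain z where z: "z \<in> homset S X (C (m + k))" "i (m + k) \<cdot> z = x"
    using torsion_Suc[OF x(1)] by blast
  have "i (m + k) \<cdot> (mult_by (p ^ m) (C (m + k)) \<cdot> z) = mult_by (p ^ m) ?A \<cdot> (i (m + k) \<cdot> z)"
    using z(1) comp_reduce[OF mult_by_natural[of "i (m + k)" "C (m + k)" ?A "p ^ m"], of z] by simp
  also have "\<dots> = ZeroArr S X ?A"
    using z(2) x(2) by simp
  finally have "mult_by (p ^ m) (C (m + k)) \<cdot> z = ZeroArr S X (C (m + k))"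
    using mono_zero[OF i_mono, of "m + k" "mult_by (p ^ m) (C (m + k)) \<cdot> z" X] z(1) by simp
  then obtain y where y: "y \<in> homset S X (C m)" "t m k \<cdot> y = z"
    using Suc.IH[OF z(1)] by blast
  then show ?case
    using z by (intro bexI[of _ y]) simp_all
qed

text \<open>As \<open>t k m\<close> is mono, \<open>J k m\<close> kills exactly what
  \<open>p ^ m\<close> kills, and that is \<open>C m\<close>. The indices are exchanged: the
  inclusion starts at \<open>m\<close>, the quotient ends at \<open>k\<close>.\<close>

lemma t_kernel_J: "is_kernel S (t m k) (J k m)"
proof -
  have eq: "t k m \<cdot> J k m = mult_by (p ^ m) (C (m + k))"
    using tJ[of k m] by (simp add: add.commute)
  have km: "C (k + m) = C (m + k)"
    by (simp add: add.commute)
  show ?thesis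
  proof (rule kernelI[of _ "C (m + k)" "C k" _ "C m"])
    have "t k m \<cdot> (J k m \<cdot> t m k) = mult_by (p ^ m) (C (m + k)) \<cdot> t m k"
      using comp_reduce[OF eq, of "t m k"] km by simp
    also have "\<dots> = t m k \<cdot> mult_by (p ^ m) (C m)"
      by (rule mult_by_natural) simp_all
    also have "\<dots> = ZeroArr S (C m) (C (k + m))"
      unfolding killed using km by simp
    finally show "J k m \<cdot> t m k = ZeroArr S (C m) (C k)"
      using mono_zero[OF t_mono, of k m "J k m \<cdot> t m k" "C m"] km by simp
    fix X x assume x: "x \<in> homset S X (C (m + k))" "J k m \<cdot> x = ZeroArr S X (C k)"
    have "mult_by (p ^ m) (C (m + k)) \<cdot> x = t k m \<cdot> (J k m \<cdot> x)"
      using comp_reduce[OF eq, of x] x(1) km by simp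
    also have "\<dots> = ZeroArr S X (C (m + k))"
      unfolding x(2) using hom_obj[OF x(1)] km by simp
    finally show "\<exists>y\<in>homset S X (C m). t m k \<cdot> y = x"
      by (rule torsion[OF x(1)])
  qed (simp_all add: km t_mono)
qed

lemma p_divisible: "p_divisible_group S p C i"
  unfolding p_divisible_group_def
proof (intro conjI allI impI)
  fix n
  \<comment> \<open>\<open>t n 1\<close> is \<open>i n\<close>, so each transition map is the kernel
    of a map to \<open>C 1\<close>.\<close>
  have "is_kernel S (t n 1) (J 1 n)"
    by (rule t_kernel_J)
  then show "is_strict_mono S (i n)"
    using kernel_imp_strict_mono by simp
next
  fix m n :: nat assume "m \<le> n"
  then obtain k where n: "n = m + k"
    using le_Suc_ex by blast
  have km: "C (k + m) = C (m + k)"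
    by (simp add: add.commute)
  have "is_cokernel S (J k m) (t m k)"
    using cover_cokernel[OF J_cover t_kernel_J] .
  then have "short_exact S (C m) (t m k) (C n) (J k m) (C (n - m))"
    unfolding short_exact_def using t_kernel_J n km by simp
  moreover have "t k m \<cdot> J k m = mult_by (p ^ m) (C n)"
    using tJ[of k m] n by (simp add: add.commute)
  ultimately show "\<exists>q. short_exact S (C m) (trans_map S C i m n) (C n) q (C (n - m)) \<and>
      trans_map S C i (n - m) n \<cdot> q = mult_by (p ^ m) (C n)"
    unfolding trans_map_def n by auto
qed (simp_all add: zero_obj)

end

context special_preabelian_category
begin

text \<open>The maps \<open>j n\<close> come from the exact sequences with m = 1. The torsion
  condition comes from the sequence with m = n inside level n + 1: there \<open>p ^ n\<close> is
  \<open>q\<close> followed by a monomorphism, so it kills only the kernel \<open>C n\<close> of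
  \<open>q\<close>.\<close>

lemma p_divisible_group_tower:
  assumes "p_divisible_group S p C i"
  shows "\<exists>j. p_tower S p C i j"
proof -
  have obj: "\<And>n. C n \<in> Obj S" and zero: "is_zero_object S (C 0)"
    and i: "\<And>n. i n \<in> homset S (C n) (C (Suc n))" "\<And>n. is_mono S (i n)"
    and ses: "\<And>m n. m \<le> n \<Longrightarrow> \<exists>q. short_exact S (C m) (trans_map S C i m n) (C n) q (C (n - m)) \<and>
      trans_map S C i (n - m) n \<cdot> q = mult_by (p ^ m) (C n)"
    using assms unfolding p_divisible_group_def is_strict_mono_def by blast+
  have tr: "trans_map S C i n (Suc n) = i n" for n
    using i(1)[of n] by (simp add: trans_map_def)
  have "\<exists>q. short_exact S (C 1) (trans_map S C i 1 (Suc n)) (C (Suc n)) q (C n) \<and>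
      i n \<cdot> q = mult_by p (C (Suc n))" for n
    using ses[of 1 "Suc n"] by (simp add: tr)
  then obtain j where j: "\<And>n. short_exact S (C 1) (trans_map S C i 1 (Suc n)) (C (Suc n)) (j n) (C n)"
    "\<And>n. i n \<cdot> j n = mult_by p (C (Suc n))"
    by metis
  have "p_tower S p C i j"
  proof
    show "is_zero_object S (C 0)" by fact
    fix n
    show "i n \<in> homset S (C n) (C (Suc n))" "is_mono S (i n)" "i n \<cdot> j n = mult_by p (C (Suc n))"
      by (fact i j)+
    show "j n \<in> homset S (C (Suc n)) (C n)" "cover (j n)"
      using j(1)[of n] unfolding short_exact_def cover_def by blast+
    fix X x assume x: "x \<in> homset S X (C (Suc n))"
      "mult_by (p ^ n) (C (Suc n)) \<cdot> x = ZeroArr S X (C (Suc n))"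
    let ?t = "trans_map S C i 1 (Suc n)"
    obtain q where q: "short_exact S (C n) (i n) (C (Suc n)) q (C 1)"
      and tq: "?t \<cdot> q = mult_by (p ^ n) (C (Suc n))"
      using ses[of n "Suc n"] tr by auto
    have t_hom: "?t \<in> homset S (C 1) (C (Suc n))" and t_mono: "is_mono S ?t"
      using j(1)[of n] kernelD(5) unfolding short_exact_def by blast+
    have q_hom: "q \<in> homset S (C (Suc n)) (C 1)" and q_ker: "is_kernel S (i n) q"
      using q unfolding short_exact_def by blast+
    have "?t \<cdot> (q \<cdot> x) = ZeroArr S X (C (Suc n))"
      using comp_reduce[OF tq, of x] t_hom q_hom x by simp
    then have "q \<cdot> x = ZeroArr S X (C 1)"
      using mono_zero[OF t_mono, of "q \<cdot> x" X] t_hom q_hom x(1) by simp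
    then show "\<exists>y\<in>homset S X (C n). i n \<cdot> y = x"
      using kernel_lift[OF q_ker, of x X] x(1) q_hom i(1)[of n] by simp
  qed
  then show ?thesis by blast
qed

end

section \<open>Extending the filtration by one level\<close>

context additive_category
begin

lemma pullback_sym:
  assumes "is_pullback S f g f' g'"
  shows "is_pullback S g f g' f'"
  unfolding is_pullback_def
proof (intro conjI ballI impI)
  note D = pullbackD[OF assms]
  fix X x y assume *: "X \<in> Obj S" "x \<in> homset S X (Dom S g)" "y \<in> homset S X (Dom S f)" "g \<cdot> x = f \<cdot> y"
  have "\<forall>X\<in>Obj S. \<forall>x\<in>homset S X (Dom S f). \<forall>y\<in>homset S X (Dom S g). f \<cdot> x = g \<cdot> y \<longrightarrow>
      (\<exists>!h. h \<in> homset S X (Dom S f') \<and> g' \<cdot> h = x \<and> f' \<cdot> h = y)"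
    using assms unfolding is_pullback_def by (elim conjE)
  from this[rule_format, OF *(1,3,2) *(4)[symmetric]]
  show "\<exists>!h. h \<in> homset S X (Dom S g') \<and> f' \<cdot> h = x \<and> g' \<cdot> h = y"
    unfolding D(8) by (simp only: conj_commute[of "f' \<cdot> _ = x"])
qed (use pullbackD[OF assms] in simp_all)

lemma pullback_eqI:
  assumes "is_pullback S f g f' g'" "x \<in> homset S X (Dom S f')" "y \<in> homset S X (Dom S f')"
    "f' \<cdot> x = f' \<cdot> y" "g' \<cdot> x = g' \<cdot> y"
  shows "x = y"
proof -
  note D = pullbackD[OF assms(1)]
  have eq: "f \<cdot> (g' \<cdot> y) = g \<cdot> (f' \<cdot> y)"
    using comp_reduce[OF D(9), of y] D(1-8) assms(3) by simp
  have "\<forall>X\<in>Obj S. \<forall>x\<in>homset S X (Dom S f). \<forall>y\<in>homset S X (Dom S g). f \<cdot> x = g \<cdot> y \<longrightarrow>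
      (\<exists>!h. h \<in> homset S X (Dom S f') \<and> g' \<cdot> h = x \<and> f' \<cdot> h = y)"
    using assms(1) unfolding is_pullback_def by (elim conjE)
  note univ = this[rule_format, OF hom_obj(1)[OF assms(2)] _ _ eq]
  have "\<exists>!h. h \<in> homset S X (Dom S f') \<and> g' \<cdot> h = g' \<cdot> y \<and> f' \<cdot> h = f' \<cdot> y"
    by (rule univ) (use D(1-8) assms(3) in simp_all)
  then show ?thesis
    using assms by blast
qed

text \<open>Base change of a kernel: an element \<open>x\<close> is killed by
  \<open>f \<cdot> g\<close> exactly when \<open>g \<cdot> x\<close> lies in \<open>h\<close>, that
  is, when \<open>x\<close> lies in \<open>e\<close>.\<close>

lemma pullback_kernel:
  assumes "is_pullback S h g e g'" "is_kernel S h f"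
  shows "is_kernel S e (f \<cdot> g)"
proof -
  note D = pullbackD[OF assms(1)] and hD = kernelD[OF assms(2)]
  have e_mono: "is_mono S e"
  proof (rule monoI)
    fix x assume x: "x \<in> Arr S" "Cod S x = Dom S e" "e \<cdot> x = ZeroArr S (Dom S x) (Cod S e)"
    have "h \<cdot> (g' \<cdot> x) = g \<cdot> (e \<cdot> x)"
      using comp_reduce[OF D(9), of x] D(1-8) x(1,2) by simp
    also have "\<dots> = ZeroArr S (Dom S x) (Cod S h)"
      unfolding x(3) using D(1-8) x(1) by simp
    finally have "g' \<cdot> x = ZeroArr S (Dom S x) (Dom S h)"
      using mono_zero[OF hD(5), of "g' \<cdot> x" "Dom S x"] D(1-8) x(1,2) by simp
    then show "x = ZeroArr S (Dom S x) (Dom S e)"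
      by - (rule pullback_eqI[OF assms(1), of x "Dom S x"], use x D(1-8) in simp_all)
  qed (use D in simp)
  show ?thesis
  proof (rule kernelI[of _ "Dom S g" "Cod S f" e "Dom S e"])
    have "(f \<cdot> g) \<cdot> e = f \<cdot> (h \<cdot> g')"
      using D hD(1,3) by simp
    also have "\<dots> = ZeroArr S (Dom S e) (Cod S f)"
      using comp_reduce[OF hD(4), of g'] D(1-8) hD(1-3) by simp
    finally show "(f \<cdot> g) \<cdot> e = ZeroArr S (Dom S e) (Cod S f)" .
    fix X x assume x: "x \<in> homset S X (Dom S g)" "(f \<cdot> g) \<cdot> x = ZeroArr S X (Cod S f)"
    have "f \<cdot> (g \<cdot> x) = ZeroArr S X (Cod S f)"
      using x D(1-8) hD(1-3) by simp
    then obtain y where y: "y \<in> homset S X (Dom S h)" "h \<cdot> y = g \<cdot> x"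
      by - (rule bexE[OF kernel_lift[OF assms(2), of "g \<cdot> x" X]];
          (erule (1) that | use x(1) D(1-8) hD(1-3) in simp))
    show "\<exists>z\<in>homset S X (Dom S e). e \<cdot> z = x"
      using pullback_lift[OF assms(1) y(1) x(1) y(2)] by blast
  qed (use D(1-8) hD(1-3) e_mono in simp_all)
qed

end

text \<open>\<open>H'\<close> meets \<open>C n\<close> in \<open>H\<close>, and \<open>p H' = H\<close>.\<close>

definition (in p_tower) next_level :: "nat \<Rightarrow> _ \<Rightarrow> _ \<Rightarrow> _ \<Rightarrow> _ \<Rightarrow> bool" where
  "next_level n A h A' h' \<longleftrightarrow>
    (\<exists>u\<in>homset S A A'. h' \<cdot> u = i n \<cdot> h) \<and>
    (\<forall>X. \<forall>x\<in>homset S X (C n). \<forall>y\<in>homset S X A'. i n \<cdot> x = h' \<cdot> y \<longrightarrow>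
      (\<exists>z\<in>homset S X A. h \<cdot> z = x)) \<and>
    (\<exists>g\<in>homset S A' A. cover g \<and> h \<cdot> g = j n \<cdot> h')"

text \<open>The hypothesis on Ext is phrased in \<open>S\<close> with a middle term killed by
  \<open>p\<close>, so the chase can stay in \<open>S\<close>; the passage from the subcategory is
  made once, when the locale is interpreted.\<close>

locale p_tower_extension = p_tower S p C i j for S (structure) and p C i j +
  fixes \<alpha> \<beta> D\<^sub>1 D\<^sub>2
  assumes ses: "short_exact S D\<^sub>1 \<alpha> (C (Suc 0)) \<beta> D\<^sub>2"
    and ext: "\<lbrakk>short_exact S D\<^sub>2 a E b D\<^sub>1; mult_by p E = ZeroArr S E E\<rbrakk> \<Longrightarrow> splits S b"
begin

lemma ab_arr [simp]:
  "\<alpha> \<in> Arr S" "Dom S \<alpha> = D\<^sub>1" "Cod S \<alpha> = C (Suc 0)"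
  "\<beta> \<in> Arr S" "Dom S \<beta> = C (Suc 0)" "Cod S \<beta> = D\<^sub>2"
  using ses unfolding short_exact_def by simp_all

lemma ab_obj [simp]: "D\<^sub>1 \<in> Obj S" "D\<^sub>2 \<in> Obj S"
  using arr_obj[of \<alpha>] arr_obj[of \<beta>] by simp_all

lemma ab_exact: "is_kernel S \<alpha> \<beta>" "cover \<beta>" "\<beta> \<cdot> \<alpha> = ZeroArr S D\<^sub>1 D\<^sub>2" "is_mono S \<alpha>"
  using ses kernelD(4,5)[of \<alpha> \<beta>] unfolding short_exact_def cover_def by auto

lemma D1_killed: "mult_by p D\<^sub>1 = ZeroArr S D\<^sub>1 D\<^sub>1"
proof -
  have "\<alpha> \<cdot> mult_by p D\<^sub>1 = mult_by p (C (Suc 0)) \<cdot> \<alpha>"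
    using mult_by_natural[of \<alpha> D\<^sub>1 "C (Suc 0)" p] by simp
  also have "\<dots> = ZeroArr S D\<^sub>1 (C (Suc 0))"
    using killed[of 1] by simp
  finally show ?thesis
    using mono_zero[OF ab_exact(4), of "mult_by p D\<^sub>1" D\<^sub>1] by simp
qed

text \<open>The invariant of \<open>H = H\<^bsub>n+1\<^esub>\<close> inside \<open>C (n + 1)\<close> which carries the construction of the next
  level: \<open>H\<close> meets \<open>C 1\<close> in \<open>D\<^sub>1\<close>, every element of \<open>H\<close> killed by \<open>p\<^sup>n\<close> is divisible by \<open>p\<close> in \<open>H\<close>
  (on a cover), and \<open>p\<^sup>n H = D\<^sub>1\<close>.\<close>

definition level :: "nat \<Rightarrow> _ \<Rightarrow> _ \<Rightarrow> bool" where
  "level n A h \<longleftrightarrow> h \<in> homset S A (C (Suc n)) \<and> (\<exists>f. is_kernel S h f) \<and>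
    (\<exists>a\<in>homset S D\<^sub>1 A. h \<cdot> a = t (Suc 0) n \<cdot> \<alpha>) \<and>
    (\<forall>X. \<forall>x\<in>homset S X (C (Suc 0)). \<forall>y\<in>homset S X A. t (Suc 0) n \<cdot> x = h \<cdot> y \<longrightarrow>
      (\<exists>z\<in>homset S X D\<^sub>1. \<alpha> \<cdot> z = x)) \<and>
    (\<forall>X. \<forall>y\<in>homset S X A. mult_by (p ^ n) A \<cdot> y = ZeroArr S X A \<longrightarrow>
      (\<exists>X'. \<exists>e\<in>homset S X' X. \<exists>z\<in>homset S X' A. cover e \<and> mult_by p A \<cdot> z = y \<cdot> e)) \<and>
    (\<exists>g\<in>homset S A D\<^sub>1. cover g \<and> \<alpha> \<cdot> g = J (Suc 0) n \<cdot> h)"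

lemma level_0: "level 0 D\<^sub>1 \<alpha>"
  unfolding level_def
proof (intro conjI allI ballI impI)
  show "\<exists>f. is_kernel S \<alpha> f"
    using ab_exact(1) by blast
  show "\<exists>a\<in>homset S D\<^sub>1 D\<^sub>1. \<alpha> \<cdot> a = t (Suc 0) 0 \<cdot> \<alpha>"
    by (intro bexI[of _ "Ide S D\<^sub>1"]) simp_all
  fix X y assume y: "y \<in> homset S X D\<^sub>1" "mult_by (p ^ 0) D\<^sub>1 \<cdot> y = ZeroArr S X D\<^sub>1"
  have X: "X \<in> Obj S"
    using hom_obj(1)[OF y(1)] .
  \<comment> \<open>At the start the torsion in question is for \<open>p ^ 0\<close>, so
    \<open>y\<close> vanishes and is divisible by \<open>p\<close> trivially.\<close>
  have y0: "y = ZeroArr S X D\<^sub>1"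
    using y by simp
  show "\<exists>X'. \<exists>e\<in>homset S X' X. \<exists>z\<in>homset S X' D\<^sub>1. cover e \<and> mult_by p D\<^sub>1 \<cdot> z = y \<cdot> e"
    by (rule exI[of _ X], rule bexI[of _ "Ide S X"], rule bexI[of _ y])
      (simp_all add: D1_killed X y0 cover_ide)
next
  show "\<exists>g\<in>homset S D\<^sub>1 D\<^sub>1. cover g \<and> \<alpha> \<cdot> g = J (Suc 0) 0 \<cdot> \<alpha>"
    by (intro bexI[of _ "Ide S D\<^sub>1"]) (simp_all add: cover_ide)
next
  fix X x y assume "x \<in> homset S X (C (Suc 0))" "y \<in> homset S X D\<^sub>1" "t (Suc 0) 0 \<cdot> x = \<alpha> \<cdot> y"
  then show "\<exists>z\<in>homset S X D\<^sub>1. \<alpha> \<cdot> z = x"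
    by (intro bexI[of _ y]) simp_all
qed simp

lemma next_level_exists:
  assumes "level n A h"
  shows "\<exists>A' h'. level (Suc n) A' h' \<and> next_level (Suc n) A h A' h'"
proof -
  define N where "N = Suc n"
  have N: "Suc n = N" "Suc (Suc n) = Suc N"
    by (simp_all add: N_def)
  have t_N: "t (Suc 0) N = i N \<cdot> t (Suc 0) n"
    by (simp add: N_def)
  \<comment> \<open>Dictionary: \<open>A\<close> is H_N inside \<open>C N\<close> and
    \<open>G\<close> is the next level. \<open>T\<close> includes C_1 into \<open>C N\<close>, and
    \<open>J'\<close> is multiplication by \<open>p ^ n\<close> from \<open>C N\<close> onto C_1.
    Folding these keeps the typing goals short.\<close>
  define G T J' where "G = C (Suc N)" and "T = t (Suc 0) n" and "J' = J (Suc 0) n"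
  have [simp]: "G \<in> Obj S" "i N \<in> Arr S" "Dom S (i N) = C N" "Cod S (i N) = G"
    "j N \<in> Arr S" "Dom S (j N) = G" "Cod S (j N) = C N"
    "T \<in> Arr S" "Dom S T = C (Suc 0)" "Cod S T = C N"
    "J' \<in> Arr S" "Dom S J' = C N" "Cod S J' = C (Suc 0)"
    by (simp_all add: G_def T_def J'_def N_def)
  have J_N: "J (Suc 0) N = J' \<cdot> j N" and TJ: "T \<cdot> J' = mult_by (p ^ n) (C N)"
    using tJ[of "Suc 0" n] by (simp_all add: T_def J'_def N_def)
  have T_mono: "is_mono S T"
    unfolding T_def by (rule t_mono)
  have jiN: "j N \<cdot> i N = mult_by p (C N)" and ijN: "i N \<cdot> j N = mult_by p G"
    using ji ij by (simp_all add: G_def)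
  have iT_ker: "is_kernel S (i N \<cdot> T) (j N)"
    using t_kernel_J[of "Suc 0" N] by (simp add: t_N T_def)
  have i_ker: "is_kernel S (i N) (J (Suc 0) N)"
    using t_kernel_J[of N "Suc 0"] by (simp add: G_def)
  note G_def [symmetric, simp]
  obtain h_hom: "h \<in> homset S A (C N)"
    and h_ker: "\<exists>f. is_kernel S h f"
    and ex_a: "\<exists>a\<in>homset S D\<^sub>1 A. h \<cdot> a = T \<cdot> \<alpha>"
    and level_meet: "\<And>X x y. \<lbrakk>x \<in> homset S X (C (Suc 0)); y \<in> homset S X A; T \<cdot> x = h \<cdot> y\<rbrakk>
      \<Longrightarrow> \<exists>z\<in>homset S X D\<^sub>1. \<alpha> \<cdot> z = x"
    and level_div: "\<And>X y. \<lbrakk>y \<in> homset S X A; mult_by (p ^ n) A \<cdot> y = ZeroArr S X A\<rbrakk>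
      \<Longrightarrow> \<exists>X'. \<exists>e\<in>homset S X' X. \<exists>z\<in>homset S X' A. cover e \<and> mult_by p A \<cdot> z = y \<cdot> e"
    and ex_g: "\<exists>g\<in>homset S A D\<^sub>1. cover g \<and> \<alpha> \<cdot> g = J' \<cdot> h"
    using assms unfolding level_def N T_def[symmetric] J'_def[symmetric] by blast
  obtain f where f: "is_kernel S h f"
    using h_ker by blast
  have h_mono: "is_mono S h"
    using kernelD(5)[OF f] .
  have A: "A \<in> Obj S"
    using hom_obj(1)[OF h_hom] .
  have [simp]: "A \<in> Obj S" "h \<in> Arr S" "Dom S h = A" "Cod S h = C N"
    using h_hom A by simp_all
  obtain a where "a \<in> homset S D\<^sub>1 A" and ha: "h \<cdot> a = T \<cdot> \<alpha>"
    using ex_a by blast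
  then have [simp]: "a \<in> Arr S" "Dom S a = D\<^sub>1" "Cod S a = A"
    by simp_all
  obtain g where "g \<in> homset S A D\<^sub>1" and g: "cover g" "\<alpha> \<cdot> g = J' \<cdot> h"
    using ex_g by blast
  then have [simp]: "g \<in> Arr S" "Dom S g = A" "Cod S g = D\<^sub>1"
    by simp_all

  text \<open>\<open>E\<close> is the preimage of the subobject \<open>A\<close> of \<open>C N\<close> under \<open>j N\<close>, and \<open>Q = E / A\<close> the
    extension of \<open>D\<^sub>1\<close> by \<open>D\<^sub>2\<close> to be split.\<close>
  obtain e j' where pb: "is_pullback S h (j N) e j'"
    using pullback_exists[OF h_hom, of "j N" G] by auto
  note pbD = pullbackD[OF pb]
  define E where "E = Dom S e"
  have [simp]: "e \<in> Arr S" "Dom S e = E" "Cod S e = G" "j' \<in> Arr S" "Dom S j' = E" "Cod S j' = A"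
    using pbD by (simp_all add: E_def)
  have [simp]: "E \<in> Obj S"
    using arr_obj[of e] by simp
  have hj: "h \<cdot> j' = j N \<cdot> e"
    using pbD by simp
  have j'_cover: "cover j'"
    using pullback_strict_epi[OF cover_imp_strict_epi[OF j_cover] pullback_sym[OF pb]]
    by (rule strict_epi_imp_cover)
  have e_ker: "is_kernel S e (f \<cdot> j N)"
    using pullback_kernel[OF pb f] .
  have e_mono: "is_mono S e"
    using kernelD(5)[OF e_ker] .
  have lift_E: "\<exists>z\<in>homset S X E. j' \<cdot> z = x \<and> e \<cdot> z = y"
    if "x \<in> homset S X A" "y \<in> homset S X G" "h \<cdot> x = j N \<cdot> y" for X x y
    using pullback_lift[OF pb, of x X y] that by simp
  have h_mult: "h \<cdot> (mult_by m A \<cdot> x) = mult_by m (C N) \<cdot> (h \<cdot> x)"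
    if "x \<in> homset S X A" for m X x
    using comp_reduce[OF mult_by_natural[of h A "C N" m], of x] that by simp

  \<comment> \<open>\<open>A\<close> lies in \<open>E\<close> because p maps \<open>A\<close> into
    itself; inside \<open>E\<close>, the map \<open>j'\<close> acts on \<open>A\<close> as
    p.\<close>
  have "h \<cdot> mult_by p A = j N \<cdot> (i N \<cdot> h)"
    using comp_reduce[OF jiN, of h] mult_by_natural[of h A "C N" p] by simp
  then obtain u where "u \<in> homset S A E" and ju: "j' \<cdot> u = mult_by p A" and eu: "e \<cdot> u = i N \<cdot> h"
    using lift_E[of "mult_by p A" A "i N \<cdot> h"] by auto
  then have [simp]: "u \<in> Arr S" "Dom S u = A" "Cod S u = E"
    by simp_all
  \<comment> \<open>Composing the kernels \<open>h\<close> and \<open>i N\<close> relies on (A1). It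
    makes \<open>u\<close> a kernel, hence the kernel of its own cokernel \<open>q\<close>, so
    vanishing in \<open>Q\<close> will mean lying in \<open>A\<close>.\<close>
  obtain f' where "is_kernel S (i N \<cdot> h) f'"
    using kernel_comp[OF f i_ker] by auto
  then have u_ker: "is_kernel S u (f' \<cdot> e)"
    using kernel_through_mono[of e u f'] e_mono eu by simp
  obtain q where q: "is_cokernel S q u"
    using has_cokernel[of u] by auto
  note qD = cokernelD[OF q]
  define Q where "Q = Cod S q"
  have [simp]: "q \<in> Arr S" "Dom S q = E" "Cod S q = Q"
    using qD by (simp_all add: Q_def)
  have [simp]: "Q \<in> Obj S"
    using arr_obj[of q] by simp
  have qu: "q \<cdot> u = ZeroArr S A Q"
    using qD(4) by simp
  have q_cover: "cover q"
    using q cover_def by blast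
  have uq_ker: "is_kernel S u q"
    using kernel_of_cokernel[OF u_ker q] .

  \<comment> \<open>C_1 is the kernel of \<open>j N\<close>, so it lies in \<open>E\<close> over the
    zero of \<open>A\<close>.\<close>
  have "h \<cdot> ZeroArr S (C (Suc 0)) A = j N \<cdot> (i N \<cdot> T)"
    using kernelD(4)[OF iT_ker] by simp
  then obtain k where "k \<in> homset S (C (Suc 0)) E"
    and jk: "j' \<cdot> k = ZeroArr S (C (Suc 0)) A" and ek: "e \<cdot> k = i N \<cdot> T"
    using lift_E[of "ZeroArr S (C (Suc 0)) A" "C (Suc 0)" "i N \<cdot> T"] by auto
  then have [simp]: "k \<in> Arr S" "Dom S k = C (Suc 0)" "Cod S k = E"
    by simp_all

  have "e \<cdot> (k \<cdot> \<alpha>) = e \<cdot> (u \<cdot> a)"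
    using comp_reduce[OF ek, of \<alpha>] comp_reduce[OF eu, of a] ha by simp
  from mono_cancel[OF e_mono this] have k\<alpha>: "k \<cdot> \<alpha> = u \<cdot> a"
    by simp
  \<comment> \<open>D_1 lies in \<open>A\<close> and dies in \<open>Q\<close>, so C_1 -> Q descends
    to the quotient D_2.\<close>
  have "(q \<cdot> k) \<cdot> \<alpha> = ZeroArr S D\<^sub>1 Q"
    using k\<alpha> comp_reduce[OF qu, of a] by simp
  then obtain w where "w \<in> homset S D\<^sub>2 Q" and w\<beta>: "w \<cdot> \<beta> = q \<cdot> k"
    using cokernel_desc[OF cover_cokernel[OF ab_exact(2,1)], of "q \<cdot> k" Q] by auto
  then have [simp]: "w \<in> Arr S" "Dom S w = D\<^sub>2" "Cod S w = Q"
    by simp_all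

  \<comment> \<open>The map onto D_1 is induced by \<open>j'\<close> followed by \<open>g\<close>,
    which is p^n on \<open>A\<close>. It factors through \<open>Q\<close> because \<open>j'\<close>
    acts on \<open>A\<close> as p and p kills D_1.\<close>
  have "g \<cdot> mult_by p A = ZeroArr S A D\<^sub>1"
    using mult_by_natural[of g A D\<^sub>1 p] D1_killed by simp
  then have "(g \<cdot> j') \<cdot> u = ZeroArr S A D\<^sub>1"
    using ju by simp
  then obtain v where "v \<in> homset S Q D\<^sub>1" and vq: "v \<cdot> q = g \<cdot> j'"
    using cokernel_desc[OF q, of "g \<cdot> j'" D\<^sub>1] by auto
  then have [simp]: "v \<in> Arr S" "Dom S v = Q" "Cod S v = D\<^sub>1"
    by simp_all
  have v_cover: "cover v"
    using cover_of_comp_cover[of v q E Q D\<^sub>1] cover_comp[OF j'_cover _ g(1), of E A D\<^sub>1] vq by simp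

  have "(v \<cdot> w) \<cdot> \<beta> = ZeroArr S D\<^sub>2 D\<^sub>1 \<cdot> \<beta>"
    using w\<beta> comp_reduce[OF vq, of k] jk by simp
  from epi_cancel[OF coverD(2)[OF ab_exact(2)] this] have vw: "v \<cdot> w = ZeroArr S D\<^sub>2 D\<^sub>1"
    by simp

  \<comment> \<open>An element \<open>z\<close> of \<open>E\<close> whose image in \<open>A\<close>
    is killed by p^n lies, on a cover, in C_1 + A. By the divisibility invariant this image is also
    p z' for some z' in \<open>A\<close>, so z - z' is killed by \<open>j N\<close> and comes from
    C_1.\<close>
  have key: "\<exists>X' c z' b. cover c \<and> c \<in> homset S X' X \<and> z' \<in> homset S X' A \<and> b \<in> homset S X' (C (Suc 0)) \<and>
      z \<cdot> c = AddArr S (k \<cdot> b) (u \<cdot> z')"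
    if z: "z \<in> homset S X E" "mult_by (p ^ n) A \<cdot> (j' \<cdot> z) = ZeroArr S X A" for X z
  proof -
    obtain X' c z' where c: "c \<in> homset S X' X" "z' \<in> homset S X' A" "cover c"
      and mz': "mult_by p A \<cdot> z' = (j' \<cdot> z) \<cdot> c"
      using level_div[of "j' \<cdot> z" X] z by auto
    let ?s = "diff (z \<cdot> c) (u \<cdot> z')"
    have s: "?s \<in> homset S X' E"
      using z(1) c by simp
    have X': "X' \<in> Obj S"
      using hom_obj(1)[OF c(1)] .
    have "j' \<cdot> (z \<cdot> c) = j' \<cdot> (u \<cdot> z')"
      using z(1) c(1,2) mz' comp_reduce[OF ju, of z'] by simp
    then have js: "j' \<cdot> ?s = ZeroArr S X' A"
      using z(1) c(1,2) by simp
    have "j N \<cdot> (e \<cdot> ?s) = h \<cdot> (j' \<cdot> ?s)"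
      using s comp_reduce[OF hj, of ?s] by (simp del: comp_diff)
    also have "\<dots> = ZeroArr S X' (C N)"
      unfolding js using X' by simp
    finally have "j N \<cdot> (e \<cdot> ?s) = ZeroArr S X' (C N)" .
    then have "\<exists>b\<in>homset S X' (C (Suc 0)). (i N \<cdot> T) \<cdot> b = e \<cdot> ?s"
      using kernel_lift[OF iT_ker, of "e \<cdot> ?s" X'] s by (simp del: comp_diff)
    then obtain b where b: "b \<in> homset S X' (C (Suc 0))" "(i N \<cdot> T) \<cdot> b = e \<cdot> ?s"
      by blast
    have "e \<cdot> (k \<cdot> b) = e \<cdot> ?s"
      using b comp_reduce[OF ek, of b] by (simp del: comp_diff)
    from mono_cancel[OF e_mono this] have "k \<cdot> b = ?s"
      using b(1) s by (simp del: comp_diff)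
    then have "z \<cdot> c = AddArr S (k \<cdot> b) (u \<cdot> z')"
      using z(1) c(1,2) by simp
    then show ?thesis
      using b(1) c by blast
  qed

  \<comment> \<open>If \<open>w\<close> kills a class represented by \<open>z\<close> in C_1, then
    \<open>z\<close> lies in \<open>A\<close>, hence in D_1 by the invariant, so its class in D_2 is
    zero.\<close>
  have w_mono: "is_mono S w"
  proof (rule monoI)
    fix x assume x: "x \<in> Arr S" "Cod S x = Dom S w" "w \<cdot> x = ZeroArr S (Dom S x) (Cod S w)"
    then have x2: "x \<in> homset S (Dom S x) D\<^sub>2"
      by simp
    obtain X' c z where c: "cover c" "c \<in> homset S X' (Dom S x)" and z: "z \<in> homset S X' (C (Suc 0))"
      and \<beta>z: "\<beta> \<cdot> z = x \<cdot> c"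
      using cover_lift[OF ab_exact(2) _ x2, of "C (Suc 0)"] by auto
    have "q \<cdot> (k \<cdot> z) = w \<cdot> (x \<cdot> c)"
      using comp_reduce[OF w\<beta>, of z] z \<beta>z by simp
    also have "\<dots> = ZeroArr S X' Q"
      using comp_reduce[OF x(3), of c] x c(2) by simp
    finally have "q \<cdot> (k \<cdot> z) = ZeroArr S X' Q" .
    then have "\<exists>y\<in>homset S X' A. u \<cdot> y = k \<cdot> z"
      using kernel_lift[OF uq_ker, of "k \<cdot> z" X'] z by simp
    then obtain y where y: "y \<in> homset S X' A" "u \<cdot> y = k \<cdot> z"
      by blast
    have "i N \<cdot> (T \<cdot> z) = i N \<cdot> (h \<cdot> y)"
      using y z comp_reduce[OF ek, of z] comp_reduce[OF eu, of y] by simp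
    from mono_cancel[OF i_mono this] have "T \<cdot> z = h \<cdot> y"
      using y(1) z by simp
    then obtain d where d: "d \<in> homset S X' D\<^sub>1" "\<alpha> \<cdot> d = z"
      using level_meet[OF z y(1)] by blast
    have "\<beta> \<cdot> (\<alpha> \<cdot> d) = ZeroArr S X' D\<^sub>2"
      using comp_reduce[OF ab_exact(3), of d] d(1) by simp
    then have "x \<cdot> c = ZeroArr S (Dom S c) D\<^sub>2"
      using d(2) \<beta>z c(2) by simp
    then show "x = ZeroArr S (Dom S x) (Dom S w)"
      using epi_zero[OF coverD(2)[OF c(1)], of x D\<^sub>2] x2 c(2) by simp
  qed simp

  \<comment> \<open>An element of \<open>Q\<close> killed by \<open>v\<close> lifts to
    \<open>E\<close>, where its image in \<open>A\<close> is killed by \<open>g\<close> and so by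
    p^n. Now \<open>key\<close> applies, and modulo \<open>A\<close> only the part from C_1
    survives.\<close>
  have w_ker: "is_kernel S w v"
  proof (rule kernelI[of _ Q D\<^sub>1 _ D\<^sub>2])
    fix X y assume y: "y \<in> homset S X Q" "v \<cdot> y = ZeroArr S X D\<^sub>1"
    obtain X1 c1 z where c1: "cover c1" "c1 \<in> homset S X1 X" and z: "z \<in> homset S X1 E"
      and qz: "q \<cdot> z = y \<cdot> c1"
      using cover_lift[OF q_cover _ y(1), of E] by auto
    have X1: "X1 \<in> Obj S"
      using hom_obj(1)[OF z] .
    have "g \<cdot> (j' \<cdot> z) = v \<cdot> (y \<cdot> c1)"
      using comp_reduce[OF vq, of z] z qz by simp
    also have "\<dots> = ZeroArr S X1 D\<^sub>1"
      using comp_reduce[OF y(2), of c1] y(1) c1(2) by simp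
    finally have gjz: "g \<cdot> (j' \<cdot> z) = ZeroArr S X1 D\<^sub>1" .
    have "h \<cdot> (mult_by (p ^ n) A \<cdot> (j' \<cdot> z)) = T \<cdot> (J' \<cdot> (h \<cdot> (j' \<cdot> z)))"
      using h_mult[of "j' \<cdot> z" X1 "p ^ n"] comp_reduce[OF TJ, of "h \<cdot> (j' \<cdot> z)"] z by simp
    also have "J' \<cdot> (h \<cdot> (j' \<cdot> z)) = \<alpha> \<cdot> (g \<cdot> (j' \<cdot> z))"
      using comp_reduce[OF g(2), of "j' \<cdot> z"] z by simp
    also have "T \<cdot> (\<alpha> \<cdot> (g \<cdot> (j' \<cdot> z))) = ZeroArr S X1 (C N)"
      unfolding gjz using X1 by simp
    finally have "mult_by (p ^ n) A \<cdot> (j' \<cdot> z) = ZeroArr S X1 A"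
      using mono_zero[OF h_mono, of "mult_by (p ^ n) A \<cdot> (j' \<cdot> z)" X1] z by simp
    from key[OF z this] obtain X' c z' b where c: "cover c" "c \<in> homset S X' X1"
      and z': "z' \<in> homset S X' A" and b: "b \<in> homset S X' (C (Suc 0))"
      and zc: "z \<cdot> c = AddArr S (k \<cdot> b) (u \<cdot> z')"
      by blast
    have "y \<cdot> (c1 \<cdot> c) = q \<cdot> (z \<cdot> c)"
      using comp_reduce[OF qz, of c] y(1) c1(2) c(2) z by simp
    also have "\<dots> = AddArr S (q \<cdot> (k \<cdot> b)) (q \<cdot> (u \<cdot> z'))"
      unfolding zc using b z' by simp
    also have "\<dots> = w \<cdot> (\<beta> \<cdot> b)"
      using comp_reduce[OF w\<beta>, of b] comp_reduce[OF qu, of z'] b z' by simp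
    finally have "w \<cdot> (\<beta> \<cdot> b) = y \<cdot> (c1 \<cdot> c)" ..
    then show "\<exists>x\<in>homset S X D\<^sub>2. w \<cdot> x = y"
      using mono_lift_local[OF w_mono _ cover_comp[OF c(1,2) c1(1,2)] _ y(1), of D\<^sub>2 X' "\<beta> \<cdot> b"] b c(2) c1(2)
      by simp
  qed (simp_all add: vw w_mono)

  \<comment> \<open>On \<open>G\<close>, p is \<open>i N \<cdot> j N\<close>, and \<open>j N\<close>
    sends \<open>E\<close> into \<open>A\<close>. Hence p vanishes on \<open>Q\<close>, as the Ext
    hypothesis requires.\<close>
  have "e \<cdot> mult_by p E = e \<cdot> (u \<cdot> j')"
    using mult_by_natural[of e E G p] comp_reduce[OF ijN, of e] comp_reduce[OF eu, of j'] hj by simp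
  from mono_cancel[OF e_mono this] have "mult_by p E = u \<cdot> j'"
    by simp
  then have "mult_by p Q \<cdot> q = ZeroArr S Q Q \<cdot> q"
    using mult_by_natural[of q E Q p] comp_reduce[OF qu, of j'] by simp
  from epi_cancel[OF qD(5) this] have "mult_by p Q = ZeroArr S Q Q"
    by simp
  moreover have "short_exact S D\<^sub>2 w Q v D\<^sub>1"
    unfolding short_exact_def using w_ker cover_cokernel[OF v_cover w_ker] by simp
  ultimately obtain s where "s \<in> homset S D\<^sub>1 Q" and vs: "v \<cdot> s = Ide S D\<^sub>1"
    using ext unfolding splits_def by fastforce
  then have [simp]: "s \<in> Arr S" "Dom S s = D\<^sub>1" "Cod S s = Q"
    by simp_all
  \<comment> \<open>The section \<open>s\<close> is turned into a retraction: 1 - s v is killed by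
    \<open>v\<close>, so it factors through \<open>w\<close>.\<close>
  have "v \<cdot> diff (Ide S Q) (s \<cdot> v) = ZeroArr S Q D\<^sub>1"
    using comp_reduce[OF vs, of v] by simp
  then obtain r' where r': "r' \<in> homset S Q D\<^sub>2" and wr: "w \<cdot> r' = diff (Ide S Q) (s \<cdot> v)"
    using kernel_lift[OF w_ker, of "diff (Ide S Q) (s \<cdot> v)" Q] by auto
  have "w \<cdot> (r' \<cdot> w) = w \<cdot> Ide S D\<^sub>2"
    using comp_reduce[OF wr, of w] r' vw by simp
  from mono_cancel[OF w_mono this] have r'w: "r' \<cdot> w = Ide S D\<^sub>2"
    using r' by simp

  \<comment> \<open>\<open>r\<close> kills \<open>A\<close> and restricts to \<beta> on C_1, so its
    kernel contains \<open>A\<close> and meets C_1 exactly in D_1.\<close>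
  define r where "r = r' \<cdot> q"
  have [simp]: "r \<in> Arr S" "Dom S r = E" "Cod S r = D\<^sub>2"
    using r' by (simp_all add: r_def)
  have ru: "r \<cdot> u = ZeroArr S A D\<^sub>2" and rk: "r \<cdot> k = \<beta>"
    using r' qu w\<beta>[symmetric] comp_reduce[OF r'w, of \<beta>] by (simp_all add: r_def)
  obtain l where l: "is_kernel S l r"
    using has_kernel[of r] by auto
  note lD = kernelD[OF l]
  define A' where "A' = Dom S l"
  have [simp]: "l \<in> Arr S" "Dom S l = A'" "Cod S l = E"
    using lD by (simp_all add: A'_def)
  have [simp]: "A' \<in> Obj S"
    using arr_obj[of l] by simp
  have rl: "r \<cdot> l = ZeroArr S A' D\<^sub>2"
    using lD(4) by simp
  define h' where "h' = e \<cdot> l"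
  have h'_hom [simp]: "h' \<in> Arr S" "Dom S h' = A'" "Cod S h' = G"
    by (simp_all add: h'_def)
  have h'_ker: "\<exists>f. is_kernel S h' f"
    unfolding h'_def using kernel_comp[OF l e_ker] by simp
  then have h'_mono: "is_mono S h'"
    using kernelD(5) by blast
  have h'_mult: "h' \<cdot> (mult_by m A' \<cdot> x) = mult_by m G \<cdot> (h' \<cdot> x)"
    if "x \<in> homset S X A'" for m X x
    using comp_reduce[OF mult_by_natural[of h' A' G m], of x] that by simp

  obtain u' where u': "u' \<in> homset S A A'" "l \<cdot> u' = u"
    using kernel_lift[OF l, of u A] ru by auto
  have h'u': "h' \<cdot> u' = i N \<cdot> h"
    using u' eu by (simp add: h'_def)

  \<comment> \<open>Since p^N kills \<open>C N\<close>, the element p x of \<open>A\<close> is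
    killed by p^n, and \<open>key\<close> writes \<open>l \<cdot> y\<close> as a part in C_1 plus a
    part in \<open>A\<close>. Applying \<open>r\<close> kills the \<beta>-image of the first part,
    which therefore lies in D_1 and so in \<open>A\<close> as well.\<close>
  have meet: "\<exists>z\<in>homset S X A. h \<cdot> z = x"
    if x: "x \<in> homset S X (C N)" and y: "y \<in> homset S X A'" and xy: "i N \<cdot> x = h' \<cdot> y" for X x y
  proof -
    have "h \<cdot> (j' \<cdot> (l \<cdot> y)) = j N \<cdot> (h' \<cdot> y)"
      using comp_reduce[OF hj, of "l \<cdot> y"] y by (simp add: h'_def)
    also have "\<dots> = mult_by p (C N) \<cdot> x"
      unfolding xy[symmetric] using comp_reduce[OF jiN, of x] x by simp
    finally have hx: "h \<cdot> (j' \<cdot> (l \<cdot> y)) = mult_by p (C N) \<cdot> x" .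
    have "h \<cdot> (mult_by (p ^ n) A \<cdot> (j' \<cdot> (l \<cdot> y))) = mult_by (p ^ n) (C N) \<cdot> (mult_by p (C N) \<cdot> x)"
      using h_mult[of "j' \<cdot> (l \<cdot> y)" X "p ^ n"] y hx by simp
    also have "\<dots> = mult_by (p ^ N) (C N) \<cdot> x"
      using mult_by_mult[of "C N" "p ^ n" p] x by (simp add: N_def mult.commute)
    also have "\<dots> = ZeroArr S X (C N)"
      using killed[of N] x by simp
    finally have "mult_by (p ^ n) A \<cdot> (j' \<cdot> (l \<cdot> y)) = ZeroArr S X A"
      using mono_zero[OF h_mono, of "mult_by (p ^ n) A \<cdot> (j' \<cdot> (l \<cdot> y))" X] y by simp
    moreover have "l \<cdot> y \<in> homset S X E"
      using y by simp
    ultimately obtain X' c z' b where c: "cover c" "c \<in> homset S X' X"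
      and z': "z' \<in> homset S X' A" and b: "b \<in> homset S X' (C (Suc 0))"
      and zc: "(l \<cdot> y) \<cdot> c = AddArr S (k \<cdot> b) (u \<cdot> z')"
      using key by blast
    have "r \<cdot> (l \<cdot> (y \<cdot> c)) = ZeroArr S X' D\<^sub>2"
      using comp_reduce[OF rl, of "y \<cdot> c"] y c(2) by simp
    moreover have "r \<cdot> (l \<cdot> (y \<cdot> c)) = r \<cdot> AddArr S (k \<cdot> b) (u \<cdot> z')"
      using zc y c(2) by (simp del: comp_add_arr)
    moreover have "\<dots> = \<beta> \<cdot> b"
      using comp_reduce[OF rk, of b] comp_reduce[OF ru, of z'] b z' by simp
    ultimately have "\<beta> \<cdot> b = ZeroArr S X' D\<^sub>2"
      by simp
    then have "\<exists>d\<in>homset S X' D\<^sub>1. \<alpha> \<cdot> d = b"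
      using kernel_lift[OF ab_exact(1), of b X'] b by simp
    then obtain d where d: "d \<in> homset S X' D\<^sub>1" "\<alpha> \<cdot> d = b"
      by blast
    have "i N \<cdot> (x \<cdot> c) = e \<cdot> ((l \<cdot> y) \<cdot> c)"
      using comp_reduce[OF xy, of c] x y c(2) by (simp add: h'_def)
    also have "\<dots> = AddArr S (i N \<cdot> (T \<cdot> b)) (i N \<cdot> (h \<cdot> z'))"
      unfolding zc using comp_reduce[OF ek, of b] comp_reduce[OF eu, of z'] b z' by simp
    also have "T \<cdot> b = h \<cdot> (a \<cdot> d)"
      unfolding d(2)[symmetric] using comp_reduce[OF ha, of d] d(1) by simp
    also have "AddArr S (i N \<cdot> (h \<cdot> (a \<cdot> d))) (i N \<cdot> (h \<cdot> z')) = i N \<cdot> (h \<cdot> AddArr S (a \<cdot> d) z')"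
      using d(1) z' by simp
    finally have "i N \<cdot> (x \<cdot> c) = i N \<cdot> (h \<cdot> AddArr S (a \<cdot> d) z')" .
    from mono_cancel[OF i_mono this] have "h \<cdot> AddArr S (a \<cdot> d) z' = x \<cdot> c"
      using x c(2) d(1) z' by (simp del: comp_add_arr)
    then show ?thesis
      using mono_lift_local[OF h_mono h_hom c x, of "AddArr S (a \<cdot> d) z'"] d(1) z'
      by (simp del: comp_add_arr)
  qed

  define g' where "g' = j' \<cdot> l"
  have [simp]: "g' \<in> Arr S" "Dom S g' = A'" "Cod S g' = A"
    by (simp_all add: g'_def)
  have hg': "h \<cdot> g' = j N \<cdot> h'"
    using comp_reduce[OF hj, of l] by (simp add: g'_def h'_def)
  \<comment> \<open>Any element of \<open>E\<close> can be moved into \<open>A'\<close> by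
    subtracting an element of C_1 with the same value under \<open>r\<close>. This does not change
    its image under \<open>j'\<close>, so \<open>A'\<close> still covers \<open>A\<close>.\<close>
  have g'_cover: "cover g'"
  proof -
    obtain X c z where c: "cover c" "c \<in> homset S X E" and z: "z \<in> homset S X (C (Suc 0))"
      and \<beta>z: "\<beta> \<cdot> z = r \<cdot> c"
      using cover_lift[OF ab_exact(2), of "C (Suc 0)" D\<^sub>2 r E] by auto
    have X: "X \<in> Obj S"
      using hom_obj(1)[OF z] .
    have "r \<cdot> diff c (k \<cdot> z) = ZeroArr S X D\<^sub>2"
      using comp_reduce[OF rk, of z] \<beta>z c(2) z by simp
    then have "\<exists>y\<in>homset S X A'. l \<cdot> y = diff c (k \<cdot> z)"
      using kernel_lift[OF l, of "diff c (k \<cdot> z)" X] c(2) z by simp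
    then obtain y where y: "y \<in> homset S X A'" "l \<cdot> y = diff c (k \<cdot> z)"
      by blast
    have "g' \<cdot> y = j' \<cdot> diff c (k \<cdot> z)"
      using y by (simp add: g'_def)
    also have "\<dots> = j' \<cdot> c"
      using comp_reduce[OF jk, of z] c(2) z X by simp
    finally have "g' \<cdot> y = j' \<cdot> c" .
    moreover have "cover (j' \<cdot> c)"
      using cover_comp[OF c j'_cover] by simp
    ultimately show ?thesis
      using cover_of_comp_cover[of g' y X A' A] y(1) by simp
  qed

  have "next_level N A h A' h'"
    unfolding next_level_def
  proof (intro conjI allI ballI impI)
    show "\<exists>u\<in>homset S A A'. h' \<cdot> u = i N \<cdot> h"
      using u'(1) h'u' by blast
    show "\<exists>g\<in>homset S A' A. cover g \<and> h \<cdot> g = j N \<cdot> h'"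
      using g'_cover hg' by (intro bexI[of _ g']) simp_all
  qed (rule meet)
  moreover have "level N A' h'"
    unfolding level_def G_def[symmetric]
  proof (intro conjI allI ballI impI)
    show "h' \<in> homset S A' G"
      by simp
    show "\<exists>a\<in>homset S D\<^sub>1 A'. h' \<cdot> a = t (Suc 0) N \<cdot> \<alpha>"
      unfolding t_N T_def[symmetric] using u'(1) comp_reduce[OF h'u', of a] ha
      by (intro bexI[of _ "u' \<cdot> a"]) simp_all
  next
    fix X x y assume x: "x \<in> homset S X (C (Suc 0))" and y: "y \<in> homset S X A'"
      and "t (Suc 0) N \<cdot> x = h' \<cdot> y"
    then have "i N \<cdot> (T \<cdot> x) = h' \<cdot> y"
      unfolding t_N T_def[symmetric] by simp
    then have "\<exists>z\<in>homset S X A. h \<cdot> z = T \<cdot> x"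
      using meet[of "T \<cdot> x" X y] x y by simp
    then obtain z where z: "z \<in> homset S X A" "h \<cdot> z = T \<cdot> x"
      by blast
    show "\<exists>z\<in>homset S X D\<^sub>1. \<alpha> \<cdot> z = x"
      using level_meet[OF x z(1) z(2)[symmetric]] .
  next
    \<comment> \<open>The divisibility invariant is reproduced: torsion puts \<open>y\<close> into
      \<open>C N\<close>, \<open>meet\<close> puts it into \<open>A\<close>, and there the cover
      \<open>g'\<close>, which is p on \<open>A'\<close>, divides it by p.\<close>
    fix X y assume y: "y \<in> homset S X A'" "mult_by (p ^ N) A' \<cdot> y = ZeroArr S X A'"
    have X: "X \<in> Obj S"
      using hom_obj(1)[OF y(1)] .
    have "mult_by (p ^ N) G \<cdot> (h' \<cdot> y) = ZeroArr S X G"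
      using h'_mult[OF y(1), of "p ^ N"] y(2) X by simp
    then have "\<exists>x\<in>homset S X (C N). i N \<cdot> x = h' \<cdot> y"
      using torsion_Suc[of "h' \<cdot> y" X N] y(1) by simp
    then obtain x where x: "x \<in> homset S X (C N)" "i N \<cdot> x = h' \<cdot> y"
      by blast
    obtain z where z: "z \<in> homset S X A" "h \<cdot> z = x"
      using meet[OF x(1) y(1) x(2)] by blast
    obtain X' c z' where c: "cover c" "c \<in> homset S X' X" and z': "z' \<in> homset S X' A'"
      and g'z': "g' \<cdot> z' = z \<cdot> c"
      using cover_lift[OF g'_cover _ z(1), of A'] by auto
    have "h' \<cdot> (mult_by p A' \<cdot> z') = i N \<cdot> (j N \<cdot> (h' \<cdot> z'))"
      using h'_mult[OF z', of p] comp_reduce[OF ijN, of "h' \<cdot> z'"] z' by simp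
    also have "j N \<cdot> (h' \<cdot> z') = h \<cdot> (g' \<cdot> z')"
      using comp_reduce[OF hg', of z'] z' by simp
    also have "i N \<cdot> (h \<cdot> (g' \<cdot> z')) = h' \<cdot> (y \<cdot> c)"
      unfolding g'z' using comp_reduce[OF z(2), of c] comp_reduce[OF x(2), of c] x(1) y(1) z(1) c(2) by simp
    finally have "h' \<cdot> (mult_by p A' \<cdot> z') = h' \<cdot> (y \<cdot> c)" .
    from mono_cancel[OF h'_mono this] have "mult_by p A' \<cdot> z' = y \<cdot> c"
      using z' y(1) c(2) by simp
    then show "\<exists>X'. \<exists>e\<in>homset S X' X. \<exists>z\<in>homset S X' A'. cover e \<and> mult_by p A' \<cdot> z = y \<cdot> e"
      using c z' by blast
  next
    have "\<alpha> \<cdot> (g \<cdot> g') = J' \<cdot> (j N \<cdot> h')"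
      using comp_reduce[OF g(2), of g'] hg' by simp
    then have "\<alpha> \<cdot> (g \<cdot> g') = J (Suc 0) N \<cdot> h'"
      by (simp add: J_N)
    moreover have "cover (g \<cdot> g')"
      using cover_comp[OF g'_cover _ g(1), of A' A D\<^sub>1] by simp
    ultimately show "\<exists>g\<in>homset S A' D\<^sub>1. cover g \<and> \<alpha> \<cdot> g = J (Suc 0) N \<cdot> h'"
      by (intro bexI[of _ "g \<cdot> g'"]) simp_all
  qed (rule h'_ker)
  ultimately show ?thesis
    unfolding N_def by blast
qed

end

section \<open>Subtower and quotient tower\<close>

context special_preabelian_category
begin

text \<open>Such an arrow is the cokernel of the identity.\<close>

lemma cover_to_zero_object:
  assumes "is_zero_object S Z" "f \<in> homset S X Z"
  shows "cover f"
proof -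
  have obj: "X \<in> Obj S" "Z \<in> Obj S"
    using hom_obj[OF assms(2)] .
  have f: "f = ZeroArr S X Z"
    using zero_object_hom(1)[OF assms] .
  have "is_cokernel S (ZeroArr S X Z) (Ide S X)"
  proof (rule cokernelI[of _ X X _ Z])
    show "is_epi S (ZeroArr S X Z)"
      by (rule epiI) (use zero_object_hom(2)[OF assms(1)] obj in simp_all)
    fix Y y assume y: "y \<in> homset S X Y" "y \<cdot> Ide S X = ZeroArr S X Y"
    then show "\<exists>x\<in>homset S Z Y. x \<cdot> ZeroArr S X Z = y"
      using obj hom_obj(2)[OF y(1)] by (intro bexI[of _ "ZeroArr S Z Y"]) simp_all
  qed (use obj in simp_all)
  then show ?thesis
    unfolding cover_def f by blast
qed

end

context p_tower
begin

text \<open>The condition on the meet yields the torsion condition for H and injectivity of the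
  transition maps of the quotients. The covers H_(n+1) -> H_n yield the torsion condition for the
  quotients.\<close>

lemma short_exact_subtower:
  assumes zero: "is_zero_object S (H 0)"
    and h: "\<And>n. h n \<in> homset S (H n) (C n)" "\<And>n. \<exists>f. is_kernel S (h n) f"
    and nxt: "\<And>n. next_level n (H n) (h n) (H (Suc n)) (h (Suc n))"
    and d: "\<And>n. is_cokernel S (d n) (h n)"
  shows "\<exists>i\<^sub>1 i\<^sub>2. short_exact_p_divisible S p H i\<^sub>1 h C i d (\<lambda>n. Cod S (d n)) i\<^sub>2"
proof -
  have [simp]: "h n \<in> Arr S" "Dom S (h n) = H n" "Cod S (h n) = C n" "H n \<in> Obj S" for n
    using h(1)[of n] hom_obj(1)[OF h(1)[of n]] by simp_all
  have h_mono: "is_mono S (h n)" for n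
    using h(2)[of n] kernelD(5) by blast
  have "\<exists>u. u \<in> homset S (H n) (H (Suc n)) \<and> h (Suc n) \<cdot> u = i n \<cdot> h n" for n
    using nxt[of n] unfolding next_level_def by blast
  then obtain u where u: "\<And>n. u n \<in> homset S (H n) (H (Suc n))" "\<And>n. h (Suc n) \<cdot> u n = i n \<cdot> h n"
    by metis
  have [simp]: "u n \<in> Arr S" "Dom S (u n) = H n" "Cod S (u n) = H (Suc n)" for n
    using u(1)[of n] by simp_all
  have "\<exists>g. g \<in> homset S (H (Suc n)) (H n) \<and> cover g \<and> h n \<cdot> g = j n \<cdot> h (Suc n)" for n
    using nxt[of n] unfolding next_level_def by blast
  then obtain g where g: "\<And>n. g n \<in> homset S (H (Suc n)) (H n)" "\<And>n. cover (g n)"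
    "\<And>n. h n \<cdot> g n = j n \<cdot> h (Suc n)"
    by metis
  have [simp]: "g n \<in> Arr S" "Dom S (g n) = H (Suc n)" "Cod S (g n) = H n" for n
    using g(1)[of n] by simp_all
  have meet: "\<exists>z\<in>homset S X (H n). h n \<cdot> z = x"
    if "x \<in> homset S X (C n)" "y \<in> homset S X (H (Suc n))" "i n \<cdot> x = h (Suc n) \<cdot> y" for n X x y
    using nxt[of n] that unfolding next_level_def by blast
  have h_mult: "h n \<cdot> (mult_by m (H n) \<cdot> x) = mult_by m (C n) \<cdot> (h n \<cdot> x)"
    if "x \<in> homset S X (H n)" for m n X x
    using comp_reduce[OF mult_by_natural[of "h n" "H n" "C n" m], of x] that by simp
  interpret H: p_tower S p H u g
  proof
    fix n
    have "is_mono S (h (Suc n) \<cdot> u n)"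
      unfolding u(2) using mono_comp[OF h_mono i_mono] by simp
    then show "is_mono S (u n)"
      by (rule mono_of_comp_mono) simp_all
    have "h (Suc n) \<cdot> (u n \<cdot> g n) = i n \<cdot> (j n \<cdot> h (Suc n))"
      using comp_reduce[OF u(2), of n "g n"] g(3) by simp
    also have "\<dots> = h (Suc n) \<cdot> mult_by p (H (Suc n))"
      using comp_reduce[OF ij, of n "h (Suc n)"] mult_by_natural[of "h (Suc n)" "H (Suc n)" "C (Suc n)" p] by simp
    finally have "h (Suc n) \<cdot> (u n \<cdot> g n) = h (Suc n) \<cdot> mult_by p (H (Suc n))" .
    from mono_cancel[OF h_mono this] show "u n \<cdot> g n = mult_by p (H (Suc n))"
      by simp
    fix X x assume x: "x \<in> homset S X (H (Suc n))"
      "mult_by (p ^ n) (H (Suc n)) \<cdot> x = ZeroArr S X (H (Suc n))"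
    have "mult_by (p ^ n) (C (Suc n)) \<cdot> (h (Suc n) \<cdot> x) = ZeroArr S X (C (Suc n))"
      using h_mult[OF x(1), of "p ^ n"] x(2) hom_obj(1)[OF x(1)] by simp
    then have "\<exists>y\<in>homset S X (C n). i n \<cdot> y = h (Suc n) \<cdot> x"
      using torsion_Suc[of "h (Suc n) \<cdot> x" X n] x(1) by simp
    then obtain y where y: "y \<in> homset S X (C n)" "i n \<cdot> y = h (Suc n) \<cdot> x"
      by blast
    obtain z where z: "z \<in> homset S X (H n)" "h n \<cdot> z = y"
      using meet[OF y(1) x(1) y(2)] by blast
    have "h (Suc n) \<cdot> (u n \<cdot> z) = h (Suc n) \<cdot> x"
      using comp_reduce[OF u(2), of n z] z y by simp
    from mono_cancel[OF h_mono this] have "u n \<cdot> z = x"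
      using z(1) x(1) by simp
    then show "\<exists>y\<in>homset S X (H n). u n \<cdot> y = x"
      using z(1) by blast
  qed (fact zero u(1) g(1,2))+

  define K where "K = (\<lambda>n. Cod S (d n))"
  have [simp]: "d n \<in> Arr S" "Dom S (d n) = C n" "Cod S (d n) = K n" for n
    using cokernelD(2,3)[OF d[of n]] by (simp_all add: K_def)
  have [simp]: "K n \<in> Obj S" for n
    using arr_obj(2)[of "d n"] by simp
  have d_cover: "cover (d n)" for n
    using d cover_def by blast
  have d_epi: "is_epi S (d n)" for n
    using coverD(2)[OF d_cover] .
  have dh: "d n \<cdot> h n = ZeroArr S (H n) (K n)" for n
    using cokernelD(4)[OF d[of n]] by simp
  have hd_ker: "is_kernel S (h n) (d n)" for n
    using h(2)[of n] kernel_of_cokernel d by blast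
  have d_mult: "mult_by m (K n) \<cdot> (d n \<cdot> x) = d n \<cdot> (mult_by m (C n) \<cdot> x)"
    if "x \<in> homset S X (C n)" for m n X x
    using comp_reduce[OF mult_by_natural[of "d n" "C n" "K n" m], of x] that by simp
  have "\<exists>v. v \<in> homset S (K n) (K (Suc n)) \<and> v \<cdot> d n = d (Suc n) \<cdot> i n" for n
  proof -
    have "(d (Suc n) \<cdot> i n) \<cdot> h n = ZeroArr S (H n) (K (Suc n))"
      using comp_reduce[OF dh, of "Suc n" "u n"] u(2)[of n] by simp
    then show ?thesis
      using cokernel_desc[OF d[of n], of "d (Suc n) \<cdot> i n" "K (Suc n)"] by auto
  qed
  then obtain v where v: "\<And>n. v n \<in> homset S (K n) (K (Suc n))" "\<And>n. v n \<cdot> d n = d (Suc n) \<cdot> i n"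
    by metis
  have [simp]: "v n \<in> Arr S" "Dom S (v n) = K n" "Cod S (v n) = K (Suc n)" for n
    using v(1)[of n] by simp_all
  have "\<exists>w. w \<in> homset S (K (Suc n)) (K n) \<and> w \<cdot> d (Suc n) = d n \<cdot> j n" for n
  proof -
    have "(d n \<cdot> j n) \<cdot> h (Suc n) = ZeroArr S (H (Suc n)) (K n)"
      using comp_reduce[OF dh, of n "g n"] g(3)[of n] by simp
    then show ?thesis
      using cokernel_desc[OF d[of "Suc n"], of "d n \<cdot> j n" "K n"] by auto
  qed
  then obtain w where w: "\<And>n. w n \<in> homset S (K (Suc n)) (K n)" "\<And>n. w n \<cdot> d (Suc n) = d n \<cdot> j n"
    by metis
  have [simp]: "w n \<in> Arr S" "Dom S (w n) = K (Suc n)" "Cod S (w n) = K n" for n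
    using w(1)[of n] by simp_all
  \<comment> \<open>A class that dies in the next quotient is represented by an element of
    \<open>C n\<close> lying in \<open>H (Suc n)\<close>; by \<open>meet\<close> it already lies in
    \<open>H n\<close>.\<close>
  have v_mono: "is_mono S (v n)" for n
  proof (rule monoI)
    fix x assume x: "x \<in> Arr S" "Cod S x = Dom S (v n)" "v n \<cdot> x = ZeroArr S (Dom S x) (Cod S (v n))"
    then have x2: "x \<in> homset S (Dom S x) (K n)"
      by simp
    obtain X' c z where c: "cover c" "c \<in> homset S X' (Dom S x)" and z: "z \<in> homset S X' (C n)"
      and dz: "d n \<cdot> z = x \<cdot> c"
      using cover_lift[OF d_cover _ x2, of n "C n"] by auto
    have "d (Suc n) \<cdot> (i n \<cdot> z) = v n \<cdot> (x \<cdot> c)"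
      using comp_reduce[OF v(2), of n z] z dz by simp
    also have "\<dots> = ZeroArr S X' (K (Suc n))"
      using comp_reduce[OF x(3), of c] x c(2) by simp
    finally have "d (Suc n) \<cdot> (i n \<cdot> z) = ZeroArr S X' (K (Suc n))" .
    then have "\<exists>y\<in>homset S X' (H (Suc n)). h (Suc n) \<cdot> y = i n \<cdot> z"
      using kernel_lift[OF hd_ker, of "i n \<cdot> z" X' "Suc n"] z by simp
    then obtain y where y: "y \<in> homset S X' (H (Suc n))" "h (Suc n) \<cdot> y = i n \<cdot> z"
      by blast
    obtain z' where z': "z' \<in> homset S X' (H n)" "h n \<cdot> z' = z"
      using meet[OF z y(1) y(2)[symmetric]] by blast
    have "d n \<cdot> z = ZeroArr S X' (K n)"
      using comp_reduce[OF dh, of n z'] z' by simp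
    then have "x \<cdot> c = ZeroArr S (Dom S c) (K n)"
      using dz c(2) by simp
    then show "x = ZeroArr S (Dom S x) (Dom S (v n))"
      using epi_zero[OF coverD(2)[OF c(1)], of x "K n"] x2 c(2) by simp
  qed simp
  interpret K: p_tower S p K v w
  proof
    have "Ide S (K 0) \<cdot> d 0 = d 0"
      by simp
    also have "\<dots> = ZeroArr S (C 0) (K 0)"
      by (rule zero_object_hom(2)[OF zero_obj]) simp
    also have "\<dots> = ZeroArr S (K 0) (K 0) \<cdot> d 0"
      by simp
    finally have "Ide S (K 0) \<cdot> d 0 = ZeroArr S (K 0) (K 0) \<cdot> d 0" .
    from epi_cancel[OF d_epi this] have "Ide S (K 0) = ZeroArr S (K 0) (K 0)"
      by simp
    then show "is_zero_object S (K 0)"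
      by (intro zero_objectI) simp_all
    fix n
    show "cover (w n)"
      by (rule cover_of_comp_cover[of "w n" "d (Suc n)" "C (Suc n)" "K (Suc n)" "K n"])
        (use cover_comp[OF j_cover _ d_cover, of n "C (Suc n)" "C n" n "K n"] w(2) in simp_all)
    have "(v n \<cdot> w n) \<cdot> d (Suc n) = (v n \<cdot> d n) \<cdot> j n"
      using w(2) by simp
    also have "\<dots> = mult_by p (K (Suc n)) \<cdot> d (Suc n)"
      unfolding v(2) using mult_by_natural[of "d (Suc n)" "C (Suc n)" "K (Suc n)" p] ij by simp
    finally have "(v n \<cdot> w n) \<cdot> d (Suc n) = mult_by p (K (Suc n)) \<cdot> d (Suc n)" .
    from epi_cancel[OF d_epi this] show "v n \<cdot> w n = mult_by p (K (Suc n))"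
      by simp
    let ?N = "Suc n"
    \<comment> \<open>The plan is to correct a representative \<open>z\<close> of \<open>y\<close>
      by an element of \<open>H ?N\<close> until \<open>p ^ n\<close> kills it; then it comes from
      \<open>C n\<close>. The obstruction is \<open>p ^ n\<close> times \<open>z\<close>, which lies
      in \<open>H ?N\<close>.\<close>
    fix X y assume y: "y \<in> homset S X (K ?N)" "mult_by (p ^ n) (K ?N) \<cdot> y = ZeroArr S X (K ?N)"
    obtain X1 c1 z where c1: "cover c1" "c1 \<in> homset S X1 X" and z: "z \<in> homset S X1 (C ?N)"
      and dz: "d ?N \<cdot> z = y \<cdot> c1"
      using cover_lift[OF d_cover _ y(1), of ?N "C ?N"] by auto
    have X1: "X1 \<in> Obj S"
      using hom_obj(1)[OF z] .
    have "d ?N \<cdot> (mult_by (p ^ n) (C ?N) \<cdot> z) = mult_by (p ^ n) (K ?N) \<cdot> (y \<cdot> c1)"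
      using d_mult[OF z, of "p ^ n"] dz by simp
    also have "\<dots> = ZeroArr S X1 (K ?N)"
      using comp_reduce[OF y(2), of c1] y(1) c1(2) by simp
    finally have "d ?N \<cdot> (mult_by (p ^ n) (C ?N) \<cdot> z) = ZeroArr S X1 (K ?N)" .
    then have "\<exists>a\<in>homset S X1 (H ?N). h ?N \<cdot> a = mult_by (p ^ n) (C ?N) \<cdot> z"
      using kernel_lift[OF hd_ker, of "mult_by (p ^ n) (C ?N) \<cdot> z" X1 ?N] z by simp
    then obtain a where a: "a \<in> homset S X1 (H ?N)" "h ?N \<cdot> a = mult_by (p ^ n) (C ?N) \<cdot> z"
      by blast
    have "h ?N \<cdot> (mult_by p (H ?N) \<cdot> a) = (mult_by p (C ?N) \<cdot> mult_by (p ^ n) (C ?N)) \<cdot> z"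
      using h_mult[OF a(1), of p] a(2) z by simp
    also have "\<dots> = mult_by (p ^ ?N) (C ?N) \<cdot> z"
      by (simp add: mult_by_mult)
    also have "\<dots> = ZeroArr S X1 (C ?N)"
      unfolding killed using z by simp
    \<comment> \<open>The obstruction is killed by \<open>p\<close>, because \<open>p ^ ?N\<close>
      kills \<open>C ?N\<close>. The forms \<open>p ^ 1\<close> and \<open>1 + n\<close> fit
      \<open>H.torsion\<close>, which moves it down to \<open>H 1\<close>.\<close>
    finally have "mult_by (p ^ 1) (H (1 + n)) \<cdot> a = ZeroArr S X1 (H (1 + n))"
      using mono_zero[OF h_mono, of ?N "mult_by p (H ?N) \<cdot> a" X1] a(1) by simp
    then have "\<exists>b\<in>homset S X1 (H 1). H.t 1 n \<cdot> b = a"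
      using H.torsion[of a X1 1 n] a(1) by simp
    then obtain b where b: "b \<in> homset S X1 (H 1)" "H.t 1 n \<cdot> b = a"
      by blast
    \<comment> \<open>\<open>H.J 1 n\<close> is \<open>p ^ n\<close> from \<open>H ?N\<close> onto
      \<open>H 1\<close> and is a cover, so the obstruction is \<open>p ^ n\<close> times some
      \<open>z'\<close> in \<open>H ?N\<close>.\<close>
    obtain X2 c2 z' where c2: "cover c2" "c2 \<in> homset S X2 X1" and z': "z' \<in> homset S X2 (H ?N)"
      and Jz': "H.J 1 n \<cdot> z' = b \<cdot> c2"
      using cover_lift[OF H.J_cover[of 1 n] _ b(1), of "H ?N"] by auto
    have "H.t 1 n \<cdot> (H.J 1 n \<cdot> z') = mult_by (p ^ n) (H ?N) \<cdot> z'"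
      using comp_reduce[OF H.tJ[of 1 n], of z'] z' by simp
    then have az': "mult_by (p ^ n) (H ?N) \<cdot> z' = a \<cdot> c2"
      unfolding Jz' using comp_reduce[OF b(2), of c2] b(1) c2(2) by simp
    let ?s = "diff (z \<cdot> c2) (h ?N \<cdot> z')"
    have s: "?s \<in> homset S X2 (C ?N)"
      using z c2(2) z' by simp
    have "mult_by (p ^ n) (C ?N) \<cdot> (h ?N \<cdot> z') = h ?N \<cdot> (a \<cdot> c2)"
      using h_mult[OF z', of "p ^ n"] az' by simp
    also have "\<dots> = mult_by (p ^ n) (C ?N) \<cdot> (z \<cdot> c2)"
      using comp_reduce[OF a(2), of c2] a(1) c2(2) z by simp
    finally have "mult_by (p ^ n) (C ?N) \<cdot> ?s = ZeroArr S X2 (C ?N)"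
      using z c2(2) z' by simp
    then obtain x where x: "x \<in> homset S X2 (C n)" "i n \<cdot> x = ?s"
      using torsion_Suc[OF s] by blast
    have "v n \<cdot> (d n \<cdot> x) = d ?N \<cdot> (i n \<cdot> x)"
      using comp_reduce[OF v(2), of n x] x(1) by simp
    also have "\<dots> = diff (d ?N \<cdot> (z \<cdot> c2)) (d ?N \<cdot> (h ?N \<cdot> z'))"
      unfolding x(2) using z c2(2) z' by simp
    also have "\<dots> = d ?N \<cdot> (z \<cdot> c2)"
      using comp_reduce[OF dh, of ?N z'] z c2(2) z' by simp
    also have "\<dots> = y \<cdot> (c1 \<cdot> c2)"
      using comp_reduce[OF dz, of c2] z c1(2) c2(2) y(1) by simp
    finally have "v n \<cdot> (d n \<cdot> x) = y \<cdot> (c1 \<cdot> c2)" .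
    then show "\<exists>x\<in>homset S X (K n). v n \<cdot> x = y"
      using mono_lift_local[OF v_mono _ cover_comp[OF c2 c1] _ y(1), of n "K n" X2 "d n \<cdot> x"]
        c1(2) c2(2) x(1) by simp
  qed (fact v(1) w(1) v_mono)+

  have "short_exact_p_divisible S p H u h C i d K v"
    unfolding short_exact_p_divisible_def short_exact_def
    using p_divisible H.p_divisible K.p_divisible d hd_ker u(2) v(2) by simp
  then show ?thesis
    unfolding K_def by blast
qed

end

section \<open>Assembling the filtration\<close>

context p_tower_extension
begin

text \<open>The recursion starts with D_1 at level one, while a tower starts with a zero object at
  level zero; this joins the two.\<close>

lemma next_level_0: "next_level 0 (C 0) (Ide S (C 0)) D\<^sub>1 \<alpha>"
  unfolding next_level_def
proof (intro conjI allI ballI impI)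
  have "i 0 = ZeroArr S (C 0) (C (Suc 0))"
    by (rule zero_object_hom(2)[OF zero_obj]) simp
  then show "\<exists>u\<in>homset S (C 0) D\<^sub>1. \<alpha> \<cdot> u = i 0 \<cdot> Ide S (C 0)"
    by (intro bexI[of _ "ZeroArr S (C 0) D\<^sub>1"]) simp_all
  show "\<exists>g\<in>homset S D\<^sub>1 (C 0). cover g \<and> Ide S (C 0) \<cdot> g = j 0 \<cdot> \<alpha>"
    using cover_to_zero_object[OF zero_obj, of "j 0 \<cdot> \<alpha>" D\<^sub>1]
    by (intro bexI[of _ "j 0 \<cdot> \<alpha>"]) simp_all
next
  fix X x y assume "x \<in> homset S X (C 0)"
  then show "\<exists>z\<in>homset S X (C 0). Ide S (C 0) \<cdot> z = x"
    by (intro bexI[of _ x]) simp_all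
qed

lemma exists_short_exact:
  "\<exists>C\<^sub>1 i\<^sub>1 C\<^sub>2 i\<^sub>2 \<gamma> \<delta>. short_exact_p_divisible S p C\<^sub>1 i\<^sub>1 \<gamma> C i \<delta> C\<^sub>2 i\<^sub>2 \<and> C\<^sub>1 1 = D\<^sub>1 \<and> C\<^sub>2 1 = D\<^sub>2"
proof -
  \<comment> \<open>The clause for \<open>n = 0\<close> fixes the start, so that the first subobject
    is D_1 itself and not merely isomorphic to it. Index \<open>n\<close> of the sequence stands for
    level n + 1 of the tower.\<close>
  let ?P = "\<lambda>n x. level n (fst x) (snd x) \<and> (n = 0 \<longrightarrow> x = (D\<^sub>1, \<alpha>))"
  let ?Q = "\<lambda>n x y. next_level (Suc n) (fst x) (snd x) (fst y) (snd y)"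
  have "\<exists>s. \<forall>n. ?P n (s n) \<and> ?Q n (s n) (s (Suc n))"
  proof (rule dependent_nat_choice)
    show "\<exists>x. ?P 0 x"
      using level_0 by auto
    show "\<exists>y. ?P (Suc n) y \<and> ?Q n x y" if "?P n x" for x n
      using next_level_exists[of n "fst x" "snd x"] that by auto
  qed
  then obtain s where s: "\<And>n. ?P n (s n)" "\<And>n. ?Q n (s n) (s (Suc n))"
    by blast
  define H where "H = case_nat (C 0) (\<lambda>n. fst (s n))"
  define h where "h = case_nat (Ide S (C 0)) (\<lambda>n. snd (s n))"
  have H: "H 0 = C 0" "H (Suc 0) = D\<^sub>1" and h: "h 0 = Ide S (C 0)" "h (Suc 0) = \<alpha>"
    using s(1)[of 0] by (simp_all add: H_def h_def)
  have "level n (H (Suc n)) (h (Suc n))" for n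
    using s(1)[of n] by (simp add: H_def h_def)
  then have h_Suc: "h (Suc n) \<in> homset S (H (Suc n)) (C (Suc n))" "\<exists>f. is_kernel S (h (Suc n)) f" for n
    unfolding level_def by blast+
  have h_hom: "h n \<in> homset S (H n) (C n)" for n
    by (cases n) (use h_Suc(1) h(1) H(1) in simp_all)
  have h_ker: "\<exists>f. is_kernel S (h n) f" for n
    by (cases n) (use h_Suc(2) h(1) kernel_zero_ide[of "C 0" "C 0"] in auto)
  have nxt: "next_level n (H n) (h n) (H (Suc n)) (h (Suc n))" for n
  proof (cases n)
    case 0
    then show ?thesis
      using next_level_0 H h by simp
  next
    case (Suc m)
    then show ?thesis
      using s(2)[of m] by (simp add: H_def h_def)
  qed
  have "is_cokernel S \<beta> \<alpha>"
    using cover_cokernel[OF ab_exact(2,1)] .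
  then have coker_1: "is_cokernel S \<beta> (h 1)"
    using h(2) by simp
  have "\<exists>d. is_cokernel S d (h n)" for n
    using has_cokernel[of "h n"] h_hom[of n] by simp
  \<comment> \<open>At level one the cokernel is taken to be \<beta>, so that the quotient there is
    D_2 itself.\<close>
  then have "\<exists>d. is_cokernel S d (h n) \<and> (n = 1 \<longrightarrow> d = \<beta>)" for n
    using coker_1 by blast
  then obtain d where d: "\<And>n. is_cokernel S (d n) (h n)" "d 1 = \<beta>"
    by metis
  have "\<exists>i\<^sub>1 i\<^sub>2. short_exact_p_divisible S p H i\<^sub>1 h C i d (\<lambda>n. Cod S (d n)) i\<^sub>2"
    by (rule short_exact_subtower) (use zero_obj H(1) h_hom h_ker nxt d(1) in simp_all)
  moreover have "H 1 = D\<^sub>1" "Cod S (d 1) = D\<^sub>2"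
    using H(2) d(2) by simp_all
  ultimately show ?thesis
    by blast
qed

end

section \<open>Objects killed by \<open>p\<close>\<close>

context preabelian_category
begin

lemma killed_subcategory_sel [simp]:
  "A \<in> Obj (killed_subcategory S p) \<longleftrightarrow> A \<in> Obj S \<and> mult_by p A = ZeroArr S A A"
  "f \<in> Arr (killed_subcategory S p) \<longleftrightarrow>
    f \<in> Arr S \<and> Dom S f \<in> Obj (killed_subcategory S p) \<and> Cod S f \<in> Obj (killed_subcategory S p)"
  "Dom (killed_subcategory S p) = Dom S" "Cod (killed_subcategory S p) = Cod S"
  "Ide (killed_subcategory S p) = Ide S" "Comp (killed_subcategory S p) = Comp S"
  "ZeroArr (killed_subcategory S p) = ZeroArr S"
  by (auto simp: killed_subcategory_def full_subcategory_def killed_by_def)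

lemma homset_killed_subcategory:
  "f \<in> homset (killed_subcategory S p) A B \<longleftrightarrow>
    f \<in> homset S A B \<and> A \<in> Obj (killed_subcategory S p) \<and> B \<in> Obj (killed_subcategory S p)"
  by (auto simp: homset_def)

text \<open>By naturality p commutes with \<open>f\<close>, so it vanishes after \<open>f\<close>
  and hence on \<open>A\<close>. Kernels formed in \<open>S\<close> of arrows of the subcategory
  therefore stay inside it.\<close>

lemma killed_of_mono:
  assumes "is_mono S f" "f \<in> homset S A B" "B \<in> Obj (killed_subcategory S p)"
  shows "A \<in> Obj (killed_subcategory S p)"
proof -
  have "f \<cdot> mult_by p A = ZeroArr S A B"
    using mult_by_natural[of f A B p] hom_obj[OF assms(2)] assms(2,3) by simp
  then have "mult_by p A = ZeroArr S A (Dom S f)"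
    by - (rule mono_zero[OF assms(1)], use assms(2) hom_obj[OF assms(2)] in simp_all)
  then show ?thesis
    using assms(2) hom_obj[OF assms(2)] by simp
qed

lemma killed_of_epi:
  assumes "is_epi S f" "f \<in> homset S A B" "A \<in> Obj (killed_subcategory S p)"
  shows "B \<in> Obj (killed_subcategory S p)"
proof -
  have "mult_by p B \<cdot> f = ZeroArr S A B"
    using mult_by_natural[of f A B p] hom_obj[OF assms(2)] assms(2,3) by simp
  then have "mult_by p B = ZeroArr S (Cod S f) B"
    by - (rule epi_zero[OF assms(1)], use assms(2) hom_obj[OF assms(2)] in simp_all)
  then show ?thesis
    using assms(2) hom_obj[OF assms(2)] by simp
qed

lemma short_exact_killed_subcategoryI:
  assumes "short_exact S A a E b B" "A \<in> Obj (killed_subcategory S p)"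
    "E \<in> Obj (killed_subcategory S p)" "B \<in> Obj (killed_subcategory S p)"
  shows "short_exact (killed_subcategory S p) A a E b B"
proof -
  have ab: "a \<in> homset S A E" "b \<in> homset S E B" "is_kernel S a b" "is_cokernel S b a"
    using assms(1) unfolding short_exact_def by blast+
  let ?K = "killed_subcategory S p"
  have [simp]: "a \<in> Arr S" "Dom S a = A" "Cod S a = E" "b \<in> Arr S" "Dom S b = E" "Cod S b = B"
    using ab(1,2) by simp_all
  have "is_kernel ?K a b"
    unfolding is_kernel_def
  proof (intro conjI ballI impI)
    fix X x assume x: "X \<in> Obj ?K" "x \<in> homset ?K X (Dom ?K b)"
      "b \<cdot>\<^bsub>?K\<^esub> x = ZeroArr ?K X (Cod ?K b)"
    have "\<forall>X\<in>Obj S. \<forall>x\<in>homset S X (Dom S b). b \<cdot> x = ZeroArr S X (Cod S b) \<longrightarrow>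
        (\<exists>!h. h \<in> homset S X (Dom S a) \<and> a \<cdot> h = x)"
      using ab(3) unfolding is_kernel_def by (elim conjE)
    then have "\<exists>!h. h \<in> homset S X (Dom S a) \<and> a \<cdot> h = x"
      using x by (simp add: homset_killed_subcategory del: in_homset)
    then show "\<exists>!h. h \<in> homset ?K X (Dom ?K a) \<and> a \<cdot>\<^bsub>?K\<^esub> h = x"
      using x(1) assms(2) by (simp add: homset_killed_subcategory)
  qed (use kernelD(4)[OF ab(3)] assms(2-4) in simp_all)
  moreover have "is_cokernel ?K b a"
    unfolding is_cokernel_def
  proof (intro conjI ballI impI)
    fix X x assume x: "X \<in> Obj ?K" "x \<in> homset ?K (Cod ?K a) X"
      "x \<cdot>\<^bsub>?K\<^esub> a = ZeroArr ?K (Dom ?K a) X"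
    have "\<forall>X\<in>Obj S. \<forall>x\<in>homset S (Cod S a) X. x \<cdot> a = ZeroArr S (Dom S a) X \<longrightarrow>
        (\<exists>!h. h \<in> homset S (Cod S b) X \<and> h \<cdot> b = x)"
      using ab(4) unfolding is_cokernel_def by (elim conjE)
    then have "\<exists>!h. h \<in> homset S (Cod S b) X \<and> h \<cdot> b = x"
      using x by (simp add: homset_killed_subcategory del: in_homset)
    then show "\<exists>!h. h \<in> homset ?K (Cod ?K b) X \<and> h \<cdot>\<^bsub>?K\<^esub> b = x"
      using x(1) assms(4) by (simp add: homset_killed_subcategory)
  qed (use cokernelD(4)[OF ab(4)] assms(2-4) in simp_all)
  ultimately show ?thesis
    unfolding short_exact_def homset_killed_subcategory using ab(1,2) assms(2-4) by blast
qed

lemma short_exact_killed_subcategoryD: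
  assumes "short_exact (killed_subcategory S p) A a E b B"
  shows "short_exact S A a E b B"
proof -
  let ?K = "killed_subcategory S p"
  have hom: "a \<in> homset S A E" "b \<in> homset S E B"
    and obj: "A \<in> Obj ?K" "E \<in> Obj ?K" "B \<in> Obj ?K"
    and ker: "is_kernel ?K a b" and coker: "is_cokernel ?K b a"
    using assms unfolding short_exact_def homset_killed_subcategory by blast+
  have [simp]: "a \<in> Arr S" "Dom S a = A" "Cod S a = E" "b \<in> Arr S" "Dom S b = E" "Cod S b = B"
    using hom by simp_all
  have [simp]: "A \<in> Obj S" "E \<in> Obj S" "B \<in> Obj S"
    using obj by simp_all
  have ba: "b \<cdot> a = ZeroArr S A B"
    using ker unfolding is_kernel_def by simp
  have ker_univ: "\<exists>!y. y \<in> homset S X A \<and> a \<cdot> y = x"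
    if "X \<in> Obj ?K" "x \<in> homset S X E" "b \<cdot> x = ZeroArr S X B" for X x
  proof -
    have "\<forall>X\<in>Obj ?K. \<forall>x\<in>homset ?K X E. b \<cdot> x = ZeroArr S X B \<longrightarrow> (\<exists>!y. y \<in> homset ?K X A \<and> a \<cdot> y = x)"
      using ker unfolding is_kernel_def by simp
    then have "\<exists>!y. y \<in> homset ?K X A \<and> a \<cdot> y = x"
      using that obj(2) by (simp add: homset_killed_subcategory del: in_homset)
    then show ?thesis
      using that(1) obj(1) by (simp add: homset_killed_subcategory del: in_homset)
  qed
  have coker_univ: "\<exists>!y. y \<in> homset S B X \<and> y \<cdot> b = x"
    if "X \<in> Obj ?K" "x \<in> homset S E X" "x \<cdot> a = ZeroArr S A X" for X x
  proof -
    have "\<forall>X\<in>Obj ?K. \<forall>x\<in>homset ?K E X. x \<cdot> a = ZeroArr S A X \<longrightarrow> (\<exists>!y. y \<in> homset ?K B X \<and> y \<cdot> b = x)"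
      using coker unfolding is_cokernel_def by simp
    then have "\<exists>!y. y \<in> homset ?K B X \<and> y \<cdot> b = x"
      using that obj(2) by (simp add: homset_killed_subcategory del: in_homset)
    then show ?thesis
      using that(1) obj(3) by (simp add: homset_killed_subcategory del: in_homset)
  qed

  text \<open>The kernel and cokernel in \<open>S\<close> are again killed by \<open>p\<close>, so they agree with those
    in the subcategory up to isomorphism.\<close>
  have "is_kernel S a b"
  proof -
    obtain k where k: "is_kernel S k b"
      using has_kernel[of b] by auto
    note kD = kernelD[OF k]
    define L where "L = Dom S k"
    have [simp]: "k \<in> Arr S" "Dom S k = L" "Cod S k = E"
      using kD by (simp_all add: L_def)
    have L: "L \<in> Obj ?K"
      using killed_of_mono[OF kD(5), of L E p] obj(2) by simp
    obtain y where y: "y \<in> homset S L A" "a \<cdot> y = k"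
      using ker_univ[OF L, of k] kD(4) by auto
    obtain z where z: "z \<in> homset S A L" "k \<cdot> z = a"
      using kernel_lift[OF k, of a A] ba by auto
    \<comment> \<open>The arrow \<open>a\<close> factors through itself in exactly one way, which
      forces \<open>y \<cdot> z\<close> to be the identity. So \<open>z\<close> is split mono, and
      \<open>a\<close>, being \<open>z\<close> followed by the kernel \<open>k\<close>, is mono in
      all of \<open>S\<close>.\<close>
    have "\<exists>!w. w \<in> homset S A A \<and> a \<cdot> w = a"
      using ker_univ[OF obj(1) hom(1) ba] .
    moreover have "y \<cdot> z \<in> homset S A A \<and> a \<cdot> (y \<cdot> z) = a" "Ide S A \<in> homset S A A \<and> a \<cdot> Ide S A = a"
      using comp_reduce[OF y(2), of z] y(1) z by simp_all
    ultimately have yz: "y \<cdot> z = Ide S A"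
      by blast
    have a_mono: "is_mono S a"
    proof -
      have "is_mono S z"
        by (rule mono_of_comp_mono[of y]) (use yz mono_ide y(1) z(1) in simp_all)
      then show ?thesis
        using mono_comp[OF _ kD(5), of z] z by simp
    qed
    show ?thesis
    proof (rule kernelI[OF hom(2,1) ba a_mono])
      fix X x assume x: "x \<in> homset S X E" "b \<cdot> x = ZeroArr S X B"
      then have "\<exists>t\<in>homset S X L. k \<cdot> t = x"
        using kernel_lift[OF k, of x X] by simp
      then obtain t where t: "t \<in> homset S X L" "k \<cdot> t = x"
        by blast
      show "\<exists>t\<in>homset S X A. a \<cdot> t = x"
        using comp_reduce[OF y(2), of t] y(1) t by (intro bexI[of _ "y \<cdot> t"]) simp_all
    qed
  qed
  moreover have "is_cokernel S b a"
  proof -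
    obtain c where c: "is_cokernel S c a"
      using has_cokernel[of a] by auto
    note cD = cokernelD[OF c]
    define L where "L = Cod S c"
    have [simp]: "c \<in> Arr S" "Dom S c = E" "Cod S c = L"
      using cD by (simp_all add: L_def)
    have L: "L \<in> Obj ?K"
      using killed_of_epi[OF cD(5), of E L p] obj(2) by simp
    obtain y where y: "y \<in> homset S B L" "y \<cdot> b = c"
      using coker_univ[OF L, of c] cD(4) by auto
    obtain z where z: "z \<in> homset S L B" "z \<cdot> c = b"
      using cokernel_desc[OF c, of b B] ba by auto
    have "\<exists>!w. w \<in> homset S B B \<and> w \<cdot> b = b"
      using coker_univ[OF obj(3) hom(2) ba] .
    moreover have "z \<cdot> y \<in> homset S B B \<and> (z \<cdot> y) \<cdot> b = b" "Ide S B \<in> homset S B B \<and> Ide S B \<cdot> b = b"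
      using y z by simp_all
    ultimately have zy: "z \<cdot> y = Ide S B"
      by blast
    have b_epi: "is_epi S b"
    proof -
      have "is_epi S z"
        by (rule epi_of_comp_epi[of _ y]) (use zy epi_ide y(1) z(1) in simp_all)
      then show ?thesis
        using epi_comp[OF cD(5), of z] z by simp
    qed
    show ?thesis
    proof (rule cokernelI[OF hom ba b_epi])
      fix X x assume x: "x \<in> homset S E X" "x \<cdot> a = ZeroArr S A X"
      then have "\<exists>t\<in>homset S L X. t \<cdot> c = x"
        using cokernel_desc[OF c, of x X] by simp
      then obtain t where t: "t \<in> homset S L X" "t \<cdot> c = x"
        by blast
      show "\<exists>t\<in>homset S B X. t \<cdot> b = x"
        using y t by (intro bexI[of _ "t \<cdot> y"]) simp_all
    qed
  qed
  ultimately show ?thesis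
    unfolding short_exact_def using hom by blast
qed

end

theorem theoremA2:
  fixes S :: "('o, 'a, 'm) additive_category_scheme"
    and p :: nat
    and C :: "nat \<Rightarrow> 'o" and i :: "nat \<Rightarrow> 'a"
    and D\<^sub>1 D\<^sub>2 :: 'o and \<alpha> \<beta> :: 'a
  assumes "prime p"
    and "special_preabelian_category S"
    and "consists_of_group_objects S"
    and "p_divisible_group S p C i"
    and "D\<^sub>1 \<in> Obj (killed_subcategory S p)" and "D\<^sub>2 \<in> Obj (killed_subcategory S p)"
    and "short_exact (killed_subcategory S p) D\<^sub>1 \<alpha> (C 1) \<beta> D\<^sub>2"
    and "Ext_vanishes (killed_subcategory S p) D\<^sub>1 D\<^sub>2"
  shows "\<exists>C\<^sub>1 i\<^sub>1 C\<^sub>2 i\<^sub>2 \<gamma> \<delta>.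
           short_exact_p_divisible S p C\<^sub>1 i\<^sub>1 \<gamma> C i \<delta> C\<^sub>2 i\<^sub>2 \<and> C\<^sub>1 1 = D\<^sub>1 \<and> C\<^sub>2 1 = D\<^sub>2"
proof -
  interpret special_preabelian_category S by fact
  obtain j where j: "p_tower S p C i j"
    using p_divisible_group_tower[OF assms(4)] by blast
  interpret p_tower S p C i j by fact
  interpret p_tower_extension S p C i j \<alpha> \<beta> D\<^sub>1 D\<^sub>2
  proof
    show "short_exact S D\<^sub>1 \<alpha> (C (Suc 0)) \<beta> D\<^sub>2"
      using short_exact_killed_subcategoryD[OF assms(7)] by simp
    fix a E b assume E: "short_exact S D\<^sub>2 a E b D\<^sub>1" "mult_by p E = ZeroArr S E E"
    have "a \<in> homset S D\<^sub>2 E"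
      using E(1) unfolding short_exact_def by blast
    then have "E \<in> Obj (killed_subcategory S p)"
      using E(2) hom_obj(2)[of a D\<^sub>2 E] by simp
    \<comment> \<open>All three terms are killed by \<open>p\<close>, so the sequence is exact in
      the full subcategory too, where the Ext hypothesis applies; a section found there is a section
      in \<open>S\<close>.\<close>
    then have "splits (killed_subcategory S p) b"
      using short_exact_killed_subcategoryI[OF E(1) assms(6) _ assms(5)] assms(8)
      unfolding Ext_vanishes_def by blast
    then show "splits S b"
      by (auto simp: splits_def homset_killed_subcategory)
  qed
  show ?thesis
    by (rule exists_short_exact)
qed

end
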